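(* Let $\Phi:M\rightarrow\mathbb{S}^2\times\mathbb{S}^2$ be a connected orientable hypersurface. If for some $\epsilon>0$ the parallel hypersurfaces $\Phi_t:M\rightarrow\mathbb{S}^2\times\mathbb{S}^2$, $t\in(-\epsilon,\epsilon)$, $\Phi_0=\Phi$, have constant mean curvature (each $\Phi_t$ has mean curvature constant on $M$), then $\Phi(M)$ is congruent either to an open subset of $\mathbb{S}^1(r)\times\mathbb{S}^2$ for some $r\in(0,1]$, or to an open subset of $M_t$ for some $t\in(-1,1)$.
   Context: $\mathbb{S}^2\subset\mathbb{R}^3$ is the unit sphere and $\mathbb{S}^2\times\mathbb{S}^2$ carries the product metric. A hypersurface $\Phi:M\to\mathbb{S}^2\times\mathbb{S}^2$ is a smooth immersion of a 3-manifold $M$. Given a unit normal field $N$ to $\Phi$, the parallel hypersurfaces are $\Phi_t(p)=\exp_{\Phi(p)}(tN_p)$, where $\exp$ is the exponential map of $\mathbb{S}^2\times\mathbb{S}^2$; they are understood to be immersions for $t\in(-\epsilon,\epsilon)$. The mean curvature is $H=\frac13\mathrm{tr}\,A$ with $A$ the shape operator. Congruent means related by an isometry of $\mathbb{S}^2\times\mathbb{S}^2$. For $r\in(0,1]$, $\mathbb{S}^1(r)=\{(x,y,z)\in\mathbb{S}^2 : z=\sqrt{1-r^2}\}$. For $t\in(-1,1)$, $M_t=\{(p,q)\in\mathbb{S}^2\times\mathbb{S}^2 : \langle p,q\rangle=t\}$, where $\langle p,q\rangle$ is the inner product of $\mathbb{R}^3$. *)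

theory Defs
  imports "HOL-Analysis.Analysis"
begin

section \<open>Smooth maps on open subsets of normed spaces\<close>

primrec Ck_on :: "nat \<Rightarrow> 'a::real_normed_vector set \<Rightarrow> ('a \<Rightarrow> 'b::real_normed_vector) \<Rightarrow> bool" where
  "Ck_on 0 S f \<longleftrightarrow> continuous_on S f"
| "Ck_on (Suc k) S f \<longleftrightarrow> f differentiable_on S \<and>
     (\<forall>v. Ck_on k S (\<lambda>x. frechet_derivative f (at x) v))"

definition smooth_on :: "'a::real_normed_vector set \<Rightarrow> ('a \<Rightarrow> 'b::real_normed_vector) \<Rightarrow> bool" where
  "smooth_on S f \<longleftrightarrow> open S \<and> (\<forall>k. Ck_on k S f)"


section \<open>Smooth 3-manifolds\<close>

text \<open>A manifold is a topology together with an atlas, which need not be maximal. A chart is a pair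
  of its domain and its coordinate map; values of the map off the domain are irrelevant.\<close>

type_synonym 'a chart = "'a set \<times> ('a \<Rightarrow> real^3)"

definition is_chart :: "'a topology \<Rightarrow> 'a chart \<Rightarrow> bool" where
  "is_chart M c \<longleftrightarrow> openin M (fst c) \<and> open (snd c ` fst c) \<and>
     homeomorphic_map (subtopology M (fst c)) (top_of_set (snd c ` fst c)) (snd c)"

definition chart_inv :: "'a chart \<Rightarrow> real^3 \<Rightarrow> 'a" where
  "chart_inv c = inv_into (fst c) (snd c)"

definition overlap :: "'a chart \<Rightarrow> 'a chart \<Rightarrow> (real^3) set" where
  "overlap c d = snd c ` (fst c \<inter> fst d)"

definition transition :: "'a chart \<Rightarrow> 'a chart \<Rightarrow> real^3 \<Rightarrow> real^3" where
  "transition c d = snd d \<circ> chart_inv c"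

definition smooth_atlas :: "'a topology \<Rightarrow> 'a chart set \<Rightarrow> bool" where
  "smooth_atlas M A \<longleftrightarrow> (\<forall>c\<in>A. is_chart M c) \<and> (\<Union>c\<in>A. fst c) = topspace M \<and>
     (\<forall>c\<in>A. \<forall>d\<in>A. smooth_on (overlap c d) (transition c d))"

definition smooth_3_manifold :: "'a topology \<Rightarrow> 'a chart set \<Rightarrow> bool" where
  "smooth_3_manifold M A \<longleftrightarrow> Hausdorff_space M \<and> second_countable M \<and> smooth_atlas M A"

definition orientable_manifold :: "'a topology \<Rightarrow> 'a chart set \<Rightarrow> bool" where
  "orientable_manifold M A \<longleftrightarrow>
     (\<exists>B. smooth_atlas M B \<and> smooth_atlas M (A \<union> B) \<and>
        (\<forall>c\<in>B. \<forall>d\<in>B. \<forall>x\<in>overlap c d.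
           det (matrix (frechet_derivative (transition c d) (at x))) > 0))"

definition smooth_map :: "'a chart set \<Rightarrow> ('a \<Rightarrow> 'b::real_normed_vector) \<Rightarrow> bool" where
  "smooth_map A f \<longleftrightarrow> (\<forall>c\<in>A. smooth_on (snd c ` fst c) (f \<circ> chart_inv c))"

text \<open>The differential of \<open>f\<close> at \<open>p\<close>, the tangent space at \<open>p\<close> being identified
  with \<open>real^3\<close> by the chart \<open>c\<close>.\<close>

definition chart_deriv :: "'a chart \<Rightarrow> ('a \<Rightarrow> 'b::real_normed_vector) \<Rightarrow> 'a \<Rightarrow> real^3 \<Rightarrow> 'b" where
  "chart_deriv c f p = frechet_derivative (f \<circ> chart_inv c) (at (snd c p))"


section \<open>The Riemannian manifold \<open>S2 \<times> S2\<close>\<close>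

text \<open>The inner product of the product type \<open>(real^3) \<times> (real^3)\<close> is the sum of the inner products
  of the factors, so it restricts to the product metric on the tangent spaces.\<close>

type_synonym R6 = "(real^3) \<times> (real^3)"

definition S2S2 :: "R6 set" where
  "S2S2 = sphere 0 1 \<times> sphere 0 1"

definition tangent_S2S2 :: "R6 \<Rightarrow> R6 set" where
  "tangent_S2S2 x = {w. fst w \<bullet> fst x = 0 \<and> snd w \<bullet> snd x = 0}"

definition tangent_proj :: "R6 \<Rightarrow> R6 \<Rightarrow> R6" where
  "tangent_proj x w = (fst w - (fst w \<bullet> fst x) *\<^sub>R fst x, snd w - (snd w \<bullet> snd x) *\<^sub>R snd x)"

lemma tangent_proj_orthogonal:
  assumes "x \<in> S2S2"
  shows "tangent_proj x w \<in> tangent_S2S2 x"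
    and "z \<in> tangent_S2S2 x \<Longrightarrow> (w - tangent_proj x w) \<bullet> z = 0"
  using assms
  by (auto simp: S2S2_def tangent_S2S2_def tangent_proj_def inner_prod_def inner_diff_left
      inner_diff_right dot_square_norm inner_commute)

text \<open>The covariant derivative of \<open>\<gamma>'\<close> along \<open>\<gamma>\<close> is the tangential part of \<open>\<gamma>''\<close>.\<close>

definition geodesic_S2S2 :: "(real \<Rightarrow> R6) \<Rightarrow> bool" where
  "geodesic_S2S2 \<gamma> \<longleftrightarrow> (\<forall>s. \<gamma> s \<in> S2S2) \<and>
     (\<exists>\<gamma>' \<gamma>''. \<forall>s. (\<gamma> has_vector_derivative \<gamma>' s) (at s) \<and>
        (\<gamma>' has_vector_derivative \<gamma>'' s) (at s) \<and> tangent_proj (\<gamma> s) (\<gamma>'' s) = 0)"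

definition exp_S2S2 :: "R6 \<Rightarrow> R6 \<Rightarrow> R6" where
  "exp_S2S2 x v =
     (THE \<gamma>. geodesic_S2S2 \<gamma> \<and> \<gamma> 0 = x \<and> (\<gamma> has_vector_derivative v) (at 0)) 1"

text \<open>Existence and uniqueness of geodesics, hence the closed form of the exponential map.\<close>

definition great_circle :: "'a::real_inner \<Rightarrow> 'a \<Rightarrow> real \<Rightarrow> 'a" where
  "great_circle p u s = cos (norm u * s) *\<^sub>R p + sin (norm u * s) *\<^sub>R sgn u"

definition great_circle' :: "'a::real_inner \<Rightarrow> 'a \<Rightarrow> real \<Rightarrow> 'a" where
  "great_circle' p u s = cos (norm u * s) *\<^sub>R u - (norm u * sin (norm u * s)) *\<^sub>R p"

lemma norm_scaleR_sgn: "norm u *\<^sub>R sgn u = (u::'a::real_inner)"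
  by (cases "u = 0") (simp_all add: sgn_div_norm)

lemma great_circle_deriv:
  "(great_circle p u has_vector_derivative great_circle' p u s) (at s)"
proof -
  have "(great_circle p u has_vector_derivative
      (- (norm u * sin (norm u * s))) *\<^sub>R p + (norm u * cos (norm u * s)) *\<^sub>R sgn u) (at s)"
    unfolding great_circle_def
    by (auto intro!: derivative_eq_intros simp: has_vector_derivative_def algebra_simps)
  moreover have "(norm u * cos (norm u * s)) *\<^sub>R sgn u = cos (norm u * s) *\<^sub>R u"
    by (metis mult.commute norm_scaleR_sgn scaleR_scaleR)
  ultimately show ?thesis by (simp add: great_circle'_def)
qed

lemma great_circle'_deriv:
  "(great_circle' p u has_vector_derivative - ((norm u)\<^sup>2 *\<^sub>R great_circle p u s)) (at s)"
proof -
  have "(great_circle' p u has_vector_derivative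
      (- (norm u * sin (norm u * s))) *\<^sub>R u - (norm u * (norm u * cos (norm u * s))) *\<^sub>R p) (at s)"
    unfolding great_circle'_def
    by (auto intro!: derivative_eq_intros simp: has_vector_derivative_def algebra_simps)
  moreover have "(norm u * sin (norm u * s)) *\<^sub>R u
      = (norm u * norm u * sin (norm u * s)) *\<^sub>R sgn u"
    by (metis (no_types, opaque_lifting) mult.assoc mult.commute norm_scaleR_sgn scaleR_scaleR)
  then have "(- (norm u * sin (norm u * s))) *\<^sub>R u - (norm u * (norm u * cos (norm u * s))) *\<^sub>R p
      = - ((norm u)\<^sup>2 *\<^sub>R great_circle p u s)"
    by (simp add: great_circle_def power2_eq_square algebra_simps)
  ultimately show ?thesis by simp
qed

lemma great_circle_norm:
  assumes "norm p = 1" "u \<bullet> p = 0"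
  shows "norm (great_circle p u s) = 1"
proof (cases "u = 0")
  case False
  have 1: "p \<bullet> p = 1" "sgn u \<bullet> sgn u = 1" "p \<bullet> sgn u = 0" "sgn u \<bullet> p = 0"
    using assms False by (simp_all add: dot_square_norm norm_sgn)
      (simp_all add: sgn_div_norm inner_commute)
  have "great_circle p u s \<bullet> great_circle p u s = (cos (norm u * s))\<^sup>2 + (sin (norm u * s))\<^sup>2"
    unfolding great_circle_def by (simp add: inner_add_left inner_add_right 1 power2_eq_square)
  then have "great_circle p u s \<bullet> great_circle p u s = 1" by simp
  then show ?thesis by (simp only: norm_eq_1)
qed (use assms in \<open>simp add: great_circle_def\<close>)

lemma inner_has_derivative:
  assumes "(a has_vector_derivative a') (at s)" "(b has_vector_derivative b') (at s)"
  shows "((\<lambda>s. a s \<bullet> b s) has_real_derivative a s \<bullet> b' + a' \<bullet> b s) (at s)"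
proof -
  have "(\<lambda>h. a s \<bullet> h *\<^sub>R b' + h *\<^sub>R a' \<bullet> b s) = (*) (a s \<bullet> b' + a' \<bullet> b s)"
    by (rule ext) (simp add: distrib_left mult.commute)
  with has_derivative_inner[OF assms[unfolded has_vector_derivative_def]]
  show ?thesis unfolding has_field_derivative_def by metis
qed

lemma real_const:
  assumes "\<And>s. (f has_real_derivative 0) (at s)"
  shows "f s = f (0::real)"
  by (rule DERIV_isconst_all) (use assms in auto)

lemma sphere_geodesic_unique:
  fixes a :: "real \<Rightarrow> 'a::real_inner"
  assumes n: "\<And>s. norm (a s) = 1"
    and d1: "\<And>s. (a has_vector_derivative a' s) (at s)"
    and d2: "\<And>s. (a' has_vector_derivative a'' s) (at s)"
    and ac: "\<And>s. a'' s - (a'' s \<bullet> a s) *\<^sub>R a s = 0"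
  shows "a = great_circle (a 0) (a' 0)"
proof -
  define k where "k = norm (a' 0)"
  have aa: "a s \<bullet> a s = 1" for s using n by (simp add: dot_square_norm)
  have o: "a s \<bullet> a' s = 0" for s
  proof -
    have "((\<lambda>s. a s \<bullet> a s) has_real_derivative a s \<bullet> a' s + a' s \<bullet> a s) (at s)"
      by (rule inner_has_derivative[OF d1 d1])
    moreover have "((\<lambda>s. a s \<bullet> a s) has_real_derivative 0) (at s)" by (simp add: aa)
    ultimately have "a s \<bullet> a' s + a' s \<bullet> a s = 0" by (rule DERIV_unique)
    then show ?thesis by (simp add: inner_commute)
  qed
  have ac': "a'' s = (a'' s \<bullet> a s) *\<^sub>R a s" for s using ac[of s] by simp
  have o2: "a'' s \<bullet> a' s = 0" for s by (subst ac') (simp add: o)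
  have "((\<lambda>s. a' s \<bullet> a' s) has_real_derivative 0) (at s)" for s
    using inner_has_derivative[OF d2 d2, of s] o2[of s] by (simp add: inner_commute)
  then have sp: "a' s \<bullet> a' s = k\<^sup>2" for s
    using real_const[of "\<lambda>s. a' s \<bullet> a' s" s] by (simp add: k_def dot_square_norm)
  have lam: "a'' s \<bullet> a s = - k\<^sup>2" for s
  proof -
    have "((\<lambda>s. a s \<bullet> a' s) has_real_derivative a s \<bullet> a'' s + a' s \<bullet> a' s) (at s)"
      by (rule inner_has_derivative[OF d1 d2])
    moreover have "((\<lambda>s. a s \<bullet> a' s) has_real_derivative 0) (at s)" by (simp add: o)
    ultimately have "a s \<bullet> a'' s + a' s \<bullet> a' s = 0" by (rule DERIV_unique)
    then show ?thesis by (simp add: sp inner_commute)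
  qed
  have acc: "a'' s = - (k\<^sup>2 *\<^sub>R a s)" for s using ac'[of s] lam[of s] by simp
  define g g' where "g = great_circle (a 0) (a' 0)" and "g' = great_circle' (a 0) (a' 0)"
  define e e' where "e = (\<lambda>s. a s - g s)" and "e' = (\<lambda>s. a' s - g' s)"
  have e1: "(e has_vector_derivative e' s) (at s)" for s
    unfolding e_def e'_def g_def g'_def
    by (intro has_vector_derivative_diff d1 great_circle_deriv)
  have "(e' has_vector_derivative a'' s - - ((norm (a' 0))\<^sup>2 *\<^sub>R g s)) (at s)" for s
    unfolding e'_def g_def g'_def
    by (intro has_vector_derivative_diff d2 great_circle'_deriv)
  then have e2: "(e' has_vector_derivative - (k\<^sup>2 *\<^sub>R e s)) (at s)" for s
    by (simp add: acc k_def e_def algebra_simps)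
  have "((\<lambda>s. e' s \<bullet> e' s + k\<^sup>2 * (e s \<bullet> e s)) has_real_derivative
      (e' s \<bullet> - (k\<^sup>2 *\<^sub>R e s) + - (k\<^sup>2 *\<^sub>R e s) \<bullet> e' s) + k\<^sup>2 * (e s \<bullet> e' s + e' s \<bullet> e s)) (at s)" for s
    by (intro DERIV_add DERIV_cmult inner_has_derivative e1 e2)
  then have en: "e' s \<bullet> e' s + k\<^sup>2 * (e s \<bullet> e s) = e' 0 \<bullet> e' 0 + k\<^sup>2 * (e 0 \<bullet> e 0)" for s
    using real_const[of "\<lambda>s. e' s \<bullet> e' s + k\<^sup>2 * (e s \<bullet> e s)" s]
    by (simp add: inner_commute algebra_simps)
  have e0: "e 0 = 0" "e' 0 = 0"
    by (simp_all add: e_def e'_def g_def g'_def great_circle_def great_circle'_def)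
  have "e' s = 0" for s
  proof -
    have "e' s \<bullet> e' s + k\<^sup>2 * (e s \<bullet> e s) = 0" using en[of s] e0 by simp
    moreover have "k\<^sup>2 * (e s \<bullet> e s) \<ge> 0" "e' s \<bullet> e' s \<ge> 0" by simp_all
    ultimately have "e' s \<bullet> e' s = 0" by linarith
    then show ?thesis by simp
  qed
  then have "(e has_derivative (\<lambda>h. 0)) (at s)" for s
    using e1[of s] by (simp add: has_vector_derivative_def)
  then have "\<exists>c. \<forall>s\<in>UNIV. e s = c"
    by (intro has_derivative_zero_constant) auto
  then obtain c where "\<And>s. e s = c" by auto
  with e0 have "e s = 0" for s by metis
  then have "a s = g s" for s unfolding e_def by (simp only: right_minus_eq)
  then show ?thesis unfolding g_def by (rule ext)
qed

lemma geodesic_great_circles: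
  assumes x: "x \<in> S2S2" and v: "v \<in> tangent_S2S2 x"
  shows "geodesic_S2S2 (\<lambda>s. (great_circle (fst x) (fst v) s, great_circle (snd x) (snd v) s))"
    (is "geodesic_S2S2 ?g")
proof -
  have n: "norm (great_circle (fst x) (fst v) s) = 1" "norm (great_circle (snd x) (snd v) s) = 1" for s
    using assms by (auto intro!: great_circle_norm simp: S2S2_def tangent_S2S2_def)
  have *: "- (c *\<^sub>R y) - (- (c *\<^sub>R y) \<bullet> y) *\<^sub>R y = 0" if "norm y = 1" for c and y :: "real^3"
    using that by (simp add: dot_square_norm)
  have "(?g has_vector_derivative
      (great_circle' (fst x) (fst v) s, great_circle' (snd x) (snd v) s)) (at s)" for s
    by (intro has_vector_derivative_Pair great_circle_deriv)
  moreover have "((\<lambda>s. (great_circle' (fst x) (fst v) s, great_circle' (snd x) (snd v) s))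
      has_vector_derivative (- ((norm (fst v))\<^sup>2 *\<^sub>R great_circle (fst x) (fst v) s),
        - ((norm (snd v))\<^sup>2 *\<^sub>R great_circle (snd x) (snd v) s))) (at s)" for s
    by (intro has_vector_derivative_Pair great_circle'_deriv)
  moreover have "tangent_proj (?g s) (- ((norm (fst v))\<^sup>2 *\<^sub>R great_circle (fst x) (fst v) s),
        - ((norm (snd v))\<^sup>2 *\<^sub>R great_circle (snd x) (snd v) s)) = 0" for s
    unfolding tangent_proj_def fst_conv snd_conv *[OF n(1)] *[OF n(2)] by (simp add: zero_prod_def)
  moreover have "?g s \<in> S2S2" for s using n by (simp add: S2S2_def)
  ultimately show ?thesis
    unfolding geodesic_S2S2_def
    by (intro conjI allI exI[of _ "\<lambda>s. (great_circle' (fst x) (fst v) s, great_circle' (snd x) (snd v) s)"]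
        exI[of _ "\<lambda>s. (- ((norm (fst v))\<^sup>2 *\<^sub>R great_circle (fst x) (fst v) s),
          - ((norm (snd v))\<^sup>2 *\<^sub>R great_circle (snd x) (snd v) s))"])
qed

lemma geodesic_unique:
  assumes "geodesic_S2S2 \<gamma>" "\<gamma> 0 = x" "(\<gamma> has_vector_derivative v) (at 0)"
  shows "\<gamma> = (\<lambda>s. (great_circle (fst x) (fst v) s, great_circle (snd x) (snd v) s))"
proof -
  from assms(1) obtain g' g'' where S: "\<And>s. \<gamma> s \<in> S2S2"
    and d1: "\<And>s. (\<gamma> has_vector_derivative g' s) (at s)"
    and d2: "\<And>s. (g' has_vector_derivative g'' s) (at s)"
    and p: "\<And>s. tangent_proj (\<gamma> s) (g'' s) = 0"
    unfolding geodesic_S2S2_def by blast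
  have v: "g' 0 = v" using d1[of 0] assms(3) vector_derivative_unique_at by blast
  have fs: "((\<lambda>s. fst (f s)) has_vector_derivative fst f') (at s)"
      "((\<lambda>s. snd (f s)) has_vector_derivative snd f') (at s)"
    if "(f has_vector_derivative f') (at s)" for f :: "real \<Rightarrow> R6" and f' s
    using bounded_linear.has_vector_derivative[OF bounded_linear_fst that]
      bounded_linear.has_vector_derivative[OF bounded_linear_snd that] by auto
  have n: "norm (fst (\<gamma> s)) = 1" "norm (snd (\<gamma> s)) = 1" for s
    using S[of s] by (auto simp: S2S2_def mem_Times_iff)
  have q: "fst (g'' s) - (fst (g'' s) \<bullet> fst (\<gamma> s)) *\<^sub>R fst (\<gamma> s) = 0"
      "snd (g'' s) - (snd (g'' s) \<bullet> snd (\<gamma> s)) *\<^sub>R snd (\<gamma> s) = 0" for s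
    using p[of s] by (auto simp only: tangent_proj_def zero_prod_def prod.inject)
  have "(\<lambda>s. fst (\<gamma> s)) = great_circle (fst (\<gamma> 0)) (fst (g' 0))"
    by (rule sphere_geodesic_unique[where a''="\<lambda>s. fst (g'' s)" and a'="\<lambda>s. fst (g' s)"])
      (use n q in \<open>simp_all add: fs[OF d1] fs[OF d2]\<close>)
  moreover have "(\<lambda>s. snd (\<gamma> s)) = great_circle (snd (\<gamma> 0)) (snd (g' 0))"
    by (rule sphere_geodesic_unique[where a''="\<lambda>s. snd (g'' s)" and a'="\<lambda>s. snd (g' s)"])
      (use n q in \<open>simp_all add: fs[OF d1] fs[OF d2]\<close>)
  ultimately show ?thesis
    unfolding assms(2) v fun_eq_iff by (simp add: prod_eq_iff)
qed

lemma exp_S2S2_eq: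
  assumes x: "x \<in> S2S2" and v: "v \<in> tangent_S2S2 x"
  shows "exp_S2S2 x v =
    (cos (norm (fst v)) *\<^sub>R fst x + sin (norm (fst v)) *\<^sub>R sgn (fst v),
     cos (norm (snd v)) *\<^sub>R snd x + sin (norm (snd v)) *\<^sub>R sgn (snd v))"
proof -
  let ?g = "\<lambda>s. (great_circle (fst x) (fst v) s, great_circle (snd x) (snd v) s)"
  have "(?g has_vector_derivative
      (great_circle' (fst x) (fst v) 0, great_circle' (snd x) (snd v) 0)) (at 0)"
    by (intro has_vector_derivative_Pair great_circle_deriv)
  then have "geodesic_S2S2 ?g \<and> ?g 0 = x \<and> (?g has_vector_derivative v) (at 0)"
    using geodesic_great_circles[OF assms] by (simp add: great_circle'_def great_circle_def)
  then have "(THE \<gamma>. geodesic_S2S2 \<gamma> \<and> \<gamma> 0 = x \<and> (\<gamma> has_vector_derivative v) (at 0)) = ?g"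
    using geodesic_unique by (intro the_equality) simp_all
  then show ?thesis by (simp add: exp_S2S2_def great_circle_def)
qed

text \<open>The differential of \<open>F\<close> on tangent vectors is computed from any smooth extension to
  a neighbourhood in \<open>R6\<close>, which exists because \<open>S2S2\<close> is a compact submanifold. Smoothness of the inverse
  is automatic since the differential is injective between spaces of equal dimension.\<close>

definition isometry_S2S2 :: "(R6 \<Rightarrow> R6) \<Rightarrow> bool" where
  "isometry_S2S2 F \<longleftrightarrow> bij_betw F S2S2 S2S2 \<and>
     (\<exists>U G. S2S2 \<subseteq> U \<and> smooth_on U G \<and> (\<forall>x\<in>S2S2. G x = F x) \<and>
        (\<forall>x\<in>S2S2. \<forall>v\<in>tangent_S2S2 x. \<forall>w\<in>tangent_S2S2 x.
           frechet_derivative G (at x) v \<bullet> frechet_derivative G (at x) w = v \<bullet> w))"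

definition congruent_S2S2 :: "R6 set \<Rightarrow> R6 set \<Rightarrow> bool" where
  "congruent_S2S2 X Y \<longleftrightarrow> (\<exists>F. isometry_S2S2 F \<and> F ` X = Y)"


section \<open>Hypersurfaces of \<open>S2 \<times> S2\<close>\<close>

definition hypersurface :: "'a topology \<Rightarrow> 'a chart set \<Rightarrow> ('a \<Rightarrow> R6) \<Rightarrow> bool" where
  "hypersurface M A \<Phi> \<longleftrightarrow> smooth_3_manifold M A \<and> \<Phi> ` topspace M \<subseteq> S2S2 \<and> smooth_map A \<Phi> \<and>
     (\<forall>c\<in>A. \<forall>p\<in>fst c. inj (chart_deriv c \<Phi> p))"

definition unit_normal_field :: "'a topology \<Rightarrow> 'a chart set \<Rightarrow> ('a \<Rightarrow> R6) \<Rightarrow> ('a \<Rightarrow> R6) \<Rightarrow> bool" where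
  "unit_normal_field M A \<Phi> N \<longleftrightarrow> smooth_map A N \<and>
     (\<forall>p\<in>topspace M. N p \<in> tangent_S2S2 (\<Phi> p) \<and> norm (N p) = 1) \<and>
     (\<forall>c\<in>A. \<forall>p\<in>fst c. \<forall>v. chart_deriv c \<Phi> p v \<bullet> N p = 0)"

definition parallel_hypersurface :: "('a \<Rightarrow> R6) \<Rightarrow> ('a \<Rightarrow> R6) \<Rightarrow> real \<Rightarrow> 'a \<Rightarrow> R6" where
  "parallel_hypersurface \<Phi> N t p = exp_S2S2 (\<Phi> p) (t *\<^sub>R N p)"

text \<open>Weingarten: \<open>d\<Phi> (A v)\<close> is minus the covariant derivative of \<open>N\<close> in direction \<open>v\<close>. The latter
  is tangent to the hypersurface because \<open>N\<close> has unit length, so \<open>A v\<close> exists, and it is unique because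
  \<open>d\<Phi>\<close> is injective.\<close>

definition shape_operator ::
    "'a chart \<Rightarrow> ('a \<Rightarrow> R6) \<Rightarrow> ('a \<Rightarrow> R6) \<Rightarrow> 'a \<Rightarrow> real^3 \<Rightarrow> real^3" where
  "shape_operator c \<Phi> N p v =
     (THE w. chart_deriv c \<Phi> p w = - tangent_proj (\<Phi> p) (chart_deriv c N p v))"

text \<open>Changing the chart conjugates the matrix of the shape operator, so the value does not depend
  on \<open>c\<close>.\<close>

definition mean_curvature :: "'a chart \<Rightarrow> ('a \<Rightarrow> R6) \<Rightarrow> ('a \<Rightarrow> R6) \<Rightarrow> 'a \<Rightarrow> real" where
  "mean_curvature c \<Phi> N p = trace (matrix (shape_operator c \<Phi> N p)) / 3"

text \<open>On a connected manifold the unit normal field is unique up to sign, and reversing it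
  changes the sign of the mean curvature; so constancy does not depend on the choice of \<open>N\<close>.\<close>

definition constant_mean_curvature :: "'a topology \<Rightarrow> 'a chart set \<Rightarrow> ('a \<Rightarrow> R6) \<Rightarrow> bool" where
  "constant_mean_curvature M A \<Phi> \<longleftrightarrow>
     (\<exists>N H. unit_normal_field M A \<Phi> N \<and> (\<forall>c\<in>A. \<forall>p\<in>fst c. mean_curvature c \<Phi> N p = H))"

definition circle_S1 :: "real \<Rightarrow> (real^3) set" where
  "circle_S1 r = {x \<in> sphere 0 1. x $ 3 = sqrt (1 - r\<^sup>2)}"

definition M_hyp :: "real \<Rightarrow> R6 set" where
  "M_hyp t = {(p, q). (p, q) \<in> S2S2 \<and> p \<bullet> q = t}"

end

(* A unit normal N = (m, n) of the hypersurface has angle function |m|^2 - |n|^2. In the orthonormal frame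
   (u1, 0), (0, u2), (|n| m/|m|, -|m| n/|n|), parallel along the normal geodesics, the Jacobi fields are explicit, so
   the Jacobian vol(t) of the parallel map is a combination of cos, sin at the frequencies |m| + |n| and |m| - |n|
   with coefficients of degree at most 1 in t. Constant mean curvature of all parallel hypersurfaces means that
   vol(t)/vol(0) is the same at all points; it is annihilated by ((d^2/dt^2 + 1)^2 - 4 |m|^2 |n|^2)^2, hence |m|^2 |n|^2
   is constant and so are |m| and |n|.

   If n = 0 then dm is a constant multiple of dp, so m - l p is a constant vector and p runs in a circle; m = 0 is
   symmetric. Otherwise the shape operator kills the third frame vector and its other entries are constrained by the
   coefficients of vol(t)/vol(0). The Codazzi equations in the direction of that vector force |m| = |n| and a constant
   shape operator, and then an explicit orthogonal map R built from the two frames is constant with p . R q constant. *)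

theory Submission imports Defs
begin

text \<open>Since |m|^2 + |n|^2 = 1, the frequencies satisfy 1 - (|m| + |n|)^2 = - 2 |m| |n| and 1 -
  (|m| - |n|)^2 = 2 |m| |n|. Squaring d^2/dt^2 + 1 therefore gives both frequencies the single
  eigenvalue 4 |m|^2 |n|^2, and coefficients of degree 1 in t only add Jordan blocks of size 2; this
  is where the annihilating operator comes from. Four obstacles shape the global argument. The frame
  exists only where m and n are both nonzero, so the zeros of |m| |n| must be excluded by
  connectedness. The unit normals of the parallel hypersurfaces are chosen separately for each t, so
  their sign against the geodesic velocity has to be controlled on neighbourhoods independent of t,
  and nothing is known about the regularity in t of the mean curvature. The map R contains a sign
  that is found only near each point, so the two signs must be shown to exclude each other before R
  can be glued. Finally, openness of the image in the model requires that the immersion fill a level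
  set locally; this is an inverse function argument in \<open>R6\<close>.\<close>

abbreviation fderiv :: "('a::real_normed_vector \<Rightarrow> 'b::real_normed_vector) \<Rightarrow> 'a \<Rightarrow> 'a \<Rightarrow> 'b" where
  "fderiv f x v \<equiv> frechet_derivative f (at x) v"

section \<open>Calculus of smooth maps: symmetry of second derivatives and Lie brackets\<close>

lemma frechet_derivative_eqI: "(f has_derivative f') (at x) \<Longrightarrow> frechet_derivative f (at x) = f'"
  using frechet_derivative_at by metis

lemma frechet_derivative_cong_open:
  assumes "open S" "x \<in> S" "\<And>y. y \<in> S \<Longrightarrow> f y = g y"
  shows "frechet_derivative f (at x) = frechet_derivative g (at x)"
proof -
  have "(f has_derivative f') (at x) \<longleftrightarrow> (g has_derivative f') (at x)" for f'
    using has_derivative_transform_within_open[of f f' x UNIV S g]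
      has_derivative_transform_within_open[of g f' x UNIV S f] assms by metis
  then show ?thesis by (simp add: frechet_derivative_def)
qed

text \<open>Openness of \<open>S\<close> makes the derivatives agree on \<open>S\<close> too, so the
  induction can pass to them. Formulas for derivatives are available only on \<open>S\<close>, which
  is why they enter \<open>Ck_on\<close> through this lemma.\<close>

lemma Ck_on_cong:
  assumes "open S" "\<And>y. y \<in> S \<Longrightarrow> f y = g y" "Ck_on k S f"
  shows "Ck_on k S g"
  using assms(2,3)
proof (induction k arbitrary: f g)
  case 0
  then show ?case by (auto cong: continuous_on_cong)
next
  case (Suc k)
  have "g differentiable_on S"
    using Suc.prems assms(1)
    unfolding differentiable_on_eq_differentiable_at[OF assms(1)] Ck_on.simps
    by (metis differentiable_def has_derivative_transform_within_open)
  moreover have "Ck_on k S (\<lambda>x. fderiv g x v)" for v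
    by (rule Suc.IH[of "\<lambda>x. fderiv f x v"])
      (use Suc.prems assms(1) in \<open>auto simp: frechet_derivative_cong_open[of S _ f g]\<close>)
  ultimately show ?case by simp
qed

lemma Ck_on_linear_image:
  assumes "open S" "bounded_linear L" "Ck_on k S f"
  shows "Ck_on k S (\<lambda>x. L (f x))"
  using assms(3)
proof (induction k arbitrary: f)
  case 0
  then show ?case using assms(2) by (auto intro: bounded_linear.continuous_on)
next
  case (Suc k)
  have d: "((\<lambda>x. L (f x)) has_derivative (\<lambda>v. L (fderiv f x v))) (at x)" if "x \<in> S" for x
  proof -
    have "f differentiable (at x)"
      using Suc.prems that assms(1) by (simp add: differentiable_on_eq_differentiable_at)
    then have "(f has_derivative fderiv f x) (at x)" by (simp add: frechet_derivative_works)
    then show ?thesis by (rule bounded_linear.has_derivative[OF assms(2)])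
  qed
  then have "(\<lambda>x. L (f x)) differentiable_on S"
    unfolding differentiable_on_def differentiable_def by (blast intro: has_derivative_at_withinI)
  moreover have "Ck_on k S (\<lambda>x. fderiv (\<lambda>x. L (f x)) x v)" for v
    by (rule Ck_on_cong[OF assms(1), of "\<lambda>x. L (fderiv f x v)"])
      (use Suc d in \<open>auto simp: frechet_derivative_eqI[OF d]\<close>)
  ultimately show ?case by simp
qed

lemma Ck_on_const: "Ck_on k S (\<lambda>x. c)"
  by (induction k arbitrary: c) (simp_all add: frechet_derivative_const)

lemma smooth_on_linear_image: "bounded_linear L \<Longrightarrow> smooth_on S f \<Longrightarrow> smooth_on S (\<lambda>x. L (f x))"
  by (simp add: smooth_on_def Ck_on_linear_image)

lemma smooth_on_bounded_linear:
  assumes "bounded_linear L" shows "smooth_on UNIV L"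
proof -
  have d: "frechet_derivative L (at x) = L" for x
    by (rule frechet_derivative_eqI[OF bounded_linear_imp_has_derivative[OF assms]])
  have "Ck_on k UNIV L" for k
    by (cases k) (simp_all add: d Ck_on_const assms linear_continuous_on
        bounded_linear_imp_differentiable_on)
  then show ?thesis by (simp add: smooth_on_def)
qed

lemma smooth_on_has_derivative:
  assumes "smooth_on S f" "x \<in> S" shows "(f has_derivative fderiv f x) (at x)"
proof -
  have "Ck_on (Suc 0) S f" "open S" using assms by (auto simp: smooth_on_def)
  then show ?thesis
    using assms(2) by (simp add: differentiable_on_eq_differentiable_at frechet_derivative_works)
qed

lemma smooth_on_fderiv: "smooth_on S f \<Longrightarrow> smooth_on S (\<lambda>x. fderiv f x v)"
  unfolding smooth_on_def by (metis Ck_on.simps(2))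

lemma smooth_on_continuous: "smooth_on S f \<Longrightarrow> continuous_on S f"
  unfolding smooth_on_def by (metis Ck_on.simps(1))

lemma smooth_on_linear: "smooth_on S f \<Longrightarrow> x \<in> S \<Longrightarrow> linear (fderiv f x)"
  using smooth_on_has_derivative has_derivative_linear by blast

text \<open>Schwarz's theorem: the second difference of \<open>f\<close> equals \<open>h\<^sup>2\<close> times a second derivative
  at a nearby point, for either order of differentiation.\<close>

lemma second_difference_mvt:
  fixes f :: "'a::real_normed_vector \<Rightarrow> real"
  assumes f: "smooth_on S f" and h: "0 < h"
    and S: "\<And>s t. 0 \<le> s \<Longrightarrow> s \<le> h \<Longrightarrow> 0 \<le> t \<Longrightarrow> t \<le> h \<Longrightarrow> x + s *\<^sub>R v + t *\<^sub>R w \<in> S"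
  shows "\<exists>s t. 0 < s \<and> s < h \<and> 0 < t \<and> t < h \<and>
    f (x + h *\<^sub>R v + h *\<^sub>R w) - f (x + h *\<^sub>R v) - f (x + h *\<^sub>R w) + f x =
      h * h * fderiv (\<lambda>y. fderiv f y v) (x + s *\<^sub>R v + t *\<^sub>R w) w"
proof -
  let ?\<phi> = "\<lambda>s. f (x + s *\<^sub>R v + h *\<^sub>R w) - f (x + s *\<^sub>R v)"
  have dline: "((\<lambda>s. g (y + s *\<^sub>R e)) has_real_derivative fderiv g (y + s *\<^sub>R e) e) (at s)"
    if "smooth_on S g" "y + s *\<^sub>R e \<in> S" for g :: "'a \<Rightarrow> real" and y e s
  proof -
    have "((\<lambda>s. y + s *\<^sub>R e) has_derivative (\<lambda>r. r *\<^sub>R e)) (at s)"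
      by (auto intro!: derivative_eq_intros)
    then have "((\<lambda>s. g (y + s *\<^sub>R e)) has_derivative (\<lambda>r. fderiv g (y + s *\<^sub>R e) (r *\<^sub>R e))) (at s)"
      by (rule has_derivative_compose[where g=g]) (rule smooth_on_has_derivative[OF that])
    moreover have "(\<lambda>r. fderiv g (y + s *\<^sub>R e) (r *\<^sub>R e)) = (*) (fderiv g (y + s *\<^sub>R e) e)"
      by (rule ext) (simp add: linear_scale[OF smooth_on_linear[OF that]])
    ultimately show ?thesis by (simp add: has_field_derivative_def)
  qed
  have "\<exists>s. 0 < s \<and> s < h \<and> ?\<phi> h - ?\<phi> 0 =
      (h - 0) * (fderiv f (x + s *\<^sub>R v + h *\<^sub>R w) v - fderiv f (x + s *\<^sub>R v) v)"
  proof (rule MVT2[OF h])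
    fix s assume s: "0 \<le> s" "s \<le> h"
    have "((\<lambda>s. f ((x + h *\<^sub>R w) + s *\<^sub>R v)) has_real_derivative fderiv f ((x + h *\<^sub>R w) + s *\<^sub>R v) v) (at s)"
      by (rule dline[OF f]) (use S[of s h] s h in \<open>simp add: algebra_simps\<close>)
    moreover have "((\<lambda>s. f (x + s *\<^sub>R v)) has_real_derivative fderiv f (x + s *\<^sub>R v) v) (at s)"
      by (rule dline[OF f]) (use S[of s 0] s h in simp)
    ultimately show "(?\<phi> has_real_derivative
        (fderiv f (x + s *\<^sub>R v + h *\<^sub>R w) v - fderiv f (x + s *\<^sub>R v) v)) (at s)"
      by (simp add: add.commute add.left_commute DERIV_diff)
  qed
  then obtain s where s: "0 < s" "s < h"
    and e1: "?\<phi> h - ?\<phi> 0 = h * (fderiv f (x + s *\<^sub>R v + h *\<^sub>R w) v - fderiv f (x + s *\<^sub>R v) v)"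
    by auto
  let ?\<psi> = "\<lambda>t. fderiv f (x + s *\<^sub>R v + t *\<^sub>R w) v"
  have "\<exists>t. 0 < t \<and> t < h \<and> ?\<psi> h - ?\<psi> 0 =
      (h - 0) * (fderiv (\<lambda>y. fderiv f y v) (x + s *\<^sub>R v + t *\<^sub>R w) w)"
    by (rule MVT2[OF h]) (use S s in \<open>auto intro!: dline smooth_on_fderiv[OF f]\<close>)
  then obtain t where "0 < t" "t < h" "?\<psi> h - ?\<psi> 0 =
      h * (fderiv (\<lambda>y. fderiv f y v) (x + s *\<^sub>R v + t *\<^sub>R w) w)" by auto
  with s e1 show ?thesis by (intro exI[of _ s] exI[of _ t]) (simp add: algebra_simps)
qed

text \<open>Both mixed derivatives are continuous. If they differed at \<open>x\<close>, each would
  stay within half of the difference of its value at \<open>x\<close> on a small parallelogram,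
  while the second difference, the same for both orders, equates a value of one with a value of the
  other there.\<close>

lemma second_derivative_symmetric_real:
  fixes f :: "'a::real_normed_vector \<Rightarrow> real"
  assumes f: "smooth_on S f" and x: "x \<in> S"
  shows "fderiv (\<lambda>y. fderiv f y v) x w = fderiv (\<lambda>y. fderiv f y w) x v"
proof (rule ccontr)
  let ?A = "\<lambda>y. fderiv (\<lambda>y. fderiv f y v) y w" and ?B = "\<lambda>y. fderiv (\<lambda>y. fderiv f y w) y v"
  assume ne: "?A x \<noteq> ?B x"
  define e where "e = \<bar>?A x - ?B x\<bar> / 2"
  have e: "e > 0" using ne by (simp add: e_def)
  have S: "open S" using f by (simp add: smooth_on_def)
  have cA: "continuous_on S ?A" and cB: "continuous_on S ?B"
    by (intro smooth_on_continuous smooth_on_fderiv f)+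
  obtain d1 where d1: "d1 > 0" "\<And>y. y \<in> S \<Longrightarrow> dist y x < d1 \<Longrightarrow> dist (?A y) (?A x) < e"
    using cA e x unfolding continuous_on_iff by metis
  obtain d2 where d2: "d2 > 0" "\<And>y. y \<in> S \<Longrightarrow> dist y x < d2 \<Longrightarrow> dist (?B y) (?B x) < e"
    using cB e x unfolding continuous_on_iff by metis
  obtain d3 where d3: "d3 > 0" "ball x d3 \<subseteq> S" using S x open_contains_ball by metis
  define d where "d = min d1 (min d2 d3)"
  have d: "d > 0" using d1 d2 d3 by (simp add: d_def)
  \<comment> \<open>The summand 1 keeps the denominator positive when \<open>v\<close> and
    \<open>w\<close> vanish, and makes the parallelogram lie strictly inside the ball of radius
    \<open>d\<close>.\<close>
  define h where "h = d / (norm v + norm w + 1)"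
  have "norm v + norm w + 1 > 0" by (smt (verit) norm_ge_zero)
  then have h: "h > 0" using d by (simp add: h_def)
  have hd: "h * (norm v + norm w) < d"
    using d \<open>norm v + norm w + 1 > 0\<close> by (simp add: h_def field_simps)
  have near: "dist (x + s *\<^sub>R v + t *\<^sub>R w) x < d" if "0 \<le> s" "s \<le> h" "0 \<le> t" "t \<le> h" for s t
  proof -
    have "norm (s *\<^sub>R v + t *\<^sub>R w) \<le> norm (s *\<^sub>R v) + norm (t *\<^sub>R w)" by (rule norm_triangle_ineq)
    also have "\<dots> \<le> h * norm v + h * norm w" using that by (intro add_mono) (auto intro: mult_right_mono)
    finally show ?thesis using hd by (simp add: dist_norm algebra_simps)
  qed
  have inS: "x + s *\<^sub>R v + t *\<^sub>R w \<in> S" if "0 \<le> s" "s \<le> h" "0 \<le> t" "t \<le> h" for s t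
    using near[OF that] d3 by (auto simp: d_def dist_commute)
  obtain s t where st: "0 < s" "s < h" "0 < t" "t < h"
    and 1: "f (x + h *\<^sub>R v + h *\<^sub>R w) - f (x + h *\<^sub>R v) - f (x + h *\<^sub>R w) + f x = h * h * ?A (x + s *\<^sub>R v + t *\<^sub>R w)"
    using second_difference_mvt[OF f h, of x v w] inS by blast
  obtain s' t' where st': "0 < s'" "s' < h" "0 < t'" "t' < h"
    and 2: "f (x + h *\<^sub>R w + h *\<^sub>R v) - f (x + h *\<^sub>R w) - f (x + h *\<^sub>R v) + f x = h * h * ?B (x + t' *\<^sub>R w + s' *\<^sub>R v)"
  proof -
    have "x + s *\<^sub>R w + t *\<^sub>R v \<in> S" if "0 \<le> s" "s \<le> h" "0 \<le> t" "t \<le> h" for s t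
      using inS[OF that(3,4,1,2)] by (simp add: add.commute add.left_commute)
    then show ?thesis using second_difference_mvt[OF f h, of x w v] that by blast
  qed
  have "h * h * ?A (x + s *\<^sub>R v + t *\<^sub>R w) = h * h * ?B (x + t' *\<^sub>R w + s' *\<^sub>R v)"
  proof -
    have "x + h *\<^sub>R w + h *\<^sub>R v = x + h *\<^sub>R v + h *\<^sub>R w" by (simp add: add.commute add.left_commute)
    with 1 2 show ?thesis by (metis (no_types, lifting) add.commute diff_diff_eq)
  qed
  then have eq: "?A (x + s *\<^sub>R v + t *\<^sub>R w) = ?B (x + s' *\<^sub>R v + t' *\<^sub>R w)"
    using h by (simp add: add.commute add.left_commute)
  have "dist (?A (x + s *\<^sub>R v + t *\<^sub>R w)) (?A x) < e"
    using d1(2)[OF inS] near[of s t] st by (simp add: d_def)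
  moreover have "dist (?B (x + s' *\<^sub>R v + t' *\<^sub>R w)) (?B x) < e"
    using d2(2)[OF inS] near[of s' t'] st' by (simp add: d_def)
  ultimately show False using eq unfolding e_def dist_real_def by argo
qed

lemma second_derivative_symmetric:
  fixes f :: "'a::real_normed_vector \<Rightarrow> 'b::euclidean_space"
  assumes f: "smooth_on S f" and x: "x \<in> S"
  shows "fderiv (\<lambda>y. fderiv f y v) x w = fderiv (\<lambda>y. fderiv f y w) x v"
proof (rule euclidean_eqI)
  fix b :: 'b assume "b \<in> Basis"
  have bl: "bounded_linear (\<lambda>z. z \<bullet> b)" by (rule bounded_linear_inner_left)
  have S: "open S" using f by (simp add: smooth_on_def)
  have 1: "fderiv (\<lambda>y. g y \<bullet> b) y u = fderiv g y u \<bullet> b" if "smooth_on S g" "y \<in> S" for g :: "'a \<Rightarrow> 'b" and y u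
    using frechet_derivative_eqI[OF bounded_linear.has_derivative[OF bl smooth_on_has_derivative[OF that]]]
    by simp
  have 2: "fderiv (\<lambda>y. fderiv (\<lambda>z. f z \<bullet> b) y u) x u' = fderiv (\<lambda>y. fderiv f y u) x u' \<bullet> b" for u u'
  proof -
    have "fderiv (\<lambda>y. fderiv (\<lambda>z. f z \<bullet> b) y u) x u' = fderiv (\<lambda>y. fderiv f y u \<bullet> b) x u'"
      using frechet_derivative_cong_open[OF S x, of "\<lambda>y. fderiv (\<lambda>z. f z \<bullet> b) y u" "\<lambda>y. fderiv f y u \<bullet> b"]
        1[OF f] by simp
    then show ?thesis using 1[OF smooth_on_fderiv[OF f] x] by simp
  qed
  show "fderiv (\<lambda>y. fderiv f y v) x w \<bullet> b = fderiv (\<lambda>y. fderiv f y w) x v \<bullet> b"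
    using second_derivative_symmetric_real[OF smooth_on_linear_image[OF bl f] x, of v w]
    by (simp add: 2)
qed

text \<open>Smoothness provides derivatives of \<open>fderiv f y u\<close> only for a fixed
  direction \<open>u\<close>. Expanding \<open>W y\<close> in the standard basis reduces the
  variable direction to fixed ones, and the product rule gives the two terms.\<close>

lemma has_derivative_along_field:
  fixes f :: "'a::euclidean_space \<Rightarrow> 'b::euclidean_space"
  assumes f: "smooth_on S f" and x: "x \<in> S" and W: "(W has_derivative W') (at x)"
  shows "((\<lambda>y. fderiv f y (W y)) has_derivative
    (\<lambda>v. fderiv (\<lambda>y. fderiv f y (W x)) x v + fderiv f x (W' v))) (at x)"
proof -
  have S: "open S" using f by (simp add: smooth_on_def)
  have ex: "fderiv f y u = (\<Sum>i\<in>Basis. (u \<bullet> i) *\<^sub>R fderiv f y i)" if "y \<in> S" for y u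
    by (subst euclidean_representation[of u, symmetric])
      (simp add: linear_sum[OF smooth_on_linear[OF f that]] linear_scale[OF smooth_on_linear[OF f that]])
  have d: "((\<lambda>y. fderiv f y u) has_derivative fderiv (\<lambda>y. fderiv f y u) x) (at x)" for u
    by (rule smooth_on_has_derivative[OF smooth_on_fderiv[OF f] x])
  have D: "((\<lambda>y. \<Sum>i\<in>Basis. (W y \<bullet> i) *\<^sub>R fderiv f y i) has_derivative
     (\<lambda>v. \<Sum>i\<in>Basis. (W x \<bullet> i) *\<^sub>R fderiv (\<lambda>y. fderiv f y i) x v + (W' v \<bullet> i) *\<^sub>R fderiv f x i)) (at x)"
    by (intro has_derivative_sum has_derivative_scaleR has_derivative_inner_left W d)
  have "((\<lambda>y. \<Sum>i\<in>Basis. (W x \<bullet> i) *\<^sub>R fderiv f y i) has_derivative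
     (\<lambda>v. \<Sum>i\<in>Basis. (W x \<bullet> i) *\<^sub>R fderiv (\<lambda>y. fderiv f y i) x v)) (at x)"
    by (intro has_derivative_sum has_derivative_scaleR_right d)
  then have "((\<lambda>y. fderiv f y (W x)) has_derivative
     (\<lambda>v. \<Sum>i\<in>Basis. (W x \<bullet> i) *\<^sub>R fderiv (\<lambda>y. fderiv f y i) x v)) (at x)"
    by (rule has_derivative_transform_within_open[OF _ S x]) (simp add: ex[of _ "W x"])
  then have e: "fderiv (\<lambda>y. fderiv f y (W x)) x v = (\<Sum>i\<in>Basis. (W x \<bullet> i) *\<^sub>R fderiv (\<lambda>y. fderiv f y i) x v)" for v
    using frechet_derivative_eqI by fastforce
  have "((\<lambda>y. \<Sum>i\<in>Basis. (W y \<bullet> i) *\<^sub>R fderiv f y i) has_derivative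
     (\<lambda>v. fderiv (\<lambda>y. fderiv f y (W x)) x v + fderiv f x (W' v))) (at x)"
    using D by (simp add: e ex[OF x, of "W' _"] sum.distrib)
  then show ?thesis
    by (rule has_derivative_transform_within_open[OF _ S x]) (simp add: ex[of _ "W _"])
qed

text \<open>The Lie bracket of \<open>V\<close> and \<open>W\<close> at \<open>x\<close> is \<open>W' (V x) - V' (W x)\<close>.\<close>

lemma Lie_bracket_derivative:
  fixes f :: "'a::euclidean_space \<Rightarrow> 'b::euclidean_space"
  assumes f: "smooth_on S f" and x: "x \<in> S"
    and V: "(V has_derivative V') (at x)" and W: "(W has_derivative W') (at x)"
    and fV: "((\<lambda>y. fderiv f y (V y)) has_derivative FV) (at x)"
    and fW: "((\<lambda>y. fderiv f y (W y)) has_derivative FW) (at x)"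
  shows "fderiv f x (W' (V x) - V' (W x)) = FW (V x) - FV (W x)"
proof -
  have "FV = (\<lambda>v. fderiv (\<lambda>y. fderiv f y (V x)) x v + fderiv f x (V' v))"
    using has_derivative_unique[OF fV has_derivative_along_field[OF f x V]] .
  moreover have "FW = (\<lambda>v. fderiv (\<lambda>y. fderiv f y (W x)) x v + fderiv f x (W' v))"
    using has_derivative_unique[OF fW has_derivative_along_field[OF f x W]] .
  ultimately show ?thesis
    using second_derivative_symmetric[OF f x, of "V x" "W x"]
    by (simp add: linear_diff[OF smooth_on_linear[OF f x]])
qed

section \<open>Trigonometric quasi-polynomials\<close>

text \<open>The equation \<open>g = f'' + f\<close> on \<open>I\<close> as a relation, so that
  differentiability of \<open>f\<close> and of its derivative is part of it. Its square
  \<open>oscillator2\<close> then needs no separate bookkeeping of derivatives.\<close>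

definition oscillator :: "real set \<Rightarrow> (real \<Rightarrow> real) \<Rightarrow> (real \<Rightarrow> real) \<Rightarrow> bool" where
  "oscillator I f g \<longleftrightarrow> (\<exists>f'. \<forall>t\<in>I. (f has_real_derivative f' t) (at t) \<and>
     (f' has_real_derivative g t - f t) (at t))"

definition oscillator2 :: "real set \<Rightarrow> (real \<Rightarrow> real) \<Rightarrow> (real \<Rightarrow> real) \<Rightarrow> bool" where
  "oscillator2 I f g \<longleftrightarrow> (\<exists>h. oscillator I f h \<and> oscillator I h g)"

lemma DERIV_unique_on:
  assumes "open I" "t \<in> I" "\<And>s. s \<in> I \<Longrightarrow> f s = g s"
    and "(f has_real_derivative d) (at t)" "(g has_real_derivative e) (at t)"
  shows "d = e"
proof -
  have "(g has_real_derivative d) (at t)"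
    by (rule has_field_derivative_transform_within_open[OF assms(4,1,2,3)])
  then show ?thesis using assms(5) by (rule DERIV_unique)
qed

text \<open>An identity valid on an open set may be differentiated, so the operator can be applied
  to both sides of it; the later comparisons of coefficients proceed in this way.\<close>

lemma oscillator_unique:
  assumes "open I" "oscillator I f g" "oscillator I f2 g2" "\<And>t. t \<in> I \<Longrightarrow> f t = f2 t" "t \<in> I"
  shows "g t = g2 t"
proof -
  from assms(2) obtain h where h: "\<And>t. t\<in>I \<Longrightarrow> (f has_real_derivative h t) (at t)"
     "\<And>t. t\<in>I \<Longrightarrow> (h has_real_derivative g t - f t) (at t)" by (auto simp: oscillator_def)
  from assms(3) obtain k where k: "\<And>t. t\<in>I \<Longrightarrow> (f2 has_real_derivative k t) (at t)"
     "\<And>t. t\<in>I \<Longrightarrow> (k has_real_derivative g2 t - f2 t) (at t)" by (auto simp: oscillator_def)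
  have hk: "h t = k t" if "t \<in> I" for t
    by (rule DERIV_unique_on[OF assms(1) that assms(4) h(1)[OF that] k(1)[OF that]])
  have "g t - f t = g2 t - f2 t"
    by (rule DERIV_unique_on[OF assms(1,5) hk h(2)[OF assms(5)] k(2)[OF assms(5)]])
  then show ?thesis using assms(4,5) by simp
qed

lemma oscillator2_unique:
  assumes "open I" "oscillator2 I f g" "oscillator2 I f2 g2" "\<And>t. t \<in> I \<Longrightarrow> f t = f2 t" "t \<in> I"
  shows "g t = g2 t"
proof -
  obtain h where h: "oscillator I f h" "oscillator I h g" using assms(2) by (auto simp: oscillator2_def)
  obtain k where k: "oscillator I f2 k" "oscillator I k g2" using assms(3) by (auto simp: oscillator2_def)
  have "h s = k s" if "s \<in> I" for s
    by (rule oscillator_unique[OF assms(1) h(1) k(1) assms(4) that])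
  then show ?thesis by (rule oscillator_unique[OF assms(1) h(2) k(2) _ assms(5)])
qed

lemma oscillator_lin:
  assumes "oscillator I f g" "oscillator I f2 g2"
  shows "oscillator I (\<lambda>t. c * f t + d * f2 t) (\<lambda>t. c * g t + d * g2 t)"
proof -
  from assms obtain h k where "\<And>t. t\<in>I \<Longrightarrow> (f has_real_derivative h t) (at t)"
     "\<And>t. t\<in>I \<Longrightarrow> (h has_real_derivative g t - f t) (at t)"
     "\<And>t. t\<in>I \<Longrightarrow> (f2 has_real_derivative k t) (at t)"
     "\<And>t. t\<in>I \<Longrightarrow> (k has_real_derivative g2 t - f2 t) (at t)" by (auto simp: oscillator_def)
  then show ?thesis unfolding oscillator_def
    by (intro exI[of _ "\<lambda>t. c * h t + d * k t"]) (auto intro!: derivative_eq_intros simp: algebra_simps)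
qed

lemma oscillator2_lin:
  assumes "oscillator2 I f g" "oscillator2 I f2 g2"
  shows "oscillator2 I (\<lambda>t. c * f t + d * f2 t) (\<lambda>t. c * g t + d * g2 t)"
  using assms unfolding oscillator2_def by (blast intro: oscillator_lin)

text \<open>With \<open>E = (d\<^sup>2/dt\<^sup>2 + 1)\<^sup>2\<close>, the polynomials \<open>(E - y)\<^sup>2\<close> and \<open>(E - z)\<^sup>2\<close> are
  coprime for \<open>y \<noteq> z\<close>, so a function annihilated by both vanishes.\<close>

lemma generalized_eigenfunctions_disjoint:
  assumes I: "open I" and t: "t \<in> I" and yz: "y \<noteq> z"
    and f: "oscillator2 I f (\<lambda>t. y * f t + k t)" and k: "oscillator2 I k (\<lambda>t. y * k t)"
    and g: "oscillator2 I g (\<lambda>t. z * g t + l t)" and l: "oscillator2 I l (\<lambda>t. z * l t)"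
    and fg: "\<And>t. t \<in> I \<Longrightarrow> f t = g t"
  shows "f t = 0"
proof -
  have 1: "y * f t + k t = z * g t + l t" if "t \<in> I" for t
    by (rule oscillator2_unique[OF I f g fg that])
  \<comment> \<open>The operator \<open>E\<close> applied to \<open>k - l = (z - y) f\<close>, which
    is the identity just obtained.\<close>
  have 2: "1 * (y * k t) + (-1) * (z * l t) = (z - y) * (y * f t + k t) + 0 * (y * k t)" if "t \<in> I" for t
    by (rule oscillator2_unique[OF I oscillator2_lin[OF k l] oscillator2_lin[OF f k] _ that])
      (use 1 fg in \<open>simp add: algebra_simps\<close>)
  have 3: "2 * k t = (z - y) * f t" if "t \<in> I" for t
  proof -
    have l: "l t = k t - (z - y) * f t" using 1[OF that] fg[OF that] by (simp add: algebra_simps)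
    have "(z - y) * (2 * k t - (z - y) * f t) = 0" using 2[OF that, unfolded l] by (simp add: algebra_simps)
    then show ?thesis using yz by simp
  qed
  \<comment> \<open>Once more \<open>E\<close>, now applied to \<open>2 k = (z - y) f\<close>;
    together with this identity the result leaves \<open>(z - y) k = 0\<close>.\<close>
  have "2 * (y * k t) + 0 * (y * k t) = (z - y) * (y * f t + k t) + 0 * (y * k t)"
    by (rule oscillator2_unique[OF I oscillator2_lin[OF k k] oscillator2_lin[OF f k] _ t])
      (use 3 in \<open>simp add: algebra_simps\<close>)
  moreover have "2 * (y * k t) = (z - y) * (y * f t)" using 3[OF t] by (simp add: mult.left_commute)
  moreover have "(z - y) * (y * f t + k t) = (z - y) * (y * f t) + (z - y) * k t" by (rule distrib_left)
  ultimately have "(z - y) * k t = 0" by linarith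
  with yz have "k t = 0" by simp
  with 3[OF t] yz show ?thesis by simp
qed

definition quasi :: "real \<Rightarrow> real \<Rightarrow> real \<Rightarrow> real \<Rightarrow> real \<Rightarrow> real \<Rightarrow> real" where
  "quasi \<omega> \<alpha> \<beta> \<gamma> \<delta> t = (\<alpha> + \<beta> * t) * cos (\<omega> * t) + (\<gamma> + \<delta> * t) * sin (\<omega> * t)"

lemma DERIV_quasi:
  "(quasi w a b c d has_real_derivative quasi w (b + w * c) (w * d) (d - w * a) (- w * b) t) (at t)"
  unfolding quasi_def by (auto intro!: derivative_eq_intros simp: algebra_simps)

text \<open>Two derivatives multiply a quasi-polynomial of frequency \<open>w\<close> by the
  negative square of \<open>w\<close>, up to the terms with factor \<open>2 * w\<close> that come
  from the linear coefficients. So the operator acts on the coefficients, with \<open>m\<close> on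
  the diagonal.\<close>

lemma oscillator_quasi:
  assumes "m = 1 - w\<^sup>2"
  shows "oscillator I (quasi w a b c d) (quasi w (m * a + 2 * w * d) (m * b) (m * c - 2 * w * b) (m * d))"
proof -
  have "(quasi w (b + w * c) (w * d) (d - w * a) (- w * b) has_real_derivative
      quasi w (m * a + 2 * w * d) (m * b) (m * c - 2 * w * b) (m * d) t - quasi w a b c d t) (at t)" for t
    by (rule DERIV_cong[OF DERIV_quasi]) (simp add: quasi_def assms algebra_simps power2_eq_square)
  with DERIV_quasi show ?thesis unfolding oscillator_def by blast
qed

lemma oscillator_pure:
  assumes "m = 1 - w\<^sup>2"
  shows "oscillator I (quasi w a 0 c 0) (\<lambda>t. m * quasi w a 0 c 0 t)"
proof -
  have "quasi w (m * a + 2 * w * 0) (m * 0) (m * c - 2 * w * 0) (m * 0) = (\<lambda>t. m * quasi w a 0 c 0 t)"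
    by (simp add: fun_eq_iff quasi_def algebra_simps)
  then show ?thesis using oscillator_quasi[OF assms, of I a 0 c 0] by simp
qed

text \<open>This is a Jordan block: the remainder beside \<open>y\<close> times the function has
  constant coefficients, hence is an eigenfunction itself.\<close>

lemma oscillator2_quasi:
  assumes "m = 1 - w\<^sup>2" "y = m\<^sup>2"
  shows "oscillator2 I (quasi w a b c d) (\<lambda>t. y * quasi w a b c d t + quasi w (4 * m * w * d) 0 (- 4 * m * w * b) 0 t)"
proof -
  have "quasi w (m * (m * a + 2 * w * d) + 2 * w * (m * d)) (m * (m * b))
      (m * (m * c - 2 * w * b) - 2 * w * (m * b)) (m * (m * d)) =
    (\<lambda>t. y * quasi w a b c d t + quasi w (4 * m * w * d) 0 (- 4 * m * w * b) 0 t)"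
    by (simp add: fun_eq_iff quasi_def assms(2) algebra_simps power2_eq_square)
  moreover have "oscillator2 I (quasi w a b c d) (quasi w (m * (m * a + 2 * w * d) + 2 * w * (m * d)) (m * (m * b))
      (m * (m * c - 2 * w * b) - 2 * w * (m * b)) (m * (m * d)))"
    unfolding oscillator2_def
    by (rule exI, rule conjI[OF oscillator_quasi oscillator_quasi]) (simp_all add: assms(1))
  ultimately show ?thesis by simp
qed

lemma oscillator2_pure:
  assumes "m = 1 - w\<^sup>2" "y = m\<^sup>2"
  shows "oscillator2 I (quasi w a 0 c 0) (\<lambda>t. y * quasi w a 0 c 0 t)"
proof -
  have "quasi w (4 * m * w * 0) 0 (- 4 * m * w * 0) 0 = (\<lambda>t. 0)" by (simp add: fun_eq_iff quasi_def)
  then show ?thesis using oscillator2_quasi[OF assms, of I a 0 c 0] by simp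
qed

text \<open>The general form of the Jacobian along a normal geodesic: one frequency for each factor
  of the product, and a row linear in \<open>t\<close> for the tangent direction that has a part in
  both factors.\<close>

definition trig_mix :: "real \<Rightarrow> real \<Rightarrow> (nat \<Rightarrow> real) \<Rightarrow> real \<Rightarrow> real" where
  "trig_mix a b k t = cos (a * t) * cos (b * t) * (k 0 + k 1 * t) + sin (a * t) * cos (b * t) * (k 2 + k 3 * t)
     + cos (a * t) * sin (b * t) * (k 4 + k 5 * t) + sin (a * t) * sin (b * t) * (k 6 + k 7 * t)"

lemma trig_mix_quasi:
  "trig_mix a b k t =
    quasi (a + b) ((k 0 - k 6) / 2) ((k 1 - k 7) / 2) ((k 2 + k 4) / 2) ((k 3 + k 5) / 2) t
    + quasi (a - b) ((k 0 + k 6) / 2) ((k 1 + k 7) / 2) ((k 2 - k 4) / 2) ((k 3 - k 5) / 2) t"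
  by (simp add: trig_mix_def quasi_def distrib_right left_diff_distrib cos_add cos_diff sin_add sin_diff field_simps)

text \<open>After the product-to-sum formulas each frequency contributes its own remainder. As both
  frequencies share the eigenvalue \<open>4 * a\<^sup>2 * b\<^sup>2\<close>, the remainders add up
  to a single eigenfunction \<open>h\<close>.\<close>

lemma oscillator2_trig_mix:
  assumes "a\<^sup>2 + b\<^sup>2 = 1"
  shows "\<exists>h. oscillator2 I (trig_mix a b k) (\<lambda>t. 4 * a\<^sup>2 * b\<^sup>2 * trig_mix a b k t + h t) \<and>
    oscillator2 I h (\<lambda>t. 4 * a\<^sup>2 * b\<^sup>2 * h t)"
proof -
  define y where "y = 4 * a\<^sup>2 * b\<^sup>2"
  have m: "- (2 * a * b) = 1 - (a + b)\<^sup>2" "2 * a * b = 1 - (a - b)\<^sup>2"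
    using assms by (simp_all add: power2_sum power2_diff)
  have y: "y = (- (2 * a * b))\<^sup>2" "y = (2 * a * b)\<^sup>2" by (simp_all add: y_def power_mult_distrib)
  let ?q1 = "quasi (a + b) ((k 0 - k 6) / 2) ((k 1 - k 7) / 2) ((k 2 + k 4) / 2) ((k 3 + k 5) / 2)"
  let ?q2 = "quasi (a - b) ((k 0 + k 6) / 2) ((k 1 + k 7) / 2) ((k 2 - k 4) / 2) ((k 3 - k 5) / 2)"
  obtain h1 where h1: "oscillator2 I ?q1 (\<lambda>t. y * ?q1 t + h1 t)" "oscillator2 I h1 (\<lambda>t. y * h1 t)"
    by (rule that[OF oscillator2_quasi[OF m(1) y(1)] oscillator2_pure[OF m(1) y(1)]])
  obtain h2 where h2: "oscillator2 I ?q2 (\<lambda>t. y * ?q2 t + h2 t)" "oscillator2 I h2 (\<lambda>t. y * h2 t)"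
    by (rule that[OF oscillator2_quasi[OF m(2) y(2)] oscillator2_pure[OF m(2) y(2)]])
  have t: "trig_mix a b k = (\<lambda>t. 1 * ?q1 t + 1 * ?q2 t)" by (simp add: trig_mix_quasi fun_eq_iff)
  have "oscillator2 I (trig_mix a b k) (\<lambda>t. y * trig_mix a b k t + (1 * h1 t + 1 * h2 t))"
    using oscillator2_lin[OF h1(1) h2(1), of 1 1] unfolding t by (simp add: algebra_simps)
  moreover have "oscillator2 I (\<lambda>t. 1 * h1 t + 1 * h2 t) (\<lambda>t. y * (1 * h1 t + 1 * h2 t))"
    using oscillator2_lin[OF h1(2) h2(2), of 1 1] by (simp add: algebra_simps)
  ultimately show ?thesis unfolding y_def by (intro exI[of _ "\<lambda>t. 1 * h1 t + 1 * h2 t"] conjI)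
qed

text \<open>With different eigenvalues the common function would lie in two generalized eigenspaces
  that meet only in 0, contrary to its value \<open>k 0\<close> at time 0. Only the frequencies are
  compared; the coefficients remain free.\<close>

lemma trig_mix_frequencies:
  assumes "a\<^sup>2 + b\<^sup>2 = 1" "c\<^sup>2 + d\<^sup>2 = 1" "\<epsilon> > 0" "k 0 \<noteq> 0"
    and "\<And>t. t \<in> {-\<epsilon><..<\<epsilon>} \<Longrightarrow> trig_mix a b k t = trig_mix c d l t"
  shows "a\<^sup>2 * b\<^sup>2 = c\<^sup>2 * d\<^sup>2"
proof (rule ccontr)
  assume "\<not> ?thesis"
  then have ne: "4 * a\<^sup>2 * b\<^sup>2 \<noteq> 4 * c\<^sup>2 * d\<^sup>2" by simp
  obtain h where "oscillator2 {-\<epsilon><..<\<epsilon>} (trig_mix a b k) (\<lambda>t. 4 * a\<^sup>2 * b\<^sup>2 * trig_mix a b k t + h t)"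
    "oscillator2 {-\<epsilon><..<\<epsilon>} h (\<lambda>t. 4 * a\<^sup>2 * b\<^sup>2 * h t)" using oscillator2_trig_mix[OF assms(1)] by blast
  moreover obtain h' where "oscillator2 {-\<epsilon><..<\<epsilon>} (trig_mix c d l) (\<lambda>t. 4 * c\<^sup>2 * d\<^sup>2 * trig_mix c d l t + h' t)"
    "oscillator2 {-\<epsilon><..<\<epsilon>} h' (\<lambda>t. 4 * c\<^sup>2 * d\<^sup>2 * h' t)" using oscillator2_trig_mix[OF assms(2)] by blast
  ultimately have "trig_mix a b k 0 = 0"
    using generalized_eigenfunctions_disjoint[of "{-\<epsilon><..<\<epsilon>}" 0, OF _ _ ne] assms(3,5) by fastforce
  then show False using assms(4) by (simp add: trig_mix_def)
qed

lemma sin_nonzero_near_0: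
  assumes "w \<noteq> 0" "\<epsilon> > 0"
  shows "\<exists>t. t \<in> {-\<epsilon><..<\<epsilon>} \<and> sin (w * t) \<noteq> (0::real)"
proof -
  define t where "t = min (\<epsilon> / 2) (1 / \<bar>w\<bar>)"
  have t: "0 < t" "t < \<epsilon>" "\<bar>w\<bar> * t \<le> 1" using assms by (auto simp: t_def min_def field_simps)
  have "0 < sin (\<bar>w\<bar> * t)" by (rule sin_gt_zero2) (use t assms pi_half_gt_zero pi_gt3 in auto)
  then have "sin (w * t) \<noteq> 0" by (cases "w \<ge> 0") auto
  then show ?thesis using t by (intro exI[of _ t]) auto
qed

text \<open>The left side splits into the frequencies \<open>a + b\<close> and \<open>a - b\<close>,
  which have different eigenvalues under the operator of \<open>oscillator\<close> because
  \<open>a * b\<close> is positive; so both parts vanish. For \<open>a = b\<close> the sine of the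
  second frequency is identically 0, which is why \<alpha> and \<beta> are then known only through
  their sum.\<close>

lemma trig_mix_zero:
  fixes \<alpha> \<beta> \<gamma> :: real
  assumes ab: "a > 0" "b > 0" and e: "\<epsilon> > 0"
    and 0: "\<And>t. t \<in> {-\<epsilon><..<\<epsilon>} \<Longrightarrow>
      \<alpha> * (sin (a * t) * cos (b * t)) + \<beta> * (cos (a * t) * sin (b * t)) + \<gamma> * (sin (a * t) * sin (b * t)) = 0"
  shows "\<alpha> + \<beta> = 0" "\<gamma> = 0" "a \<noteq> b \<Longrightarrow> \<alpha> = 0"
proof -
  define k :: "nat \<Rightarrow> real" where "k = (\<lambda>i. if i = 2 then \<alpha> else if i = 4 then \<beta> else if i = 6 then \<gamma> else 0)"
  define f where "f = quasi (a + b) (- \<gamma> / 2) 0 ((\<alpha> + \<beta>) / 2) 0"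
  define g where "g = quasi (a - b) (\<gamma> / 2) 0 ((\<alpha> - \<beta>) / 2) 0"
  let ?I = "{-\<epsilon><..<\<epsilon>}"
  have fg: "1 * f t + 1 * g t = 0 * f t + 0 * g t" if "t \<in> ?I" for t
    using 0[OF that] trig_mix_quasi[of a b k t] by (simp add: trig_mix_def k_def f_def g_def algebra_simps)
  define m1 m2 where "m1 = 1 - (a + b)\<^sup>2" and "m2 = 1 - (a - b)\<^sup>2"
  have ne: "m1 \<noteq> m2" using ab by (simp add: m1_def m2_def power2_sum power2_diff)
  have of: "oscillator ?I f (\<lambda>t. m1 * f t)"
    unfolding f_def by (rule oscillator_pure[OF m1_def])
  have og: "oscillator ?I g (\<lambda>t. m2 * g t)"
    unfolding g_def by (rule oscillator_pure[OF m2_def])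
  have "1 * (m1 * f t) + 1 * (m2 * g t) = 0 * (m1 * f t) + 0 * (m2 * g t)" if "t \<in> ?I" for t
    by (rule oscillator_unique[OF _ oscillator_lin[OF of og] oscillator_lin[OF of og] fg that]) auto
  then have mfg: "m1 * f t + m2 * g t = 0 \<and> f t + g t = 0" if "t \<in> ?I" for t
    using that fg[OF that] by fastforce
  have fz: "f t = 0 \<and> g t = 0" if "t \<in> ?I" for t
  proof -
    have 1: "m1 * f t + m2 * g t = 0" "g t = - f t" using mfg[OF that] by auto
    then have "(m1 - m2) * f t = 0" by (simp add: algebra_simps)
    with ne 1 show ?thesis by simp
  qed
  from fz[of 0] e show g0: "\<gamma> = 0" by (simp add: f_def quasi_def)
  obtain t where t: "t \<in> ?I" "sin ((a + b) * t) \<noteq> 0" using sin_nonzero_near_0[of "a + b", OF _ e] ab by auto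
  then show 1: "\<alpha> + \<beta> = 0" using fz[OF t(1)] g0 by (simp add: f_def quasi_def)
  show "\<alpha> = 0" if ne': "a \<noteq> b"
  proof -
    obtain t where t: "t \<in> ?I" "sin ((a - b) * t) \<noteq> 0" using sin_nonzero_near_0[of "a - b", OF _ e] ne' by auto
    then have "\<alpha> - \<beta> = 0" using fz[OF t(1)] g0 by (simp add: g_def quasi_def)
    with 1 show ?thesis by simp
  qed
qed

text \<open>The quotient \<open>f / g\<close> has derivative 0. In the application \<open>h\<close>
  is built from normals and mean curvatures chosen separately for each time, so the argument must
  work without any regularity of \<open>h\<close>.\<close>

lemma logarithmic_derivative_unique:
  fixes f g :: "real \<Rightarrow> real"
  assumes e: "\<epsilon> > 0"
    and f: "\<And>t. t \<in> {-\<epsilon><..<\<epsilon>} \<Longrightarrow> (f has_real_derivative h t * f t) (at t)"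
    and g: "\<And>t. t \<in> {-\<epsilon><..<\<epsilon>} \<Longrightarrow> (g has_real_derivative h t * g t) (at t)"
    and nz: "\<And>t. t \<in> {-\<epsilon><..<\<epsilon>} \<Longrightarrow> g t \<noteq> 0" and "f 0 = 1" "g 0 = 1" and t: "t \<in> {-\<epsilon><..<\<epsilon>}"
  shows "f t = g t"
proof -
  have "((\<lambda>t. f t / g t) has_real_derivative 0) (at s)" if "s \<in> {-\<epsilon><..<\<epsilon>}" for s
    by (rule derivative_eq_intros f[OF that] g[OF that] nz[OF that] refl)+ (simp add: algebra_simps)
  then have "\<exists>c. \<forall>s\<in>{-\<epsilon><..<\<epsilon>}. f s / g s = c"
    by (intro has_field_derivative_zero_constant) (auto intro: has_field_derivative_at_within)
  then have "f t / g t = f 0 / g 0" using t e by force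
  then show ?thesis using assms nz[OF t] by simp
qed

section \<open>Linear algebra\<close>

definition triple :: "real^3 \<Rightarrow> real^3 \<Rightarrow> real^3 \<Rightarrow> real" where
  "triple x y z = x \<bullet> cross3 y z"

lemma triple_zero_common_normal:
  assumes "triple x y z = 0"
  shows "\<exists>w. w \<noteq> 0 \<and> x \<bullet> w = 0 \<and> y \<bullet> w = 0 \<and> z \<bullet> w = 0"
proof -
  have "det (vector [x, y, z] :: real^3^3) = 0" using assms by (simp add: triple_def dot_cross_det)
  then obtain w where w: "w \<noteq> 0" "(vector [x, y, z] :: real^3^3) *v w = 0"
    using matrix_nonfull_linear_equations_eq[of "vector [x, y, z] :: real^3^3"] det_eq_0_rank[of "vector [x, y, z] :: real^3^3"] by auto
  have "x \<bullet> w = ((vector [x, y, z] :: real^3^3) *v w) $ 1" "y \<bullet> w = ((vector [x, y, z] :: real^3^3) *v w) $ 2"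
    "z \<bullet> w = ((vector [x, y, z] :: real^3^3) *v w) $ 3"
    by (simp_all add: matrix_vector_mult_def inner_vec_def sum_3 vector_def)
  with w show ?thesis by auto
qed

text \<open>Cramer's rule in dimension 3: the normalised cross products form the reciprocal
  basis.\<close>

lemma triple_dual:
  assumes "triple x y z \<noteq> 0"
  defines "d \<equiv> triple x y z"
  shows "x \<bullet> (cross3 y z /\<^sub>R d) = 1" "y \<bullet> (cross3 y z /\<^sub>R d) = 0" "z \<bullet> (cross3 y z /\<^sub>R d) = 0"
    "x \<bullet> (cross3 z x /\<^sub>R d) = 0" "y \<bullet> (cross3 z x /\<^sub>R d) = 1" "z \<bullet> (cross3 z x /\<^sub>R d) = 0"
    "x \<bullet> (cross3 x y /\<^sub>R d) = 0" "y \<bullet> (cross3 x y /\<^sub>R d) = 0" "z \<bullet> (cross3 x y /\<^sub>R d) = 1"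
proof -
  have "y \<bullet> cross3 z x = d" "z \<bullet> cross3 x y = d" "x \<bullet> cross3 y z = d"
    unfolding d_def triple_def by (simp_all add: cross3_simps)
  then show "x \<bullet> (cross3 y z /\<^sub>R d) = 1" "y \<bullet> (cross3 y z /\<^sub>R d) = 0" "z \<bullet> (cross3 y z /\<^sub>R d) = 0"
    "x \<bullet> (cross3 z x /\<^sub>R d) = 0" "y \<bullet> (cross3 z x /\<^sub>R d) = 1" "z \<bullet> (cross3 z x /\<^sub>R d) = 0"
    "x \<bullet> (cross3 x y /\<^sub>R d) = 0" "y \<bullet> (cross3 x y /\<^sub>R d) = 0" "z \<bullet> (cross3 x y /\<^sub>R d) = 1"
    using assms(1) by (simp_all add: dot_cross_self d_def)
qed

lemma triple_separates:
  assumes "triple x y z \<noteq> 0" "x \<bullet> v = x \<bullet> w" "y \<bullet> v = y \<bullet> w" "z \<bullet> v = z \<bullet> w"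
  shows "v = w"
proof -
  have "triple x y z *\<^sub>R u = (x \<bullet> u) *\<^sub>R cross3 y z + (y \<bullet> u) *\<^sub>R cross3 z x + (z \<bullet> u) *\<^sub>R cross3 x y" for u
    by (simp add: triple_def cross3_simps forall_3)
  then have "triple x y z *\<^sub>R v = triple x y z *\<^sub>R w" using assms(2-4) by simp
  then show ?thesis using assms(1) by simp
qed

text \<open>Jacobi's formula: for \<open>W B = - W'\<close>, with \<open>W\<close> and \<open>W'\<close> given by their rows.\<close>

lemma trace_triple:
  assumes "\<And>v. x \<bullet> B v = - (x' \<bullet> v)" "\<And>v. y \<bullet> B v = - (y' \<bullet> v)" "\<And>v. z \<bullet> B v = - (z' \<bullet> v)"
  shows "trace (matrix B) * triple x y z = - (triple x' y z + triple x y' z + triple x y z')"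
proof -
  have 1: "u' $ j = - (u $ 1 * B (axis j 1) $ 1 + u $ 2 * B (axis j 1) $ 2 + u $ 3 * B (axis j 1) $ 3)"
    if "\<And>v. u \<bullet> B v = - (u' \<bullet> v)" for u u' :: "real^3" and j
    using that[of "axis j 1"] by (simp add: inner_vec_def[of u] sum_3 inner_axis)
  show ?thesis
    unfolding triple_def trace_def matrix_def sum_3 inner_vec_def cross_components
    by (simp add: 1[OF assms(1)] 1[OF assms(2)] 1[OF assms(3)] cross3_def vector_def algebra_simps)
qed

text \<open>The shape operator is given only by a definite description. Once its defining condition
  is split into three scalar equations with independent rows, the reciprocal basis shows that the
  description denotes, and Jacobi's formula gives the trace without computing the operator.\<close>

lemma trace_implicit_operator:
  fixes P :: "real^3 \<Rightarrow> real^3 \<Rightarrow> bool"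
  assumes P: "\<And>v w. P v w \<longleftrightarrow> x \<bullet> w = - (x' \<bullet> v) \<and> y \<bullet> w = - (y' \<bullet> v) \<and> z \<bullet> w = - (z' \<bullet> v)"
    and nz: "triple x y z \<noteq> 0"
  shows "trace (matrix (\<lambda>v. THE w. P v w)) * triple x y z = - (triple x' y z + triple x y' z + triple x y z')"
proof -
  define d where "d = triple x y z"
  have ex: "P v (THE w. P v w)" for v
  proof (rule theI)
    let ?w = "- ((x' \<bullet> v) *\<^sub>R (cross3 y z /\<^sub>R d) + (y' \<bullet> v) *\<^sub>R (cross3 z x /\<^sub>R d) + (z' \<bullet> v) *\<^sub>R (cross3 x y /\<^sub>R d))"
    show "P v ?w" unfolding P inner_minus_right inner_add_right inner_scaleR_right[of _ "_ \<bullet> v"]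
      using triple_dual[OF nz] unfolding d_def by auto
    show "w = ?w" if "P v w" for w
      using that \<open>P v ?w\<close> unfolding P by (intro triple_separates[OF nz]) auto
  qed
  show ?thesis by (rule trace_triple) (use ex in \<open>auto simp: P\<close>)
qed

lemma cross3_frame:
  fixes p n :: "real^3"
  assumes "norm p = 1" "norm n = 1" "p \<bullet> n = 0"
  defines "u \<equiv> cross3 p n"
  shows "norm u = 1" "u \<bullet> p = 0" "u \<bullet> n = 0"
    and "w = (w \<bullet> p) *\<^sub>R p + (w \<bullet> n) *\<^sub>R n + (w \<bullet> u) *\<^sub>R u"
proof -
  have "(norm u)\<^sup>2 = 1" using norm_cross_dot[of p n] assms by simp
  then show nu: "norm u = 1" using norm_ge_zero[of u] by (simp add: power2_eq_1_iff)
  show o: "u \<bullet> p = 0" "u \<bullet> n = 0" by (simp_all add: u_def dot_cross_self)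
  have "triple p n u = 1" using nu by (simp add: triple_def u_def cross3_simps norm_eq_1)
  then show "w = (w \<bullet> p) *\<^sub>R p + (w \<bullet> n) *\<^sub>R n + (w \<bullet> u) *\<^sub>R u"
    using assms o nu
    by (intro triple_separates[of p n u]) (simp_all add: inner_add_right inner_commute norm_eq_1)
qed

lemma frame_eqI:
  fixes p n :: "real^3"
  assumes "norm p = 1" "norm n = 1" "p \<bullet> n = 0"
    "v \<bullet> p = w \<bullet> p" "v \<bullet> n = w \<bullet> n" "v \<bullet> cross3 p n = w \<bullet> cross3 p n"
  shows "v = w"
  using cross3_frame(4)[OF assms(1-3), of v] cross3_frame(4)[OF assms(1-3), of w] assms(4-6) by simp

lemma unit_orthogonal_exists:
  fixes p :: "real^3" obtains n where "norm n = 1" "p \<bullet> n = 0"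
proof -
  obtain x where "x \<noteq> 0" "orthogonal p x" using orthogonal_to_vector_exists[of p] by auto
  then have "norm (sgn x) = 1" "p \<bullet> sgn x = 0" by (simp_all add: norm_sgn orthogonal_def sgn_div_norm)
  then show ?thesis using that by blast
qed

text \<open>Dimensions decide: the orthogonal complement of the three unit vectors in
  \<open>R6\<close> has dimension 6 - 3 = 3, and the range of the injective map \<open>L\<close>,
  which lies in it, has dimension 3 as well.\<close>

lemma range_eq_orthogonal_complement:
  fixes L :: "real^3 \<Rightarrow> R6"
  assumes L: "linear L" "inj L"
    and e: "norm e1 = 1" "norm e2 = 1" "norm e3 = 1" "e1 \<bullet> e2 = 0" "e1 \<bullet> e3 = 0" "e2 \<bullet> e3 = 0"
    and o: "\<And>v. L v \<bullet> e1 = 0" "\<And>v. L v \<bullet> e2 = 0" "\<And>v. L v \<bullet> e3 = 0"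
    and w: "w \<bullet> e1 = 0" "w \<bullet> e2 = 0" "w \<bullet> e3 = 0"
  shows "w \<in> range L"
proof -
  let ?B = "{e1, e2, e3}"
  have e': "e2 \<bullet> e1 = 0" "e3 \<bullet> e1 = 0" "e3 \<bullet> e2 = 0" using e by (simp_all add: inner_commute)
  have ne: "e1 \<noteq> e2" "e1 \<noteq> e3" "e2 \<noteq> e3" "e1 \<noteq> 0" "e2 \<noteq> 0" "e3 \<noteq> 0" using e by auto
  have "pairwise orthogonal ?B" unfolding pairwise_def orthogonal_def using e e' by blast
  then have "independent ?B" using ne by (intro pairwise_orthogonal_independent) simp_all
  then have "dim ?B = card ?B" by (rule dim_eq_card_independent)
  moreover have "card ?B = 3" using ne by simp
  ultimately have dB: "dim (span ?B) = 3" by (simp only: dim_span)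
  let ?C = "{y. \<forall>x\<in>span ?B. orthogonal x y}"
  have C: "y \<in> ?C \<longleftrightarrow> y \<bullet> e1 = 0 \<and> y \<bullet> e2 = 0 \<and> y \<bullet> e3 = 0" for y
  proof
    assume y: "y \<bullet> e1 = 0 \<and> y \<bullet> e2 = 0 \<and> y \<bullet> e3 = 0"
    have "orthogonal y b" if "b \<in> ?B" for b using that y unfolding orthogonal_def by blast
    then have "orthogonal y x" if "x \<in> span ?B" for x
      using that by (intro orthogonal_to_span[of x ?B y])
    then show "y \<in> ?C" by (simp add: orthogonal_commute)
  next
    assume "y \<in> ?C"
    then have "orthogonal b y" if "b \<in> ?B" for b using that span_base[of b ?B] by blast
    then show "y \<bullet> e1 = 0 \<and> y \<bullet> e2 = 0 \<and> y \<bullet> e3 = 0"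
      unfolding orthogonal_def by (simp add: inner_commute)
  qed
  have "dim ?C + dim (span ?B) = dim (UNIV :: R6 set)"
    using dim_subspace_orthogonal_to_vectors[of "span ?B" "UNIV :: R6 set"] by (simp add: subspace_span)
  then have dC: "dim ?C = 3" using dB by simp
  have dR: "dim (range L) = 3" using dim_image_eq[OF L(1), of UNIV] L(2) by simp
  have "range L = ?C"
  proof (rule subspace_dim_equal)
    show "subspace (range L)" using L(1) by (simp add: linear_subspace_image)
    show "subspace ?C" by (rule subspace_orthogonal_to_vectors)
    show "range L \<subseteq> ?C"
    proof
      fix y assume "y \<in> range L"
      then show "y \<in> ?C" unfolding C using o by auto
    qed
    show "dim ?C \<le> dim (range L)" using dC dR by simp
  qed
  then show ?thesis using C[of w] w by blast
qed

text \<open>Near a regular point of \<open>F\<close>, an immersed piece of maximal dimension fills the level set: the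
  adjoint of \<open>f'\<close> projects it onto an open set by Sussmann's theorem, and together with \<open>F\<close> it is locally injective.\<close>

lemma immersion_fills_level_set:
  fixes f :: "real^3 \<Rightarrow> R6" and F :: "R6 \<Rightarrow> 'b::euclidean_space"
  assumes U: "open U" "x \<in> U" and f: "continuous_on U f" "(f has_derivative f') (at x)" "inj f'"
    and F: "\<And>z. (F has_derivative F' z) (at z)"
    and F'c: "\<And>e. e > 0 \<Longrightarrow> \<exists>d>0. \<forall>z. dist (f x) z < d \<longrightarrow> onorm (\<lambda>v. F' z v - F' (f x) v) < e"
    and Ff: "\<And>y. y \<in> U \<Longrightarrow> F (f y) = c"
    and ker: "\<And>w. F' (f x) w = 0 \<Longrightarrow> w \<in> range f'"
  shows "\<exists>V. open V \<and> f x \<in> V \<and> (\<forall>z\<in>V. F z = c \<longrightarrow> z \<in> f ` U)"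
proof -
  have lf: "linear f'" using f(2) has_derivative_linear by blast
  let ?\<pi> = "adjoint f'"
  have l\<pi>: "linear ?\<pi>" by (rule adjoint_linear[OF lf])
  have b\<pi>: "bounded_linear ?\<pi>" using l\<pi> linear_conv_bounded_linear by blast
  have i\<pi>: "v = 0" if "?\<pi> (f' v) = 0" for v
  proof -
    have "f' v \<bullet> f' v = 0" using adjoint_works[OF lf, of v "f' v"] that by simp
    then have "f' v = 0" by simp
    then show ?thesis using f(3) lf by (metis injD linear_0)
  qed
  define h where "h = (\<lambda>z. (?\<pi> z, F z))"
  define h' where "h' = (\<lambda>z w. (?\<pi> w, F' z w))"
  have dh: "(h has_derivative h' z) (at z)" for z
    unfolding h_def h'_def
    by (intro has_derivative_Pair F bounded_linear_imp_has_derivative b\<pi>)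
  have lh: "linear (h' z)" for z using dh has_derivative_linear by blast
  \<comment> \<open>A vector killed by the derivative of \<open>F\<close> lies in the range of
    \<open>f'\<close>, where the adjoint is injective; so the pair has no kernel.\<close>
  have ih: "inj (h' (f x))"
  proof (subst linear_injective_0[OF lh], intro allI impI)
    fix w assume "h' (f x) w = 0"
    then have "?\<pi> w = 0" "F' (f x) w = 0" by (auto simp: h'_def zero_prod_def)
    then obtain v where "w = f' v" using ker by blast
    with \<open>?\<pi> w = 0\<close> i\<pi> show "w = 0" using linear_0[OF lf] by metis
  qed
  obtain g where g: "linear g" "g \<circ> h' (f x) = id"
    using linear_injective_left_inverse[OF lh ih] by blast
  have hc: "\<exists>d>0. \<forall>z. dist (f x) z < d \<longrightarrow> onorm (\<lambda>v. h' z v - h' (f x) v) < e" if "e > 0" for e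
  proof -
    have "onorm (\<lambda>v. h' z v - h' (f x) v) = onorm (\<lambda>v. F' z v - F' (f x) v)" for z
      unfolding onorm_def h'_def by (simp add: norm_Pair)
    then show ?thesis using F'c[OF that] by simp
  qed
  have bg: "bounded_linear g" using g(1) linear_conv_bounded_linear by blast
  obtain r where r: "r > 0" "inj_on h (ball (f x) r)"
    by (rule has_derivative_locally_injective[OF UNIV_I open_UNIV bg g(2) dh hc]) auto
  define T where "T = U \<inter> f -` ball (f x) r"
  have T: "open T" "x \<in> T" using U f(1) r(1) by (auto simp: T_def continuous_open_preimage)
  let ?k = "\<lambda>y. ?\<pi> (f y)"
  have dk: "(?k has_derivative (\<lambda>v. ?\<pi> (f' v))) (at x)"
    by (rule bounded_linear.has_derivative[OF b\<pi> f(2)])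
  have lk: "linear (\<lambda>v. ?\<pi> (f' v))" using dk has_derivative_linear by blast
  have "inj (\<lambda>v. ?\<pi> (f' v))" using i\<pi> by (subst linear_injective_0[OF lk]) auto
  \<comment> \<open>An injective linear map of \<open>real^3\<close> to itself is onto, as
    Sussmann's theorem requires.\<close>
  then have "surj (\<lambda>v. ?\<pi> (f' v))" using linear_injective_imp_surjective lk by blast
  then obtain g' where g': "linear g'" "(\<lambda>v. ?\<pi> (f' v)) \<circ> g' = id"
    using linear_surjective_right_inverse[OF lk] by blast
  have ck: "continuous_on T ?k"
    by (rule bounded_linear.continuous_on[OF b\<pi>]) (use f(1) in \<open>auto simp: T_def intro: continuous_on_subset\<close>)
  have int: "?k x \<in> interior (?k ` T)"
    by (rule sussmann_open_mapping[OF T(1) ck T(2) dk _ g'(2) subset_refl])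
      (use g' T in \<open>auto simp: linear_conv_bounded_linear interior_open\<close>)
  \<comment> \<open>\<open>V\<close> collects the points near \<open>f x\<close> whose projection
    lies inside the projected piece. On the level set, injectivity of \<open>h\<close> identifies
    such a point with the point of the piece that has the same projection.\<close>
  define V where "V = ball (f x) r \<inter> ?\<pi> -` interior (?k ` T)"
  have "open V" unfolding V_def
    by (intro open_Int open_ball open_vimage open_interior linear_continuous_on b\<pi>)
  moreover have "f x \<in> V" using int r by (simp add: V_def)
  moreover have "z \<in> f ` U" if z: "z \<in> V" "F z = c" for z
  proof -
    obtain y where y: "y \<in> T" "?\<pi> z = ?k y" using z(1) interior_subset[of "?k ` T"] by (auto simp: V_def)
    have "h z = h (f y)" using y z(2) Ff[of y] by (simp add: h_def T_def)
    moreover have "f y \<in> ball (f x) r" "z \<in> ball (f x) r" using y z by (auto simp: T_def V_def)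
    ultimately have "z = f y" using r(2) by (metis inj_on_eq_iff)
    then show ?thesis using y by (auto simp: T_def)
  qed
  ultimately show ?thesis by blast
qed

section \<open>Parallel hypersurfaces\<close>

text \<open>The part of \<open>N'\<close> orthogonal to \<open>N\<close> is tangent to
  \<open>S2S2\<close>, hence lies in the range of \<open>L\<close> by dimension. As both normals are
  orthogonal to that range, this part is orthogonal to itself.\<close>

lemma unit_normal_unique:
  fixes L :: "real^3 \<Rightarrow> R6"
  assumes L: "linear L" "inj L" and z: "z \<in> S2S2"
    and t: "\<And>v. L v \<in> tangent_S2S2 z" "N \<in> tangent_S2S2 z" "N' \<in> tangent_S2S2 z"
    and n: "norm N = 1" "norm N' = 1" "\<And>v. L v \<bullet> N = 0" "\<And>v. L v \<bullet> N' = 0"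
  shows "N' = (N' \<bullet> N) *\<^sub>R N" "(N' \<bullet> N)\<^sup>2 = 1"
proof -
  let ?w = "N' - (N' \<bullet> N) *\<^sub>R N"
  have nz: "norm (fst z) = 1" "norm (snd z) = 1" using z by (auto simp: S2S2_def mem_Times_iff)
  have NN: "N \<bullet> N = 1" using n(1) by (simp add: norm_eq_1)
  have p: "y \<bullet> (fst z, 0) = 0" "y \<bullet> (0, snd z) = 0" "(fst z, 0) \<bullet> y = 0" "(0, snd z) \<bullet> y = 0"
    if "y \<in> tangent_S2S2 z" for y :: R6
    using that by (simp_all add: tangent_S2S2_def inner_prod_def inner_commute)
  have w: "?w \<in> tangent_S2S2 z"
    using t(2,3) by (simp add: tangent_S2S2_def inner_diff_left)
  have "?w \<bullet> N = 0" by (simp add: inner_diff_left NN)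
  then have "?w \<in> range L"
    by (intro range_eq_orthogonal_complement[OF L, of "(fst z, 0)" "(0, snd z)" N])
      (simp_all add: nz n p[OF t(1)] p[OF t(2)] p[OF w] norm_Pair)
  then obtain v where v: "?w = L v" by blast
  have "L v \<bullet> ?w = 0" using n(3)[of v] n(4)[of v] by (simp add: inner_diff_right)
  then have "?w = 0" unfolding v by simp
  then show e: "N' = (N' \<bullet> N) *\<^sub>R N" by simp
  have "N' \<bullet> N' = (N' \<bullet> N)\<^sup>2" by (subst (1 2) e) (simp add: NN power2_eq_square)
  then show "(N' \<bullet> N)\<^sup>2 = 1" using n(2) by (simp add: norm_eq_1)
qed

lemma orthonormal_combination_eq:
  fixes u w :: "'a::real_inner"
  assumes "norm u = 1" "norm w = 1" "u \<bullet> w = 0"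
  shows "a *\<^sub>R u + b *\<^sub>R w = - (c *\<^sub>R u + d *\<^sub>R w) \<longleftrightarrow> a = - c \<and> b = - d"
proof
  assume *: "a *\<^sub>R u + b *\<^sub>R w = - (c *\<^sub>R u + d *\<^sub>R w)"
  have "u \<bullet> u = 1" "w \<bullet> w = 1" "w \<bullet> u = 0" using assms by (simp_all add: norm_eq_1 inner_commute)
  with arg_cong[OF *, of "\<lambda>z. z \<bullet> u"] arg_cong[OF *, of "\<lambda>z. z \<bullet> w"] assms(3)
  show "a = - c \<and> b = - d" by (simp add: inner_add_left inner_diff_left)
qed (simp add: algebra_simps)

lemma has_derivative_inner_const:
  assumes S: "open S" "x \<in> S" and f: "(f has_derivative f') (at x)" and g: "(g has_derivative g') (at x)"
    and c: "\<And>y. y \<in> S \<Longrightarrow> f y \<bullet> g y = c"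
  shows "f x \<bullet> g' v + f' v \<bullet> g x = 0"
proof -
  have "((\<lambda>y. c) has_derivative (\<lambda>v. f x \<bullet> g' v + f' v \<bullet> g x)) (at x)"
    by (rule has_derivative_transform_within_open[OF has_derivative_inner[OF f g] S c])
  then have "(\<lambda>v. f x \<bullet> g' v + f' v \<bullet> g x) = (\<lambda>v. 0)"
    using has_derivative_unique has_derivative_const by blast
  then show ?thesis by meson
qed

lemma has_derivative_sgn:
  fixes m :: "'a::real_normed_vector \<Rightarrow> 'b::real_inner"
  assumes m: "(m has_derivative m') (at x)" and "m x \<noteq> 0"
  shows "((\<lambda>y. sgn (m y)) has_derivative
    (\<lambda>v. (m' v - (m' v \<bullet> sgn (m x)) *\<^sub>R sgn (m x)) /\<^sub>R norm (m x))) (at x)"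
proof -
  have n: "((\<lambda>y. norm (m y)) has_derivative (\<lambda>v. m' v \<bullet> sgn (m x))) (at x)"
    using has_derivative_compose[OF m has_derivative_norm[OF assms(2)]] .
  have "((\<lambda>y. inverse (norm (m y)) *\<^sub>R m y) has_derivative
      (\<lambda>v. inverse (norm (m x)) *\<^sub>R m' v +
        (- (inverse (norm (m x)) * (m' v \<bullet> sgn (m x)) * inverse (norm (m x)))) *\<^sub>R m x)) (at x)"
    by (rule has_derivative_scaleR[OF Deriv.has_derivative_inverse[OF _ n] m]) (use assms(2) in simp)
  then show ?thesis
    by (simp add: sgn_div_norm algebra_simps)
qed

text \<open>\<open>D v - (D v \<bullet> pt) pt\<close> is the covariant derivative of the velocity of the geodesics.\<close>

lemma great_circle_variation:
  fixes p m :: "'a::real_normed_vector \<Rightarrow> real^3" and t :: real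
  assumes p: "(p has_derivative p') (at x)" and m: "(m has_derivative m') (at x)"
    and n: "norm (p x) = 1" "m x \<bullet> p x = 0" "m x \<noteq> 0"
    and o: "\<And>v. p' v \<bullet> p x = 0" "\<And>v. m' v \<bullet> p x = - (m x \<bullet> p' v)"
  defines "a \<equiv> norm (m x)" and "n1 \<equiv> sgn (m x)"
  defines "u \<equiv> cross3 (p x) n1"
  defines "nt \<equiv> cos (a * t) *\<^sub>R n1 - sin (a * t) *\<^sub>R p x" and "pt \<equiv> great_circle (p x) (m x) t"
  shows "norm pt = 1" "norm nt = 1" "norm u = 1" "pt \<bullet> nt = 0" "nt \<bullet> u = 0" "pt \<bullet> u = 0"
    and "great_circle' (p x) (m x) t = a *\<^sub>R nt"
    and "((\<lambda>y. great_circle (p y) (m y) t) has_derivative (\<lambda>v. (p' v \<bullet> n1 + t * (m' v \<bullet> n1)) *\<^sub>R nt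
        + (cos (a * t) * (p' v \<bullet> u) + sin (a * t) / a * (m' v \<bullet> u)) *\<^sub>R u)) (at x)"
    and "\<exists>D. ((\<lambda>y. great_circle' (p y) (m y) t) has_derivative D) (at x) \<and>
      (\<forall>v. D v - (D v \<bullet> pt) *\<^sub>R pt = (m' v \<bullet> n1) *\<^sub>R nt
        + (cos (a * t) * (m' v \<bullet> u) - a * sin (a * t) * (p' v \<bullet> u)) *\<^sub>R u)"
proof -
  have a: "a > 0" using n(3) by (simp add: a_def)
  have mx: "m x = a *\<^sub>R n1" using n(3) by (simp add: a_def n1_def sgn_div_norm)
  have n1: "norm n1 = 1" "p x \<bullet> n1 = 0"
    using n by (auto simp: n1_def norm_sgn sgn_div_norm inner_commute)
  note fr = cross3_frame[OF n(1) n1, folded u_def]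
  have ip: "p x \<bullet> p x = 1" "n1 \<bullet> n1 = 1" "u \<bullet> u = 1" "n1 \<bullet> p x = 0" "p x \<bullet> u = 0" "n1 \<bullet> u = 0"
    "p x \<bullet> n1 = 0" "u \<bullet> p x = 0" "u \<bullet> n1 = 0"
    using n n1 fr by (simp_all add: norm_eq_1 inner_commute)
  let ?c = "cos (a * t)" and ?s = "sin (a * t)"
  have cs: "?c * ?c + ?s * ?s = 1" using sin_cos_squared_add3 by simp
  have pt: "pt = ?c *\<^sub>R p x + ?s *\<^sub>R n1" by (simp add: pt_def great_circle_def a_def n1_def)
  show npt: "norm pt = 1" unfolding norm_eq_1 pt using cs by (simp add: inner_add_left inner_add_right ip)
  show nnt: "norm nt = 1"
    unfolding norm_eq_1 nt_def using cs by (simp add: inner_diff_left inner_diff_right ip)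
  show "norm u = 1" by (rule fr(1))
  show ptnt: "pt \<bullet> nt = 0" unfolding pt nt_def
    by (simp add: inner_diff_right inner_add_left ip)
  show ntu: "nt \<bullet> u = 0" "pt \<bullet> u = 0" unfolding pt nt_def
    by (simp_all add: inner_diff_left inner_add_left ip)
  show "great_circle' (p x) (m x) t = a *\<^sub>R nt"
    unfolding great_circle'_def nt_def a_def[symmetric] by (simp add: mx algebra_simps)
  \<comment> \<open>The pair \<open>pt, nt\<close> is the pair \<open>p x, n1\<close> rotated in its
    plane, so the third frame vector does not move along the great circle.\<close>
  have ptu: "cross3 pt nt = u"
  proof -
    have "cross3 pt nt = (?c * ?c + ?s * ?s) *\<^sub>R cross3 (p x) n1"
      unfolding pt nt_def by (simp add: cross_add_left Cross3.right_diff_distrib cross_mult_left cross_mult_right cross_skew[of n1 "p x"] algebra_simps del: sin_cos_squared_add3)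
    then show ?thesis using cs by (simp add: u_def)
  qed
  have mp: "m' v \<bullet> p x = - (a * (p' v \<bullet> n1))" for v
    using o(2)[of v] by (simp add: mx inner_commute)
  have dn: "((\<lambda>y. norm (m y)) has_derivative (\<lambda>v. m' v \<bullet> n1)) (at x)"
    unfolding n1_def using has_derivative_compose[OF m has_derivative_norm[OF n(3)]] .
  have dnt: "((\<lambda>y. norm (m y) * t) has_derivative (\<lambda>v. (m' v \<bullet> n1) * t)) (at x)"
    by (rule has_derivative_mult_left[OF dn])
  have dc: "((\<lambda>y. cos (norm (m y) * t)) has_derivative (\<lambda>v. (m' v \<bullet> n1) * t * - ?s)) (at x)"
    using has_derivative_cos[OF dnt] by (simp add: a_def)
  have ds: "((\<lambda>y. sin (norm (m y) * t)) has_derivative (\<lambda>v. (m' v \<bullet> n1) * t * ?c)) (at x)"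
    using has_derivative_sin[OF dnt] by (simp add: a_def)
  have dsgn: "((\<lambda>y. sgn (m y)) has_derivative (\<lambda>v. (m' v - (m' v \<bullet> n1) *\<^sub>R n1) /\<^sub>R a)) (at x)"
    unfolding n1_def a_def by (rule has_derivative_sgn[OF m n(3)])
  define P where "P v = (?c *\<^sub>R p' v + ((m' v \<bullet> n1) * t * - ?s) *\<^sub>R p x) +
      (?s *\<^sub>R ((m' v - (m' v \<bullet> n1) *\<^sub>R n1) /\<^sub>R a) + ((m' v \<bullet> n1) * t * ?c) *\<^sub>R n1)" for v
  have "((\<lambda>y. great_circle (p y) (m y) t) has_derivative P) (at x)"
    unfolding great_circle_def P_def a_def n1_def
    by (intro has_derivative_add has_derivative_scaleR p dc[unfolded a_def n1_def] ds[unfolded a_def n1_def]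
        dsgn[unfolded a_def n1_def])
  \<comment> \<open>The parts along \<open>p x\<close> and \<open>n1\<close> combine to a multiple
    of \<open>nt\<close>; this is verified on the frame at time 0.\<close>
  moreover have Pv: "P v = (p' v \<bullet> n1 + t * (m' v \<bullet> n1)) *\<^sub>R nt
        + (cos (a * t) * (p' v \<bullet> u) + sin (a * t) / a * (m' v \<bullet> u)) *\<^sub>R u" for v
    by (rule frame_eqI[OF n(1) n1, folded u_def])
      (use a in \<open>simp_all add: P_def nt_def inner_add_left inner_diff_left ip o(1) mp field_simps\<close>)
  ultimately show "((\<lambda>y. great_circle (p y) (m y) t) has_derivative (\<lambda>v. (p' v \<bullet> n1 + t * (m' v \<bullet> n1)) *\<^sub>R nt
        + (cos (a * t) * (p' v \<bullet> u) + sin (a * t) / a * (m' v \<bullet> u)) *\<^sub>R u)) (at x)"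
    unfolding ext[of P, OF Pv] by -
  define Q where "Q v = (?c *\<^sub>R m' v + ((m' v \<bullet> n1) * t * - ?s) *\<^sub>R m x) -
      ((a * ?s) *\<^sub>R p' v + (a * ((m' v \<bullet> n1) * t * ?c) + (m' v \<bullet> n1) * ?s) *\<^sub>R p x)" for v
  have "((\<lambda>y. great_circle' (p y) (m y) t) has_derivative Q) (at x)"
    unfolding great_circle'_def Q_def a_def n1_def
    by (intro has_derivative_diff has_derivative_scaleR has_derivative_mult p m dn[unfolded n1_def]
        dc[unfolded a_def n1_def] ds[unfolded a_def n1_def])
  moreover have "Q v - (Q v \<bullet> pt) *\<^sub>R pt = (m' v \<bullet> n1) *\<^sub>R nt
        + (cos (a * t) * (m' v \<bullet> u) - a * sin (a * t) * (p' v \<bullet> u)) *\<^sub>R u" for v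
  proof -
    have "Q v \<bullet> nt = (?c * ?c + ?s * ?s) * (m' v \<bullet> n1)"
      by (simp add: Q_def nt_def inner_add_left inner_diff_left inner_diff_right ip o(1) mp mx algebra_simps
          del: sin_cos_squared_add3)
    then have 1: "Q v \<bullet> nt = m' v \<bullet> n1" using cs by simp
    have 2: "Q v \<bullet> u = cos (a * t) * (m' v \<bullet> u) - a * sin (a * t) * (p' v \<bullet> u)"
      by (simp add: Q_def inner_add_left inner_diff_left ip mx)
    have "Q v = (Q v \<bullet> pt) *\<^sub>R pt + (Q v \<bullet> nt) *\<^sub>R nt + (Q v \<bullet> u) *\<^sub>R u"
      using cross3_frame(4)[OF npt nnt ptnt, of "Q v"] unfolding ptu .
    then show ?thesis unfolding 1 2 by (simp add: algebra_simps)
  qed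
  ultimately show "\<exists>D. ((\<lambda>y. great_circle' (p y) (m y) t) has_derivative D) (at x) \<and>
      (\<forall>v. D v - (D v \<bullet> pt) *\<^sub>R pt = (m' v \<bullet> n1) *\<^sub>R nt
        + (cos (a * t) * (m' v \<bullet> u) - a * sin (a * t) * (p' v \<bullet> u)) *\<^sub>R u)" by blast
qed

section \<open>A hypersurface in one chart: coframe, Jacobi fields and the Jacobian\<close>

definition covector :: "('a::euclidean_space \<Rightarrow> real) \<Rightarrow> 'a" where
  "covector L = (\<Sum>i\<in>Basis. L i *\<^sub>R i)"

lemma covector_inner: "linear L \<Longrightarrow> covector L \<bullet> v = L v"
  unfolding covector_def inner_sum_left inner_scaleR_left
  by (subst (2) euclidean_representation[of v, symmetric])
    (simp add: linear_sum linear_scale inner_commute mult.commute)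

text \<open>Three times the mean curvature, with the chart absorbed into the two maps;
  \<open>mean_curvature_coords\<close> makes the link.\<close>

definition shape_trace :: "(real^3 \<Rightarrow> R6) \<Rightarrow> (real^3 \<Rightarrow> R6) \<Rightarrow> real^3 \<Rightarrow> real" where
  "shape_trace f g x = trace (matrix (\<lambda>v. THE w. fderiv f x w = - tangent_proj (f x) (fderiv g x v)))"

text \<open>The immersion \<open>(p, q)\<close> and its unit normal \<open>(m, n)\<close> read in
  one chart. Since no manifold occurs, the locale can also be instantiated with the two factors
  exchanged.\<close>

locale local_hypersurface =
  fixes U :: "(real^3) set" and p q m n :: "real^3 \<Rightarrow> real^3"
  assumes U: "open U" and smooth: "smooth_on U p" "smooth_on U q" "smooth_on U m" "smooth_on U n"
    and unit: "\<And>x. x \<in> U \<Longrightarrow> norm (p x) = 1" "\<And>x. x \<in> U \<Longrightarrow> norm (q x) = 1"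
    and tangent: "\<And>x. x \<in> U \<Longrightarrow> m x \<bullet> p x = 0" "\<And>x. x \<in> U \<Longrightarrow> n x \<bullet> q x = 0"
    and unit_normal: "\<And>x. x \<in> U \<Longrightarrow> (norm (m x))\<^sup>2 + (norm (n x))\<^sup>2 = 1"
    and normal: "\<And>x v. x \<in> U \<Longrightarrow> fderiv p x v \<bullet> m x + fderiv q x v \<bullet> n x = 0"
    and immersion: "\<And>x v. x \<in> U \<Longrightarrow> fderiv p x v = 0 \<Longrightarrow> fderiv q x v = 0 \<Longrightarrow> v = 0"
begin

lemmas derivs = smooth_on_has_derivative[OF smooth(1)] smooth_on_has_derivative[OF smooth(2)]
  smooth_on_has_derivative[OF smooth(3)] smooth_on_has_derivative[OF smooth(4)]

lemmas lins = smooth_on_linear[OF smooth(1)] smooth_on_linear[OF smooth(2)]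
  smooth_on_linear[OF smooth(3)] smooth_on_linear[OF smooth(4)]

lemma first_order:
  assumes x: "x \<in> U"
  shows "fderiv p x v \<bullet> p x = 0" "fderiv q x v \<bullet> q x = 0"
    "fderiv m x v \<bullet> p x = - (m x \<bullet> fderiv p x v)" "fderiv n x v \<bullet> q x = - (n x \<bullet> fderiv q x v)"
    "fderiv m x v \<bullet> m x + fderiv n x v \<bullet> n x = 0"
proof -
  note c = has_derivative_inner_const[OF U x]
  show "fderiv p x v \<bullet> p x = 0"
    using c[OF derivs(1)[OF x] derivs(1)[OF x], of 1 v] unit by (simp add: norm_eq_1 inner_commute)
  show "fderiv q x v \<bullet> q x = 0"
    using c[OF derivs(2)[OF x] derivs(2)[OF x], of 1 v] unit by (simp add: norm_eq_1 inner_commute)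
  show "fderiv m x v \<bullet> p x = - (m x \<bullet> fderiv p x v)"
    using c[OF derivs(3)[OF x] derivs(1)[OF x], of 0 v] tangent by simp
  show "fderiv n x v \<bullet> q x = - (n x \<bullet> fderiv q x v)"
    using c[OF derivs(4)[OF x] derivs(2)[OF x], of 0 v] tangent by simp
  have "(m x, n x) \<bullet> (fderiv m x v, fderiv n x v) + (fderiv m x v, fderiv n x v) \<bullet> (m x, n x) = 0"
    by (rule c[OF has_derivative_Pair[OF derivs(3)[OF x] derivs(4)[OF x]]
          has_derivative_Pair[OF derivs(3)[OF x] derivs(4)[OF x]], of 1])
      (use unit_normal in \<open>simp add: power2_norm_eq_inner\<close>)
  then show "fderiv m x v \<bullet> m x + fderiv n x v \<bullet> n x = 0" by (simp add: inner_commute)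
qed

definition "u1 x = cross3 (p x) (sgn (m x))"
definition "u2 x = cross3 (q x) (sgn (n x))"
text \<open>\<open>X1, X2, X3\<close> is the coframe dual to \<open>(u1, 0), (0, u2), (|n| m/|m|, - |m| n/|n|)\<close>; \<open>Y1, Y2, Y3\<close> are the
  components of the derivative of the normal in that frame.\<close>

definition "X1 x = covector (\<lambda>v. fderiv p x v \<bullet> u1 x)"
definition "X2 x = covector (\<lambda>v. fderiv q x v \<bullet> u2 x)"
definition "X3 x = covector (\<lambda>v. norm (n x) * (fderiv p x v \<bullet> sgn (m x)) - norm (m x) * (fderiv q x v \<bullet> sgn (n x)))"
definition "Y1 x = covector (\<lambda>v. fderiv m x v \<bullet> u1 x)"
definition "Y2 x = covector (\<lambda>v. fderiv n x v \<bullet> u2 x)"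
definition "Y3 x = covector (\<lambda>v. norm (n x) * (fderiv m x v \<bullet> sgn (m x)) - norm (m x) * (fderiv n x v \<bullet> sgn (n x)))"

lemma covectors:
  assumes x: "x \<in> U"
  shows "X1 x \<bullet> v = fderiv p x v \<bullet> u1 x" "X2 x \<bullet> v = fderiv q x v \<bullet> u2 x"
    "X3 x \<bullet> v = norm (n x) * (fderiv p x v \<bullet> sgn (m x)) - norm (m x) * (fderiv q x v \<bullet> sgn (n x))"
    "Y1 x \<bullet> v = fderiv m x v \<bullet> u1 x" "Y2 x \<bullet> v = fderiv n x v \<bullet> u2 x"
    "Y3 x \<bullet> v = norm (n x) * (fderiv m x v \<bullet> sgn (m x)) - norm (m x) * (fderiv n x v \<bullet> sgn (n x))"
proof -
  have l: "linear (\<lambda>v. L v \<bullet> w)" if "linear L" for L :: "real^3 \<Rightarrow> real^3" and w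
    using that by (intro linearI) (simp_all add: linear_add linear_scale inner_add_left)
  have l2: "linear (\<lambda>v. c * (L v \<bullet> w) - d * (L' v \<bullet> w'))" if "linear L" "linear L'"
    for L L' :: "real^3 \<Rightarrow> real^3" and w w' c d
    using that by (intro linearI) (simp_all add: linear_add linear_scale inner_add_left algebra_simps)
  note lx = lins(1)[OF x] lins(2)[OF x] lins(3)[OF x] lins(4)[OF x]
  show "X1 x \<bullet> v = fderiv p x v \<bullet> u1 x" "X2 x \<bullet> v = fderiv q x v \<bullet> u2 x"
    "X3 x \<bullet> v = norm (n x) * (fderiv p x v \<bullet> sgn (m x)) - norm (m x) * (fderiv q x v \<bullet> sgn (n x))"
    "Y1 x \<bullet> v = fderiv m x v \<bullet> u1 x" "Y2 x \<bullet> v = fderiv n x v \<bullet> u2 x"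
    "Y3 x \<bullet> v = norm (n x) * (fderiv m x v \<bullet> sgn (m x)) - norm (m x) * (fderiv n x v \<bullet> sgn (n x))"
    unfolding X1_def X2_def X3_def Y1_def Y2_def Y3_def
    by (rule covector_inner l l2 lx)+
qed

text \<open>The pairs of components along \<open>m\<close> and \<open>n\<close>, for the immersion
  and for the normal alike, are orthogonal to \<open>(norm (m x), norm (n x))\<close>. They are
  therefore multiples of the unit vector \<open>(norm (n x), - norm (m x))\<close>, and
  \<open>X3\<close> and \<open>Y3\<close> are the multipliers.\<close>

lemma normal_components:
  assumes x: "x \<in> U" and nz: "m x \<noteq> 0" "n x \<noteq> 0"
  shows "fderiv p x v \<bullet> sgn (m x) = norm (n x) * (X3 x \<bullet> v)"
    "fderiv q x v \<bullet> sgn (n x) = - norm (m x) * (X3 x \<bullet> v)"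
    "fderiv m x v \<bullet> sgn (m x) = norm (n x) * (Y3 x \<bullet> v)"
    "fderiv n x v \<bullet> sgn (n x) = - norm (m x) * (Y3 x \<bullet> v)"
proof -
  define a b where "a = norm (m x)" and "b = norm (n x)"
  have ab: "a * a + b * b = 1" using unit_normal[OF x] by (simp add: a_def b_def power2_eq_square)
  have mn: "w \<bullet> m x = a * (w \<bullet> sgn (m x))" "w \<bullet> n x = b * (w \<bullet> sgn (n x))" for w
    using nz by (simp_all add: a_def b_def sgn_div_norm)
  have *: "\<alpha> = b * (b * \<alpha> - a * \<beta>)" "\<beta> = - a * (b * \<alpha> - a * \<beta>)" if "a * \<alpha> + b * \<beta> = 0" for \<alpha> \<beta> :: real
  proof -
    have "b * (b * \<alpha> - a * \<beta>) = (a * a + b * b) * \<alpha> - a * (a * \<alpha> + b * \<beta>)"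
      "- a * (b * \<alpha> - a * \<beta>) = (a * a + b * b) * \<beta> - b * (a * \<alpha> + b * \<beta>)" by (simp_all add: algebra_simps)
    with that ab show "\<alpha> = b * (b * \<alpha> - a * \<beta>)" "\<beta> = - a * (b * \<alpha> - a * \<beta>)" by simp_all
  qed
  have 1: "a * (fderiv p x v \<bullet> sgn (m x)) + b * (fderiv q x v \<bullet> sgn (n x)) = 0"
    using normal[OF x, of v] by (simp add: mn)
  have 2: "a * (fderiv m x v \<bullet> sgn (m x)) + b * (fderiv n x v \<bullet> sgn (n x)) = 0"
    using first_order(5)[OF x, of v] by (simp add: mn)
  show "fderiv p x v \<bullet> sgn (m x) = norm (n x) * (X3 x \<bullet> v)"
    "fderiv q x v \<bullet> sgn (n x) = - norm (m x) * (X3 x \<bullet> v)"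
    "fderiv m x v \<bullet> sgn (m x) = norm (n x) * (Y3 x \<bullet> v)"
    "fderiv n x v \<bullet> sgn (n x) = - norm (m x) * (Y3 x \<bullet> v)"
    unfolding covectors[OF x] a_def[symmetric] b_def[symmetric]
    by (rule *[OF 1] *[OF 2])+
qed

abbreviation "parallel t \<equiv> \<lambda>y. (great_circle (p y) (m y) t, great_circle (q y) (n y) t)"
abbreviation "parallel_normal t \<equiv> \<lambda>y. (great_circle' (p y) (m y) t, great_circle' (q y) (n y) t)"

text \<open>The rows \<open>R1, R2, R3\<close> are the components of the Jacobi fields along the normal geodesic in its parallel frame,
  and the shape operator at time \<open>t\<close> is \<open>- R\<inverse> R'\<close>.\<close>

definition "R1 x t = cos (norm (m x) * t) *\<^sub>R X1 x + (sin (norm (m x) * t) / norm (m x)) *\<^sub>R Y1 x"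
definition "R2 x t = cos (norm (n x) * t) *\<^sub>R X2 x + (sin (norm (n x) * t) / norm (n x)) *\<^sub>R Y2 x"
definition "R3 x t = X3 x + t *\<^sub>R Y3 x"
definition "R1' x t = cos (norm (m x) * t) *\<^sub>R Y1 x - (norm (m x) * sin (norm (m x) * t)) *\<^sub>R X1 x"
definition "R2' x t = cos (norm (n x) * t) *\<^sub>R Y2 x - (norm (n x) * sin (norm (n x) * t)) *\<^sub>R X2 x"

text \<open>Each factor moves along its own great circle, so the variation formula applies twice.
  \<open>E1\<close> and \<open>E2\<close> are the unit directions of the two great circles at time
  \<open>t\<close>; the components along them reduce to the single row \<open>R3\<close> because
  they stay proportional to \<open>norm (n x)\<close> and \<open>- norm (m x)\<close>.\<close>

lemma parallel_variation:
  assumes x: "x \<in> U" and nz: "m x \<noteq> 0" "n x \<noteq> 0"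
  obtains E1 E2 D where "norm E1 = 1" "norm E2 = 1"
    "E1 \<bullet> u1 x = 0" "E2 \<bullet> u2 x = 0" "norm (u1 x) = 1" "norm (u2 x) = 1"
    "parallel_normal t x = (norm (m x) *\<^sub>R E1, norm (n x) *\<^sub>R E2)"
    "parallel t x \<in> S2S2" "parallel_normal t x \<in> tangent_S2S2 (parallel t x)"
    "norm (parallel_normal t x) = 1"
    "\<And>v. fderiv (parallel t) x v \<in> tangent_S2S2 (parallel t x)"
    "\<And>v. fderiv (parallel t) x v \<bullet> parallel_normal t x = 0"
    "\<And>v. fderiv (parallel t) x v = ((norm (n x) * (R3 x t \<bullet> v)) *\<^sub>R E1 + (R1 x t \<bullet> v) *\<^sub>R u1 x,
      (- norm (m x) * (R3 x t \<bullet> v)) *\<^sub>R E2 + (R2 x t \<bullet> v) *\<^sub>R u2 x)"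
    "(parallel t has_derivative fderiv (parallel t) x) (at x)"
    "(parallel_normal t has_derivative D) (at x)"
    "\<And>v. tangent_proj (parallel t x) (D v) = ((norm (n x) * (Y3 x \<bullet> v)) *\<^sub>R E1 + (R1' x t \<bullet> v) *\<^sub>R u1 x,
      (- norm (m x) * (Y3 x \<bullet> v)) *\<^sub>R E2 + (R2' x t \<bullet> v) *\<^sub>R u2 x)"
proof -
  define E1 where "E1 = cos (norm (m x) * t) *\<^sub>R sgn (m x) - sin (norm (m x) * t) *\<^sub>R p x"
  define E2 where "E2 = cos (norm (n x) * t) *\<^sub>R sgn (n x) - sin (norm (n x) * t) *\<^sub>R q x"
  note v1 = great_circle_variation(1,2,4-9)[where t=t, OF derivs(1)[OF x] derivs(3)[OF x] unit(1)[OF x] tangent(1)[OF x] nz(1)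
      first_order(1)[OF x] first_order(3)[OF x], folded E1_def u1_def]
  note v2 = great_circle_variation(1,2,4-9)[where t=t, OF derivs(2)[OF x] derivs(4)[OF x] unit(2)[OF x] tangent(2)[OF x] nz(2)
      first_order(2)[OF x] first_order(4)[OF x], folded E2_def u2_def]
  have P: "(parallel t has_derivative (\<lambda>v. ((norm (n x) * (R3 x t \<bullet> v)) *\<^sub>R E1 + (R1 x t \<bullet> v) *\<^sub>R u1 x,
      (- norm (m x) * (R3 x t \<bullet> v)) *\<^sub>R E2 + (R2 x t \<bullet> v) *\<^sub>R u2 x))) (at x)"
    using has_derivative_Pair[OF v1(7) v2(7)]
    unfolding R1_def R2_def R3_def inner_add_left inner_scaleR_left covectors(1,2,4,5)[OF x] normal_components[OF x nz]
    by (simp add: algebra_simps)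
  note vu = great_circle_variation(3)[OF derivs(1)[OF x] derivs(3)[OF x] unit(1)[OF x] tangent(1)[OF x] nz(1)
      first_order(1)[OF x] first_order(3)[OF x], folded u1_def]
    great_circle_variation(3)[OF derivs(2)[OF x] derivs(4)[OF x] unit(2)[OF x] tangent(2)[OF x] nz(2)
      first_order(2)[OF x] first_order(4)[OF x], folded u2_def]
  obtain D1 where D1: "((\<lambda>y. great_circle' (p y) (m y) t) has_derivative D1) (at x)"
    "\<And>v. D1 v - (D1 v \<bullet> great_circle (p x) (m x) t) *\<^sub>R great_circle (p x) (m x) t =
      (fderiv m x v \<bullet> sgn (m x)) *\<^sub>R E1 + (cos (norm (m x) * t) * (fderiv m x v \<bullet> u1 x)
        - norm (m x) * sin (norm (m x) * t) * (fderiv p x v \<bullet> u1 x)) *\<^sub>R u1 x"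
    using v1(8) by blast
  obtain D2 where D2: "((\<lambda>y. great_circle' (q y) (n y) t) has_derivative D2) (at x)"
    "\<And>v. D2 v - (D2 v \<bullet> great_circle (q x) (n x) t) *\<^sub>R great_circle (q x) (n x) t =
      (fderiv n x v \<bullet> sgn (n x)) *\<^sub>R E2 + (cos (norm (n x) * t) * (fderiv n x v \<bullet> u2 x)
        - norm (n x) * sin (norm (n x) * t) * (fderiv q x v \<bullet> u2 x)) *\<^sub>R u2 x"
    using v2(8) by blast
  have ic: "great_circle (p x) (m x) t \<bullet> E1 = 0" "E1 \<bullet> u1 x = 0" "great_circle (p x) (m x) t \<bullet> u1 x = 0"
    "great_circle (q x) (n x) t \<bullet> E2 = 0" "E2 \<bullet> u2 x = 0" "great_circle (q x) (n x) t \<bullet> u2 x = 0"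
    "E1 \<bullet> great_circle (p x) (m x) t = 0" "u1 x \<bullet> E1 = 0" "u1 x \<bullet> great_circle (p x) (m x) t = 0"
    "E2 \<bullet> great_circle (q x) (n x) t = 0" "u2 x \<bullet> E2 = 0" "u2 x \<bullet> great_circle (q x) (n x) t = 0"
    using v1(3,4,5) v2(3,4,5) by (simp_all add: inner_commute)
  have nn: "E1 \<bullet> E1 = 1" "E2 \<bullet> E2 = 1" using v1(2) v2(2) by (simp_all add: norm_eq_1)
  note fd = frechet_derivative_eqI[OF P]
  show ?thesis
  proof (rule that[of E1 E2])
    show "norm E1 = 1" "norm E2 = 1" "E1 \<bullet> u1 x = 0" "E2 \<bullet> u2 x = 0" "norm (u1 x) = 1" "norm (u2 x) = 1"
      using v1(2,4) v2(2,4) vu by simp_all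
    show N: "parallel_normal t x = (norm (m x) *\<^sub>R E1, norm (n x) *\<^sub>R E2)" using v1(6) v2(6) by simp
    show "parallel t x \<in> S2S2" using v1(1) v2(1) by (simp add: S2S2_def)
    show "parallel_normal t x \<in> tangent_S2S2 (parallel t x)"
      unfolding N tangent_S2S2_def by (simp add: ic)
    have "parallel_normal t x \<bullet> parallel_normal t x = (norm (m x))\<^sup>2 + (norm (n x))\<^sup>2"
      unfolding N by (simp add: nn power2_eq_square)
    then show "norm (parallel_normal t x) = 1" using unit_normal[OF x] by (simp add: norm_eq_1)
    show "fderiv (parallel t) x v \<in> tangent_S2S2 (parallel t x)" for v
      unfolding fd tangent_S2S2_def by (simp add: ic inner_add_left inner_diff_left)
    show "fderiv (parallel t) x v \<bullet> parallel_normal t x = 0" for v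
      unfolding fd N by (simp add: ic inner_add_left inner_diff_left nn)
    show "(parallel t has_derivative fderiv (parallel t) x) (at x)" using P fd by simp
    show "fderiv (parallel t) x v = ((norm (n x) * (R3 x t \<bullet> v)) *\<^sub>R E1 + (R1 x t \<bullet> v) *\<^sub>R u1 x,
      (- norm (m x) * (R3 x t \<bullet> v)) *\<^sub>R E2 + (R2 x t \<bullet> v) *\<^sub>R u2 x)" for v by (simp add: fd)
    show "(parallel_normal t has_derivative (\<lambda>v. (D1 v, D2 v))) (at x)"
      by (rule has_derivative_Pair[OF D1(1) D2(1)])
    show "tangent_proj (parallel t x) (D1 v, D2 v) = ((norm (n x) * (Y3 x \<bullet> v)) *\<^sub>R E1 + (R1' x t \<bullet> v) *\<^sub>R u1 x,
      (- norm (m x) * (Y3 x \<bullet> v)) *\<^sub>R E2 + (R2' x t \<bullet> v) *\<^sub>R u2 x)" for v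
      unfolding tangent_proj_def fst_conv snd_conv D1(2) D2(2) normal_components[OF x nz]
        R1'_def R2'_def inner_diff_left inner_scaleR_left covectors(1,2,4,5)[OF x] by simp
  qed
qed

definition "vol x t = triple (R1 x t) (R2 x t) (R3 x t)"

text \<open>Expanding the triple product in its three rows, each a sum of two terms, gives the eight
  coefficients.\<close>

lemma vol_trig_mix: "\<exists>k. vol x = trig_mix (norm (m x)) (norm (n x)) k"
proof -
  let ?a = "norm (m x)" and ?b = "norm (n x)"
  let ?k = "\<lambda>i::nat. [triple (X1 x) (X2 x) (X3 x), triple (X1 x) (X2 x) (Y3 x),
    triple (Y1 x) (X2 x) (X3 x) / ?a, triple (Y1 x) (X2 x) (Y3 x) / ?a,
    triple (X1 x) (Y2 x) (X3 x) / ?b, triple (X1 x) (Y2 x) (Y3 x) / ?b,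
    triple (Y1 x) (Y2 x) (X3 x) / (?a * ?b), triple (Y1 x) (Y2 x) (Y3 x) / (?a * ?b)] ! i"
  have "vol x t = trig_mix ?a ?b ?k t" for t
    unfolding vol_def R1_def R2_def R3_def triple_def trig_mix_def
    by (simp add: cross_add_left cross_add_right cross_mult_left cross_mult_right inner_add_left inner_add_right
        eval_nat_numeral algebra_simps)
  then show ?thesis by blast
qed

text \<open>This is Jacobi's formula for the derivative of a determinant, since the trace is that of
  the shape operator formed from the rows and their time derivatives. The sign \<sigma> compares the
  given normal field \<open>g\<close> with the velocity of the geodesics.\<close>

lemma shape_trace_parallel:
  assumes x: "x \<in> U" and nz: "m x \<noteq> 0" "n x \<noteq> 0"
    and inj: "inj (fderiv (parallel t) x)"
    and V: "open V" "x \<in> V" and g: "\<And>y. y \<in> V \<Longrightarrow> g y = \<sigma> *\<^sub>R parallel_normal t y"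
    and \<sigma>: "\<sigma>\<^sup>2 = 1"
  shows "(vol x has_real_derivative - \<sigma> * shape_trace (parallel t) g x * vol x t) (at t)"
    and "vol x t \<noteq> 0"
proof -
  let ?a = "norm (m x)" and ?b = "norm (n x)"
  have ab: "?a > 0" "?b > 0" using nz by auto
  obtain E1 E2 D where E: "norm E1 = 1" "norm E2 = 1"
    "E1 \<bullet> u1 x = 0" "E2 \<bullet> u2 x = 0" "norm (u1 x) = 1" "norm (u2 x) = 1"
    and P: "\<And>v. fderiv (parallel t) x v = ((?b * (R3 x t \<bullet> v)) *\<^sub>R E1 + (R1 x t \<bullet> v) *\<^sub>R u1 x,
      (- ?a * (R3 x t \<bullet> v)) *\<^sub>R E2 + (R2 x t \<bullet> v) *\<^sub>R u2 x)"
    and D: "(parallel_normal t has_derivative D) (at x)"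
    "\<And>v. tangent_proj (parallel t x) (D v) = ((?b * (Y3 x \<bullet> v)) *\<^sub>R E1 + (R1' x t \<bullet> v) *\<^sub>R u1 x,
      (- ?a * (Y3 x \<bullet> v)) *\<^sub>R E2 + (R2' x t \<bullet> v) *\<^sub>R u2 x)"
    by (rule parallel_variation[OF x nz, of t], rule that)
  show nzv: "vol x t \<noteq> 0"
  proof
    assume "vol x t = 0"
    then obtain w where w: "w \<noteq> 0" "R1 x t \<bullet> w = 0" "R2 x t \<bullet> w = 0" "R3 x t \<bullet> w = 0"
      unfolding vol_def using triple_zero_common_normal by blast
    then have "fderiv (parallel t) x w = fderiv (parallel t) x 0" by (simp add: P)
    then have "w = 0" by (rule injD[OF inj])
    with w(1) show False by simp
  qed
  have "(g has_derivative (\<lambda>v. \<sigma> *\<^sub>R D v)) (at x)"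
    by (rule has_derivative_transform_within_open[OF has_derivative_scaleR_right[OF D(1)] V]) (use g in simp)
  then have gd: "fderiv g x v = \<sigma> *\<^sub>R D v" for v by (simp add: frechet_derivative_eqI)
  have ts: "tangent_proj z (c *\<^sub>R w) = c *\<^sub>R tangent_proj z w" for z w c
    by (simp add: tangent_proj_def scaleR_diff_right)
  \<comment> \<open>Weingarten's equation in the frame at time \<open>t\<close>. The third frame
    vector has a part in each factor, so its equation occurs twice, scaled by
    \<open>norm (n x)\<close> and by \<open>- norm (m x)\<close>, both nonzero.\<close>
  have iff: "fderiv (parallel t) x w = - tangent_proj (parallel t x) (fderiv g x v) \<longleftrightarrow>
     R1 x t \<bullet> w = - ((\<sigma> *\<^sub>R R1' x t) \<bullet> v) \<and> R2 x t \<bullet> w = - ((\<sigma> *\<^sub>R R2' x t) \<bullet> v)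
     \<and> R3 x t \<bullet> w = - ((\<sigma> *\<^sub>R Y3 x) \<bullet> v)" for v w
  proof -
    have "fderiv (parallel t) x w = - tangent_proj (parallel t x) (fderiv g x v) \<longleftrightarrow>
      (?b * (R3 x t \<bullet> w)) *\<^sub>R E1 + (R1 x t \<bullet> w) *\<^sub>R u1 x =
        - ((\<sigma> * (?b * (Y3 x \<bullet> v))) *\<^sub>R E1 + (\<sigma> * (R1' x t \<bullet> v)) *\<^sub>R u1 x) \<and>
      (- ?a * (R3 x t \<bullet> w)) *\<^sub>R E2 + (R2 x t \<bullet> w) *\<^sub>R u2 x =
        - ((\<sigma> * (- ?a * (Y3 x \<bullet> v))) *\<^sub>R E2 + (\<sigma> * (R2' x t \<bullet> v)) *\<^sub>R u2 x)"
      unfolding gd ts D(2) P by (simp add: scaleR_add_right scaleR_diff_right)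
    also have "\<dots> \<longleftrightarrow> (?b * (R3 x t \<bullet> w) = - (\<sigma> * (?b * (Y3 x \<bullet> v))) \<and> R1 x t \<bullet> w = - (\<sigma> * (R1' x t \<bullet> v))) \<and>
      (- ?a * (R3 x t \<bullet> w) = - (\<sigma> * (- ?a * (Y3 x \<bullet> v))) \<and> R2 x t \<bullet> w = - (\<sigma> * (R2' x t \<bullet> v)))"
      unfolding orthonormal_combination_eq[OF E(1,5,3)] orthonormal_combination_eq[OF E(2,6,4)] ..
    also have "?b * (R3 x t \<bullet> w) = - (\<sigma> * (?b * (Y3 x \<bullet> v))) \<longleftrightarrow> R3 x t \<bullet> w = - (\<sigma> * (Y3 x \<bullet> v))"
      using ab(2) mult_cancel_left[of ?b "R3 x t \<bullet> w" "- (\<sigma> * (Y3 x \<bullet> v))"] by (simp add: mult.left_commute)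
    also have "- ?a * (R3 x t \<bullet> w) = - (\<sigma> * (- ?a * (Y3 x \<bullet> v))) \<longleftrightarrow> R3 x t \<bullet> w = - (\<sigma> * (Y3 x \<bullet> v))"
      using ab(1) mult_cancel_left[of "- ?a" "R3 x t \<bullet> w" "- (\<sigma> * (Y3 x \<bullet> v))"] by (simp add: mult.left_commute)
    finally show ?thesis by auto
  qed
  let ?T = "triple (R1' x t) (R2 x t) (R3 x t) + triple (R1 x t) (R2' x t) (R3 x t) + triple (R1 x t) (R2 x t) (Y3 x)"
  have "shape_trace (parallel t) g x * vol x t =
     - (triple (\<sigma> *\<^sub>R R1' x t) (R2 x t) (R3 x t) + triple (R1 x t) (\<sigma> *\<^sub>R R2' x t) (R3 x t)
        + triple (R1 x t) (R2 x t) (\<sigma> *\<^sub>R Y3 x))"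
    unfolding shape_trace_def vol_def by (rule trace_implicit_operator[OF iff nzv[unfolded vol_def]])
  also have "\<dots> = - \<sigma> * ?T" by (simp add: triple_def cross_mult_left cross_mult_right algebra_simps)
  finally have tr: "shape_trace (parallel t) g x * vol x t = - \<sigma> * ?T" .
  have d1: "(R1 x has_vector_derivative R1' x t) (at t)"
    unfolding R1_def R1'_def
    by (auto intro!: derivative_eq_intros simp: has_vector_derivative_def algebra_simps nz)
  have d2: "(R2 x has_vector_derivative R2' x t) (at t)"
    unfolding R2_def R2'_def
    by (auto intro!: derivative_eq_intros simp: has_vector_derivative_def algebra_simps nz)
  have d3: "(R3 x has_vector_derivative Y3 x) (at t)"
    unfolding R3_def by (auto intro!: derivative_eq_intros simp: has_vector_derivative_def)
  have bc: "bounded_bilinear (cross3 :: real^3 \<Rightarrow> _)"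
    using bilinear_conv_bounded_bilinear bilinear_cross by blast
  have "((\<lambda>t. cross3 (R2 x t) (R3 x t)) has_vector_derivative (cross3 (R2 x t) (Y3 x) + cross3 (R2' x t) (R3 x t))) (at t)"
    by (rule bounded_bilinear.has_vector_derivative[OF bc d2 d3])
  from inner_has_derivative[OF d1 this] have "(vol x has_real_derivative ?T) (at t)"
    unfolding vol_def triple_def by (simp add: inner_add_right algebra_simps)
  moreover have "- \<sigma> * shape_trace (parallel t) g x * vol x t = \<sigma>\<^sup>2 * ?T"
    unfolding mult.assoc[of "- \<sigma>"] tr by (simp add: power2_eq_square mult.assoc)
  ultimately show "(vol x has_real_derivative - \<sigma> * shape_trace (parallel t) g x * vol x t) (at t)" using \<sigma> by simp
qed

end

section \<open>Hypersurfaces of constant angle\<close>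

lemma differentiable_inner:
  fixes f g :: "'a::real_normed_vector \<Rightarrow> 'b::real_inner"
  assumes "f differentiable (at x)" "g differentiable (at x)"
  shows "(\<lambda>y. f y \<bullet> g y) differentiable (at x)"
  using assms has_derivative_inner unfolding differentiable_def by blast

lemma bounded_bilinear_cross3: "bounded_bilinear cross3"
  using bilinear_conv_bounded_bilinear bilinear_cross by blast

lemma differentiable_cross3:
  fixes f g :: "'a::real_normed_vector \<Rightarrow> real^3"
  assumes "f differentiable (at x)" "g differentiable (at x)"
  shows "(\<lambda>y. cross3 (f y) (g y)) differentiable (at x)"
  using assms bounded_bilinear.FDERIV[OF bounded_bilinear_cross3] unfolding differentiable_def by blast

lemma differentiable_cong_open:
  assumes "f differentiable (at x)" "open S" "x \<in> S" "\<And>y. y \<in> S \<Longrightarrow> f y = g y"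
  shows "g differentiable (at x)"
  using assms has_derivative_transform_within_open unfolding differentiable_def by metis

text \<open>The directional derivatives enter as closed expressions \<open>F\<close> and
  \<open>G\<close> valid on all of \<open>S\<close>, which is the form that the frame equations
  provide.\<close>

lemma bracket_of_fields:
  fixes f :: "'a::euclidean_space \<Rightarrow> 'b::euclidean_space"
  assumes f: "smooth_on S f" and x: "x \<in> S"
    and V: "(V has_derivative V') (at x)" and W: "(W has_derivative W') (at x)"
    and F: "\<And>y. y \<in> S \<Longrightarrow> fderiv f y (V y) = F y" "(F has_derivative F') (at x)"
    and G: "\<And>y. y \<in> S \<Longrightarrow> fderiv f y (W y) = G y" "(G has_derivative G') (at x)"
  shows "fderiv f x (W' (V x) - V' (W x)) = G' (V x) - F' (W x)"
proof -
  have S: "open S" using f by (simp add: smooth_on_def)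
  show ?thesis
    by (rule Lie_bracket_derivative[OF f x V W])
      (rule has_derivative_transform_within_open[OF F(2) S x] has_derivative_transform_within_open[OF G(2) S x];
        simp add: F(1) G(1))+
qed

locale constant_angle = local_hypersurface +
  fixes a b :: real
  assumes pos: "a > 0" "b > 0"
    and norm_m: "\<And>x. x \<in> U \<Longrightarrow> norm (m x) = a" and norm_n: "\<And>x. x \<in> U \<Longrightarrow> norm (n x) = b"
begin

text \<open>On \<open>U\<close> this is \<open>sgn (m x)\<close>, but division by a constant makes
  smoothness immediate; likewise for \<open>n2\<close>.\<close>

definition "n1 x = m x /\<^sub>R a"
definition "n2 x = n x /\<^sub>R b"

lemma sgn_mn: "x \<in> U \<Longrightarrow> sgn (m x) = n1 x" "x \<in> U \<Longrightarrow> sgn (n x) = n2 x"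
  by (simp_all add: sgn_div_norm n1_def n2_def norm_m norm_n)

lemma nonzero_mn: "x \<in> U \<Longrightarrow> m x \<noteq> 0" "x \<in> U \<Longrightarrow> n x \<noteq> 0"
  using norm_m[of x] norm_n[of x] pos by auto

lemma u_eq: "x \<in> U \<Longrightarrow> u1 x = cross3 (p x) (n1 x)" "x \<in> U \<Longrightarrow> u2 x = cross3 (q x) (n2 x)"
  by (simp_all add: u1_def u2_def sgn_mn)

lemma smooth_n: "smooth_on U n1" "smooth_on U n2"
  unfolding n1_def n2_def by (intro smooth_on_linear_image[OF bounded_linear_scaleR_right] smooth)+

lemma unit_n:
  assumes "x \<in> U"
  shows "norm (n1 x) = 1" "norm (n2 x) = 1" "p x \<bullet> n1 x = 0" "q x \<bullet> n2 x = 0"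
  using pos norm_m[OF assms] norm_n[OF assms] tangent[OF assms]
  by (auto simp: n1_def n2_def inner_commute)

lemma frame1:
  assumes "x \<in> U"
  shows "norm (u1 x) = 1" "u1 x \<bullet> p x = 0" "u1 x \<bullet> n1 x = 0"
    and "w = (w \<bullet> p x) *\<^sub>R p x + (w \<bullet> n1 x) *\<^sub>R n1 x + (w \<bullet> u1 x) *\<^sub>R u1 x"
  using cross3_frame[OF unit(1)[OF assms] unit_n(1)[OF assms] unit_n(3)[OF assms]] by (simp_all add: u_eq assms)

lemma frame2:
  assumes "x \<in> U"
  shows "norm (u2 x) = 1" "u2 x \<bullet> q x = 0" "u2 x \<bullet> n2 x = 0"
    and "w = (w \<bullet> q x) *\<^sub>R q x + (w \<bullet> n2 x) *\<^sub>R n2 x + (w \<bullet> u2 x) *\<^sub>R u2 x"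
  using cross3_frame[OF unit(2)[OF assms] unit_n(2)[OF assms] unit_n(4)[OF assms]] by (simp_all add: u_eq assms)

lemma orthonormal:
  assumes "x \<in> U"
  shows "p x \<bullet> p x = 1" "n1 x \<bullet> n1 x = 1" "u1 x \<bullet> u1 x = 1"
    "p x \<bullet> n1 x = 0" "n1 x \<bullet> p x = 0" "p x \<bullet> u1 x = 0" "u1 x \<bullet> p x = 0" "n1 x \<bullet> u1 x = 0" "u1 x \<bullet> n1 x = 0"
    "q x \<bullet> q x = 1" "n2 x \<bullet> n2 x = 1" "u2 x \<bullet> u2 x = 1"
    "q x \<bullet> n2 x = 0" "n2 x \<bullet> q x = 0" "q x \<bullet> u2 x = 0" "u2 x \<bullet> q x = 0" "n2 x \<bullet> u2 x = 0" "u2 x \<bullet> n2 x = 0"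
  using unit[OF assms] unit_n[OF assms] frame1[OF assms] frame2[OF assms] by (simp_all add: norm_eq_1 inner_commute)

text \<open>Connection forms of the moving frames: multiplied by the constants \<open>a\<close> and
  \<open>b\<close>, \<open>S\<close> and \<open>T\<close> are the rows \<open>Y1\<close> and
  \<open>Y2\<close>, so they carry the shape operator.\<close>

definition "S x v = fderiv n1 x v \<bullet> u1 x"
definition "T x v = fderiv n2 x v \<bullet> u2 x"

lemma linear_ST: assumes "x \<in> U" shows "linear (S x)" "linear (T x)"
  unfolding S_def T_def using smooth_on_linear[OF smooth_n(1) assms] smooth_on_linear[OF smooth_n(2) assms]
  by (auto intro!: linearI simp: linear_add linear_scale inner_add_left)

lemma differentiable_u: assumes "x \<in> U" shows "u1 differentiable (at x)" "u2 differentiable (at x)"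
proof -
  have d: "p differentiable (at x)" "q differentiable (at x)" "n1 differentiable (at x)" "n2 differentiable (at x)"
    using smooth_on_has_derivative[OF _ assms] smooth smooth_n unfolding differentiable_def by blast+
  show "u1 differentiable (at x)"
    by (rule differentiable_cong_open[OF differentiable_cross3[OF d(1,3)] U assms]) (simp add: u_eq)
  show "u2 differentiable (at x)"
    by (rule differentiable_cong_open[OF differentiable_cross3[OF d(2,4)] U assms]) (simp add: u_eq)
qed

lemma fderiv_pq:
  assumes x: "x \<in> U"
  shows "fderiv p x v = (b * (X3 x \<bullet> v)) *\<^sub>R n1 x + (X1 x \<bullet> v) *\<^sub>R u1 x"
    "fderiv q x v = (- a * (X3 x \<bullet> v)) *\<^sub>R n2 x + (X2 x \<bullet> v) *\<^sub>R u2 x"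
proof -
  note nc = normal_components(1,2)[OF x nonzero_mn[OF x], unfolded sgn_mn[OF x] norm_m[OF x] norm_n[OF x]]
  show "fderiv p x v = (b * (X3 x \<bullet> v)) *\<^sub>R n1 x + (X1 x \<bullet> v) *\<^sub>R u1 x"
    using frame1(4)[OF x, of "fderiv p x v"] by (simp add: first_order[OF x] nc covectors[OF x])
  show "fderiv q x v = (- a * (X3 x \<bullet> v)) *\<^sub>R n2 x + (X2 x \<bullet> v) *\<^sub>R u2 x"
    using frame2(4)[OF x, of "fderiv q x v"] by (simp add: first_order[OF x] nc covectors[OF x])
qed

text \<open>Differentiating the orthonormality relations leaves only the component along
  \<open>u1\<close> or \<open>u2\<close> free; the component along \<open>p\<close> or
  \<open>q\<close> is minus the corresponding one in \<open>fderiv_pq\<close>.\<close>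

lemma fderiv_n:
  assumes x: "x \<in> U"
  shows "fderiv n1 x v = (- b * (X3 x \<bullet> v)) *\<^sub>R p x + S x v *\<^sub>R u1 x"
    "fderiv n2 x v = (a * (X3 x \<bullet> v)) *\<^sub>R q x + T x v *\<^sub>R u2 x"
proof -
  note c = has_derivative_inner_const[OF U x]
  note d = smooth_on_has_derivative[OF smooth_n(1) x] smooth_on_has_derivative[OF smooth_n(2) x]
  have 1: "n1 x \<bullet> fderiv n1 x v + fderiv n1 x v \<bullet> n1 x = 0" "n2 x \<bullet> fderiv n2 x v + fderiv n2 x v \<bullet> n2 x = 0"
    by (rule c[OF d(1) d(1)] c[OF d(2) d(2)], erule orthonormal)+
  have 2: "p x \<bullet> fderiv n1 x v + fderiv p x v \<bullet> n1 x = 0" "q x \<bullet> fderiv n2 x v + fderiv q x v \<bullet> n2 x = 0"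
    by (rule c[OF derivs(1)[OF x] d(1)] c[OF derivs(2)[OF x] d(2)], erule orthonormal)+
  have 3: "fderiv n1 x v \<bullet> n1 x = 0" "fderiv n2 x v \<bullet> n2 x = 0"
    "fderiv n1 x v \<bullet> p x = - b * (X3 x \<bullet> v)" "fderiv n2 x v \<bullet> q x = a * (X3 x \<bullet> v)"
    using 1 2 by (simp_all add: inner_commute fderiv_pq[OF x] inner_add_left inner_add_right inner_diff_right orthonormal[OF x])
  show "fderiv n1 x v = (- b * (X3 x \<bullet> v)) *\<^sub>R p x + S x v *\<^sub>R u1 x"
    using frame1(4)[OF x, of "fderiv n1 x v"] unfolding 3 by (simp add: S_def)
  show "fderiv n2 x v = (a * (X3 x \<bullet> v)) *\<^sub>R q x + T x v *\<^sub>R u2 x"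
    using frame2(4)[OF x, of "fderiv n2 x v"] unfolding 3 by (simp add: T_def)
qed

lemma deriv_u:
  assumes x: "x \<in> U"
  shows "(u1 has_derivative (\<lambda>v. - ((X1 x \<bullet> v) *\<^sub>R p x) - S x v *\<^sub>R n1 x)) (at x)"
    "(u2 has_derivative (\<lambda>v. - ((X2 x \<bullet> v) *\<^sub>R q x) - T x v *\<^sub>R n2 x)) (at x)"
proof -
  note c = has_derivative_inner_const[OF U x]
  note d = smooth_on_has_derivative[OF smooth_n(1) x] smooth_on_has_derivative[OF smooth_n(2) x]
  obtain G H where G: "(u1 has_derivative G) (at x)" and H: "(u2 has_derivative H) (at x)"
    using differentiable_u[OF x] unfolding differentiable_def by blast
  have 1: "u1 x \<bullet> G v + G v \<bullet> u1 x = 0" "u2 x \<bullet> H v + H v \<bullet> u2 x = 0" for v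
    by (rule c[OF G G] c[OF H H], erule orthonormal)+
  have 2: "p x \<bullet> G v + fderiv p x v \<bullet> u1 x = 0" "q x \<bullet> H v + fderiv q x v \<bullet> u2 x = 0" for v
    by (rule c[OF derivs(1)[OF x] G] c[OF derivs(2)[OF x] H], erule orthonormal)+
  have 3: "n1 x \<bullet> G v + fderiv n1 x v \<bullet> u1 x = 0" "n2 x \<bullet> H v + fderiv n2 x v \<bullet> u2 x = 0" for v
    by (rule c[OF d(1) G] c[OF d(2) H], erule orthonormal)+
  have 4: "G v \<bullet> u1 x = 0" "H v \<bullet> u2 x = 0" "G v \<bullet> p x = - (X1 x \<bullet> v)" "H v \<bullet> q x = - (X2 x \<bullet> v)"
    "G v \<bullet> n1 x = - S x v" "H v \<bullet> n2 x = - T x v" for v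
    using 1[of v] 2[of v] 3[of v] covectors(1,2)[OF x, of v]
    by (simp_all add: inner_commute S_def T_def)
  have "G = (\<lambda>v. - ((X1 x \<bullet> v) *\<^sub>R p x) - S x v *\<^sub>R n1 x)"
  proof
    show "G v = - ((X1 x \<bullet> v) *\<^sub>R p x) - S x v *\<^sub>R n1 x" for v
      using frame1(4)[OF x, of "G v"] unfolding 4 by simp
  qed
  with G show "(u1 has_derivative (\<lambda>v. - ((X1 x \<bullet> v) *\<^sub>R p x) - S x v *\<^sub>R n1 x)) (at x)" by simp
  have "H = (\<lambda>v. - ((X2 x \<bullet> v) *\<^sub>R q x) - T x v *\<^sub>R n2 x)"
  proof
    show "H v = - ((X2 x \<bullet> v) *\<^sub>R q x) - T x v *\<^sub>R n2 x" for v
      using frame2(4)[OF x, of "H v"] unfolding 4 by simp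
  qed
  with H show "(u2 has_derivative (\<lambda>v. - ((X2 x \<bullet> v) *\<^sub>R q x) - T x v *\<^sub>R n2 x)) (at x)" by simp
qed

definition "\<Delta> x = triple (X1 x) (X2 x) (X3 x)"

lemma Delta_nonzero:
  assumes x: "x \<in> U" shows "\<Delta> x \<noteq> 0"
proof
  assume "\<Delta> x = 0"
  then obtain w where w: "w \<noteq> 0" "X1 x \<bullet> w = 0" "X2 x \<bullet> w = 0" "X3 x \<bullet> w = 0"
    unfolding \<Delta>_def using triple_zero_common_normal by blast
  then have "fderiv p x w = 0" "fderiv q x w = 0" by (simp_all add: fderiv_pq[OF x])
  with immersion[OF x] w show False by blast
qed

text \<open>The frame fields in the chart: the immersion maps \<open>V1, V2, V3\<close> to
  \<open>(u1, 0)\<close>, \<open>(0, u2)\<close> and \<open>(b n1, - a n2)\<close>.\<close>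

definition "V1 x = cross3 (X2 x) (X3 x) /\<^sub>R \<Delta> x"
definition "V2 x = cross3 (X3 x) (X1 x) /\<^sub>R \<Delta> x"
definition "V3 x = cross3 (X1 x) (X2 x) /\<^sub>R \<Delta> x"

lemma dual:
  assumes "x \<in> U"
  shows "X1 x \<bullet> V1 x = 1" "X2 x \<bullet> V1 x = 0" "X3 x \<bullet> V1 x = 0"
    "X1 x \<bullet> V2 x = 0" "X2 x \<bullet> V2 x = 1" "X3 x \<bullet> V2 x = 0"
    "X1 x \<bullet> V3 x = 0" "X2 x \<bullet> V3 x = 0" "X3 x \<bullet> V3 x = 1"
  using triple_dual[OF Delta_nonzero[OF assms, unfolded \<Delta>_def]] unfolding V1_def V2_def V3_def \<Delta>_def .

lemma dual_expansion:
  assumes x: "x \<in> U"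
  shows "v = (X1 x \<bullet> v) *\<^sub>R V1 x + (X2 x \<bullet> v) *\<^sub>R V2 x + (X3 x \<bullet> v) *\<^sub>R V3 x"
  by (rule triple_separates[OF Delta_nonzero[OF x, unfolded \<Delta>_def]])
    (simp_all add: inner_add_right dual[OF x])

text \<open>Up to sign, the shape operator in this frame has the rows \<open>a\<close> times
  \<open>s1, s2, s3\<close>, \<open>b\<close> times \<open>r1, r2, r3\<close>, and 0.\<close>

definition "s1 x = S x (V1 x)"
definition "s2 x = S x (V2 x)"
definition "s3 x = S x (V3 x)"
definition "r1 x = T x (V1 x)"
definition "r2 x = T x (V2 x)"
definition "r3 x = T x (V3 x)"

lemma ST_expansion:
  assumes x: "x \<in> U"
  shows "S x v = (X1 x \<bullet> v) * s1 x + (X2 x \<bullet> v) * s2 x + (X3 x \<bullet> v) * s3 x"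
    "T x v = (X1 x \<bullet> v) * r1 x + (X2 x \<bullet> v) * r2 x + (X3 x \<bullet> v) * r3 x"
  unfolding s1_def s2_def s3_def r1_def r2_def r3_def
  by (subst dual_expansion[OF x, of v], simp add: linear_add[OF linear_ST(1)[OF x]] linear_scale[OF linear_ST(1)[OF x]]
      linear_add[OF linear_ST(2)[OF x]] linear_scale[OF linear_ST(2)[OF x]])+

lemma differentiable_X:
  assumes x: "x \<in> U"
  shows "X1 differentiable (at x)" "X2 differentiable (at x)" "X3 differentiable (at x)"
proof -
  have d: "(\<lambda>y. fderiv f y v) differentiable (at x)" "f differentiable (at x)" if "smooth_on U f" for f :: "real^3 \<Rightarrow> real^3" and v
    using smooth_on_has_derivative[OF smooth_on_fderiv[OF that] x] smooth_on_has_derivative[OF that x]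
    unfolding differentiable_def by blast+
  note d' = d[OF smooth(1)] d[OF smooth(2)] d[OF smooth_n(1)] d[OF smooth_n(2)]
  show "X1 differentiable (at x)" unfolding X1_def covector_def
    by (intro differentiable_sum ballI differentiable_scaleR differentiable_inner differentiable_const d' differentiable_u x) auto
  show "X2 differentiable (at x)" unfolding X2_def covector_def
    by (intro differentiable_sum ballI differentiable_scaleR differentiable_inner differentiable_const d' differentiable_u x) auto
  have "(\<lambda>y. \<Sum>i\<in>Basis. (b * (fderiv p y i \<bullet> n1 y) - a * (fderiv q y i \<bullet> n2 y)) *\<^sub>R i) differentiable (at x)"
    by (intro differentiable_sum ballI differentiable_scaleR differentiable_diff differentiable_mult
        differentiable_inner differentiable_const d') auto
  then show "X3 differentiable (at x)"
    by (rule differentiable_cong_open[OF _ U x]) (simp add: X3_def covector_def sgn_mn norm_m norm_n)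
qed

lemma differentiable_V:
  assumes x: "x \<in> U"
  shows "V1 differentiable (at x)" "V2 differentiable (at x)" "V3 differentiable (at x)"
proof -
  note dX = differentiable_X[OF x]
  have "(\<lambda>y. inverse (\<Delta> y)) differentiable (at x)"
    unfolding \<Delta>_def triple_def using Delta_nonzero[OF x]
    by (intro differentiable_inverse differentiable_inner differentiable_cross3 dX) (simp add: \<Delta>_def triple_def)
  then show "V1 differentiable (at x)" "V2 differentiable (at x)" "V3 differentiable (at x)"
    unfolding V1_def V2_def V3_def by (intro differentiable_scaleR differentiable_cross3 dX; assumption)+
qed

lemma along:
  assumes x: "x \<in> U"
  shows "fderiv p x (V1 x) = u1 x" "fderiv p x (V2 x) = 0" "fderiv p x (V3 x) = b *\<^sub>R n1 x"
    "fderiv q x (V1 x) = 0" "fderiv q x (V2 x) = u2 x" "fderiv q x (V3 x) = - a *\<^sub>R n2 x"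
    "fderiv n1 x (V1 x) = s1 x *\<^sub>R u1 x" "fderiv n1 x (V2 x) = s2 x *\<^sub>R u1 x"
    "fderiv n1 x (V3 x) = - b *\<^sub>R p x + s3 x *\<^sub>R u1 x"
    "fderiv n2 x (V1 x) = r1 x *\<^sub>R u2 x" "fderiv n2 x (V2 x) = r2 x *\<^sub>R u2 x"
    "fderiv n2 x (V3 x) = a *\<^sub>R q x + r3 x *\<^sub>R u2 x"
  by (simp_all add: fderiv_pq[OF x] fderiv_n[OF x] dual[OF x] s1_def s2_def s3_def r1_def r2_def r3_def)

text \<open>The \<open>X3\<close> component of a bracket can be read off from either factor, as
  \<open>b\<close> times it from \<open>p\<close> and as \<open>- a\<close> times it from
  \<open>q\<close>. Comparing the two readings for the three brackets yields the symmetry of the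
  shape operator; the remaining components are kept for the Codazzi equations.\<close>

lemma structure_equations:
  assumes x: "x \<in> U"
    and V: "(V1 has_derivative V1') (at x)" "(V2 has_derivative V2') (at x)" "(V3 has_derivative V3') (at x)"
  shows "s3 x = 0" "r3 x = 0" "a * s2 x = b * r1 x"
    "X1 x \<bullet> (V3' (V1 x) - V1' (V3 x)) = b * s1 x" "X2 x \<bullet> (V3' (V1 x) - V1' (V3 x)) = - a * r1 x"
    "X3 x \<bullet> (V3' (V1 x) - V1' (V3 x)) = 0"
    "X1 x \<bullet> (V3' (V2 x) - V2' (V3 x)) = b * s2 x" "X2 x \<bullet> (V3' (V2 x) - V2' (V3 x)) = - a * r2 x"
    "X3 x \<bullet> (V3' (V2 x) - V2' (V3 x)) = 0"
proof -
  let ?Z13 = "V3' (V1 x) - V1' (V3 x)" and ?Z23 = "V3' (V2 x) - V2' (V3 x)" and ?Z12 = "V2' (V1 x) - V1' (V2 x)"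
  note d = smooth_on_has_derivative[OF smooth_n(1) x] smooth_on_has_derivative[OF smooth_n(2) x]
  note du = deriv_u[OF x]
  have dn: "((\<lambda>y. b *\<^sub>R n1 y) has_derivative (\<lambda>v. b *\<^sub>R fderiv n1 x v)) (at x)"
    "((\<lambda>y. - a *\<^sub>R n2 y) has_derivative (\<lambda>v. - a *\<^sub>R fderiv n2 x v)) (at x)"
    by (intro has_derivative_scaleR_right d)+
  have d0: "((\<lambda>y. 0 :: real^3) has_derivative (\<lambda>v. 0)) (at x)" by simp
  note B = bracket_of_fields[where S=U, OF _ x]
  have p13: "fderiv p x ?Z13 = (b * s1 x) *\<^sub>R u1 x + s3 x *\<^sub>R n1 x"
    using B[OF smooth(1) V(1,3) along(1) du(1) along(3) dn(1)] by (simp add: along[OF x] dual[OF x] s3_def)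
  have q13: "fderiv q x ?Z13 = (- a * r1 x) *\<^sub>R u2 x"
    using B[OF smooth(2) V(1,3) along(4) d0 along(6) dn(2)] by (simp add: along[OF x])
  have p23: "fderiv p x ?Z23 = (b * s2 x) *\<^sub>R u1 x"
    using B[OF smooth(1) V(2,3) along(2) d0 along(3) dn(1)] by (simp add: along[OF x])
  have q23: "fderiv q x ?Z23 = (- a * r2 x) *\<^sub>R u2 x + r3 x *\<^sub>R n2 x"
    using B[OF smooth(2) V(2,3) along(5) du(2) along(6) dn(2)] by (simp add: along[OF x] dual[OF x] r3_def)
  have p12: "fderiv p x ?Z12 = s2 x *\<^sub>R n1 x"
    using B[OF smooth(1) V(1,2) along(1) du(1) along(2) d0] by (simp add: dual[OF x] s2_def)
  have q12: "fderiv q x ?Z12 = - r1 x *\<^sub>R n2 x"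
    using B[OF smooth(2) V(1,2) along(4) d0 along(5) du(2)] by (simp add: dual[OF x] r1_def)
  have I: "X1 x \<bullet> Z = fderiv p x Z \<bullet> u1 x" "X2 x \<bullet> Z = fderiv q x Z \<bullet> u2 x"
    "b * (X3 x \<bullet> Z) = fderiv p x Z \<bullet> n1 x" "- a * (X3 x \<bullet> Z) = fderiv q x Z \<bullet> n2 x" for Z
    by (simp_all add: fderiv_pq[OF x] inner_add_left inner_diff_left orthonormal[OF x])
  show "X1 x \<bullet> ?Z13 = b * s1 x" "X2 x \<bullet> ?Z13 = - a * r1 x" "X1 x \<bullet> ?Z23 = b * s2 x" "X2 x \<bullet> ?Z23 = - a * r2 x"
    unfolding I p13 q13 p23 q23 by (simp_all add: inner_add_left inner_diff_left orthonormal[OF x])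
  have "b * (X3 x \<bullet> ?Z13) = s3 x" "- a * (X3 x \<bullet> ?Z13) = 0" "b * (X3 x \<bullet> ?Z23) = 0" "- a * (X3 x \<bullet> ?Z23) = r3 x"
    "b * (X3 x \<bullet> ?Z12) = s2 x" "- a * (X3 x \<bullet> ?Z12) = - r1 x"
    unfolding I p13 q13 p23 q23 p12 q12 by (simp_all add: inner_add_left inner_diff_left orthonormal[OF x])
  note z = this
  show "X3 x \<bullet> ?Z13 = 0" "X3 x \<bullet> ?Z23 = 0" using z(2,3) pos by simp_all
  then show "s3 x = 0" "r3 x = 0" using z(1,4) by simp_all
  have "r1 x = a * (X3 x \<bullet> ?Z12)" using z(6) by simp
  then show "a * s2 x = b * r1 x" using z(5) by (metis mult.left_commute)
qed

lemma frame_symmetry: assumes "x \<in> U" shows "s3 x = 0" "r3 x = 0" "a * s2 x = b * r1 x"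
  using structure_equations[OF assms] differentiable_V[OF assms] unfolding differentiable_def by blast+

text \<open>The Codazzi equations along \<open>V3\<close>, a geodesic direction contained in the kernel of the shape operator.\<close>

lemma Codazzi:
  assumes x: "x \<in> U"
  obtains s1' s2' r2' where "(s1 has_derivative s1') (at x)" "(s2 has_derivative s2') (at x)"
    "(r2 has_derivative r2') (at x)"
    "s1' (V3 x) = - b - b * (s1 x)\<^sup>2 + a * r1 x * s2 x"
    "s2' (V3 x) = - b * s1 x * s2 x + a * r2 x * s2 x"
    "r2' (V3 x) = a + a * (r2 x)\<^sup>2 - b * s2 x * r1 x"
proof -
  obtain V1' V2' V3' where V: "(V1 has_derivative V1') (at x)" "(V2 has_derivative V2') (at x)" "(V3 has_derivative V3') (at x)"
    using differentiable_V[OF x] unfolding differentiable_def by blast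
  note SE = structure_equations[OF x V]
  have d: "(\<lambda>y. fderiv n1 y (V1 y)) differentiable (at x)" "(\<lambda>y. fderiv n1 y (V2 y)) differentiable (at x)"
    "(\<lambda>y. fderiv n2 y (V2 y)) differentiable (at x)"
    unfolding differentiable_def
    by (rule exI, rule has_derivative_along_field[OF smooth_n(1) x V(1)] has_derivative_along_field[OF smooth_n(1) x V(2)]
      has_derivative_along_field[OF smooth_n(2) x V(2)])+
  note d' = differentiable_inner[OF d(1) differentiable_u(1)[OF x]] differentiable_inner[OF d(2) differentiable_u(1)[OF x]]
    differentiable_inner[OF d(3) differentiable_u(2)[OF x]]
  have "s1 differentiable (at x)" "s2 differentiable (at x)" "r2 differentiable (at x)"
    using d' unfolding s1_def[abs_def] s2_def[abs_def] r2_def[abs_def] S_def T_def .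
  then obtain s1' s2' r2' where D: "(s1 has_derivative s1') (at x)" "(s2 has_derivative s2') (at x)"
    "(r2 has_derivative r2') (at x)"
    unfolding differentiable_def by blast
  note du = deriv_u[OF x]
  have dp: "((\<lambda>y. - b *\<^sub>R p y) has_derivative (\<lambda>v. - b *\<^sub>R fderiv p x v)) (at x)"
    "((\<lambda>y. a *\<^sub>R q y) has_derivative (\<lambda>v. a *\<^sub>R fderiv q x v)) (at x)"
    by (intro has_derivative_scaleR_right derivs x)+
  note B = bracket_of_fields[where S=U, OF _ x]
  \<comment> \<open>Because \<open>s3\<close> and \<open>r3\<close> vanish on all of
    \<open>U\<close>, the derivatives along \<open>V3\<close> have these short forms everywhere and
    can be differentiated again.\<close>
  have al: "fderiv n1 y (V3 y) = - b *\<^sub>R p y" "fderiv n2 y (V3 y) = a *\<^sub>R q y" if "y \<in> U" for y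
    using along(9,12)[OF that] frame_symmetry[OF that] by simp_all
  \<comment> \<open>The \<open>u1\<close> component of the derivative of \<open>n1\<close> along the
    bracket of \<open>V1\<close> and \<open>V3\<close>. Expanding this bracket by the structure
    equations then expresses the derivative of \<open>s1\<close>.\<close>
  have 1: "S x (V3' (V1 x) - V1' (V3 x)) = - b - s1' (V3 x)"
    using arg_cong[OF B[OF smooth_n(1) V(1,3) along(7) has_derivative_scaleR[OF D(1) du(1)] al(1) dp(1)], of "\<lambda>z. z \<bullet> u1 x"]
    by (simp add: S_def[symmetric] inner_diff_left inner_add_left orthonormal[OF x] along[OF x] dual[OF x])
  have 2: "S x (V3' (V2 x) - V2' (V3 x)) = - s2' (V3 x)"
    using arg_cong[OF B[OF smooth_n(1) V(2,3) along(8) has_derivative_scaleR[OF D(2) du(1)] al(1) dp(1)], of "\<lambda>z. z \<bullet> u1 x"]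
    by (simp add: S_def[symmetric] inner_diff_left inner_add_left orthonormal[OF x] along[OF x] dual[OF x])
  have 3: "T x (V3' (V2 x) - V2' (V3 x)) = a - r2' (V3 x)"
    using arg_cong[OF B[OF smooth_n(2) V(2,3) along(11) has_derivative_scaleR[OF D(3) du(2)] al(2) dp(2)], of "\<lambda>z. z \<bullet> u2 x"]
    by (simp add: T_def[symmetric] inner_diff_left inner_add_left orthonormal[OF x] along[OF x] dual[OF x])
  note e = 1[unfolded ST_expansion[OF x] SE(1,2,4-9)] 2[unfolded ST_expansion[OF x] SE(1,2,4-9)]
    3[unfolded ST_expansion[OF x] SE(1,2,4-9)]
  show ?thesis
    by (rule that[OF D]) (use e in \<open>simp_all add: power2_eq_square algebra_simps\<close>)
qed

text \<open>Here \<open>Y3\<close> vanishes, so \<open>R3\<close> does not depend on time, no term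
  linear in \<open>t\<close> survives, and what remains is a 2 by 2 determinant in the rows
  \<open>X1\<close> and \<open>X2\<close>.\<close>

lemma vol_constant_angle:
  assumes x: "x \<in> U"
  shows "vol x t = \<Delta> x * (cos (a * t) * cos (b * t) + s1 x * (sin (a * t) * cos (b * t))
    + r2 x * (cos (a * t) * sin (b * t)) + (s1 x * r2 x - s2 x * r1 x) * (sin (a * t) * sin (b * t)))"
proof -
  have m: "(\<lambda>y. a *\<^sub>R n1 y) = m" "(\<lambda>y. b *\<^sub>R n2 y) = n" using pos by (simp_all add: n1_def n2_def)
  have fm: "fderiv m x v = a *\<^sub>R fderiv n1 x v" "fderiv n x v = b *\<^sub>R fderiv n2 x v" for v
    using has_derivative_scaleR_right[OF smooth_on_has_derivative[OF smooth_n(1) x], of a]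
      has_derivative_scaleR_right[OF smooth_on_has_derivative[OF smooth_n(2) x], of b]
    unfolding m by (simp_all add: frechet_derivative_eqI)
  have Y1: "Y1 x = (a * s1 x) *\<^sub>R X1 x + (a * s2 x) *\<^sub>R X2 x"
    by (rule vector_eq_rdot[THEN iffD1])
      (simp add: covectors(4)[OF x] fm S_def[symmetric] ST_expansion[OF x] frame_symmetry[OF x] inner_add_left algebra_simps)
  have Y2: "Y2 x = (b * r1 x) *\<^sub>R X1 x + (b * r2 x) *\<^sub>R X2 x"
    by (rule vector_eq_rdot[THEN iffD1])
      (simp add: covectors(5)[OF x] fm T_def[symmetric] ST_expansion[OF x] frame_symmetry[OF x] inner_add_left algebra_simps)
  have Y3: "Y3 x = 0"
    by (rule vector_eq_rdot[THEN iffD1])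
      (simp add: covectors(6)[OF x] fm sgn_mn[OF x] fderiv_n[OF x] inner_add_left inner_diff_left orthonormal[OF x])
  have R: "R1 x t = (cos (a * t) + s1 x * sin (a * t)) *\<^sub>R X1 x + (s2 x * sin (a * t)) *\<^sub>R X2 x"
    "R2 x t = (r1 x * sin (b * t)) *\<^sub>R X1 x + (cos (b * t) + r2 x * sin (b * t)) *\<^sub>R X2 x" "R3 x t = X3 x"
    using pos unfolding R1_def R2_def R3_def Y1 Y2 Y3 norm_m[OF x] norm_n[OF x]
    by (simp_all add: algebra_simps)
  have t: "triple (c1 *\<^sub>R A + c2 *\<^sub>R B) (d1 *\<^sub>R A + d2 *\<^sub>R B) C = (c1 * d2 - c2 * d1) * triple A B C"
    for A B C c1 c2 d1 d2 by (simp add: triple_def cross3_simps)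
  show ?thesis unfolding vol_def R t \<Delta>_def by (simp add: algebra_simps)
qed

lemma Delta_vol: "x \<in> U \<Longrightarrow> \<Delta> x = vol x 0" by (simp add: vol_constant_angle)

end

section \<open>Rigidity from constant coefficients, and the orthogonal map between the two
  factors\<close>

lemma has_derivative_locally_const:
  assumes "(f has_derivative f') (at x)" "open W" "x \<in> W" "\<And>y. y \<in> W \<Longrightarrow> f y = f x"
  shows "f' v = 0"
proof -
  have "((\<lambda>y. f x) has_derivative f') (at x)"
    by (rule has_derivative_transform_within_open[OF assms(1-4)])
  then have "f' = (\<lambda>v. 0)" using has_derivative_unique has_derivative_const by blast
  then show ?thesis by simp
qed

context constant_angle begin

text \<open>Constancy of \<open>s1\<close>, \<open>r2\<close> and the determinant, with
  \<open>a * s2 = b * r1\<close>, makes the square of \<open>s2\<close> constant. The Codazzi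
  equation for \<open>r2\<close> excludes \<open>s2 = 0\<close>, so the one for \<open>s2\<close>
  gives \<open>a * r2 = b * s1\<close>; put into the equations for \<open>s1\<close> and
  \<open>r2\<close>, this forces \<open>b\<^sup>2 = a\<^sup>2\<close>.\<close>

lemma different_radii_impossible:
  assumes W: "open W" "W \<subseteq> U" "x \<in> W" and ab: "a \<noteq> b"
    and c: "\<And>y. y \<in> W \<Longrightarrow> s1 y = s1 x" "\<And>y. y \<in> W \<Longrightarrow> r2 y = r2 x"
      "\<And>y. y \<in> W \<Longrightarrow> s1 y * r2 y - s2 y * r1 y = s1 x * r2 x - s2 x * r1 x"
  shows False
proof -
  have x: "x \<in> U" using W by blast
  obtain s1' s2' r2' where D: "(s1 has_derivative s1') (at x)" "(s2 has_derivative s2') (at x)"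
    "(r2 has_derivative r2') (at x)"
    and E: "s1' (V3 x) = - b - b * (s1 x)\<^sup>2 + a * r1 x * s2 x"
    "s2' (V3 x) = - b * s1 x * s2 x + a * r2 x * s2 x" "r2' (V3 x) = a + a * (r2 x)\<^sup>2 - b * s2 x * r1 x"
    using Codazzi[OF x] by blast
  have z: "s1' (V3 x) = 0" "r2' (V3 x) = 0"
    by (rule has_derivative_locally_const[OF D(1) W(1,3) c(1)] has_derivative_locally_const[OF D(3) W(1,3) c(2)], assumption)+
  have sr: "a * s2 y = b * r1 y" if "y \<in> U" for y using frame_symmetry[OF that] by simp
  have "s2 y * s2 y = s2 x * s2 x" if "y \<in> W" for y
  proof -
    have "s2 y * r1 y = s2 x * r1 x" using c[OF that] by simp
    then have "s2 y * (b * r1 y) = s2 x * (b * r1 x)" by (simp add: mult.left_commute)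
    then have "a * (s2 y * s2 y) = a * (s2 x * s2 x)"
      unfolding sr[OF x, symmetric] sr[OF subsetD[OF W(2) that], symmetric] by (simp add: mult.left_commute)
    then show ?thesis using pos by simp
  qed
  from has_derivative_locally_const[OF has_derivative_mult[OF D(2) D(2)] W(1,3) this, of "V3 x"]
  have "s2 x * s2' (V3 x) = 0" by (simp add: mult.commute)
  moreover have "s2 x \<noteq> 0"
  proof
    assume "s2 x = 0"
    then have "a * (1 + (r2 x)\<^sup>2) = 0" using E(3) z by (simp add: algebra_simps)
    then show False using pos by (auto simp: add_nonneg_eq_0_iff)
  qed
  ultimately have "s2 x * (a * r2 x - b * s1 x) = 0" using E(2) by (simp add: algebra_simps)
  with \<open>s2 x \<noteq> 0\<close> have e: "a * r2 x = b * s1 x" by simp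
  \<comment> \<open>Multiplied by \<open>b\<close> and by \<open>a\<close>, the equations for
    \<open>s1\<close> and \<open>r2\<close> acquire the same coupling term on the right.\<close>
  have 1: "b * (b + b * (s1 x)\<^sup>2) = a * (s2 x * (b * r1 x))" using E(1) z by (simp add: algebra_simps)
  have 2: "a * (a + a * (r2 x)\<^sup>2) = a * (s2 x * (b * r1 x))" using E(3) z by (simp add: algebra_simps)
  have "b * b + (b * s1 x)\<^sup>2 = a * a + (a * r2 x)\<^sup>2" using 1 2 by (simp add: power2_eq_square algebra_simps)
  then have "b\<^sup>2 = a\<^sup>2" unfolding e by (simp add: power2_eq_square)
  with ab pos show False by (simp add: power2_eq_iff)
qed

text \<open>Where \<open>s1\<close> and \<open>r2\<close> differ, the derivative of their constant
  sum along \<open>V3\<close> gives \<open>r2 = - s1\<close>, and that of the constant determinant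
  then gives \<open>2 * s1 * (1 + s1^2 + s2^2) = 0\<close>, a contradiction. So both equal
  \<open>h / 2\<close>, and the Codazzi equation for the constant \<open>s1\<close> determines the
  square of \<open>s2\<close>.\<close>

lemma equal_radii_curvatures:
  assumes W: "open W" "W \<subseteq> U" "x \<in> W" and ab: "a = b"
    and c: "\<And>y. y \<in> W \<Longrightarrow> s1 y + r2 y = h" "\<And>y. y \<in> W \<Longrightarrow> s1 y * r2 y - s2 y * r1 y = K"
  shows "s1 x = h / 2" "r2 x = h / 2" "r1 x = s2 x" "(s2 x)\<^sup>2 = 1 + (h / 2)\<^sup>2"
proof -
  have rs: "r1 y = s2 y" if "y \<in> U" for y using frame_symmetry[OF that] pos ab by simp
  have eq: "s1 y = r2 y" if y: "y \<in> W" for y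
  proof (rule ccontr)
    assume ne: "s1 y \<noteq> r2 y"
    have yU: "y \<in> U" using W y by blast
    obtain s1' s2' r2' where D: "(s1 has_derivative s1') (at y)" "(s2 has_derivative s2') (at y)"
      "(r2 has_derivative r2') (at y)"
      and E: "s1' (V3 y) = - b - b * (s1 y)\<^sup>2 + a * r1 y * s2 y"
      "s2' (V3 y) = - b * s1 y * s2 y + a * r2 y * s2 y" "r2' (V3 y) = a + a * (r2 y)\<^sup>2 - b * s2 y * r1 y"
      using Codazzi[OF yU] by blast
    have "s1' (V3 y) + r2' (V3 y) = 0"
      using has_derivative_locally_const[OF has_derivative_add[OF D(1,3)] W(1) y, of "V3 y"] c(1) y by simp
    then have "b * ((r2 y - s1 y) * (r2 y + s1 y)) = 0"
      unfolding E ab rs[OF yU] by (simp add: power2_eq_square algebra_simps)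
    then have r: "r2 y = - s1 y" using pos ne by auto
    have "s1 z * r2 z - s2 z * s2 z = s1 y * r2 y - s2 y * s2 y" if "z \<in> W" for z
      using c(2)[OF that] c(2)[OF y] rs[OF yU] rs[OF subsetD[OF W(2) that]] by simp
    from has_derivative_locally_const[OF has_derivative_diff[OF has_derivative_mult[OF D(1,3)] has_derivative_mult[OF D(2,2)]] W(1) y this, of "V3 y"]
    have "s1 y * r2' (V3 y) + s1' (V3 y) * r2 y - (s2 y * s2' (V3 y) + s2' (V3 y) * s2 y) = 0" .
    then have "b * (2 * s1 y * (1 + s1 y * s1 y + s2 y * s2 y)) = 0"
      unfolding E ab rs[OF yU] r by (simp add: power2_eq_square algebra_simps)
    moreover have "1 + s1 y * s1 y + s2 y * s2 y > 0" by (smt (verit) zero_le_square)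
    ultimately have "s1 y = 0" using pos by simp
    with ne r show False by simp
  qed
  have h: "s1 y = h / 2" if "y \<in> W" for y using eq[OF that] c(1)[OF that] by simp
  have x: "x \<in> U" using W by blast
  show "s1 x = h / 2" "r2 x = h / 2" "r1 x = s2 x" using h[OF W(3)] eq[OF W(3)] rs[OF x] by simp_all
  obtain s1' where D: "(s1 has_derivative s1') (at x)"
    and E: "s1' (V3 x) = - b - b * (s1 x)\<^sup>2 + a * r1 x * s2 x" using Codazzi[OF x] by blast
  have "s1 y = s1 x" if "y \<in> W" for y using h[OF that] h[OF W(3)] by simp
  then have "s1' (V3 x) = 0" by (rule has_derivative_locally_const[OF D W(1,3)])
  then have "b * ((s2 x)\<^sup>2 - (1 + (h / 2)\<^sup>2)) = 0"
    unfolding E rs[OF x] h[OF W(3)] using ab by (simp add: power2_eq_square algebra_simps)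
  then show "(s2 x)\<^sup>2 = 1 + (h / 2)\<^sup>2" using pos by simp
qed

text \<open>The orthogonal map taking the frame \<open>q, n2, u2\<close> to \<open>cos \<theta> p + sin \<theta> n1, sin \<theta> p - cos \<theta> n1, \<plusminus> u1\<close>, where
  \<open>cot \<theta> = - k\<close>; on the model \<open>p \<bullet> q = cos \<theta>\<close> it is the identity.\<close>

definition "sin_angle k = 1 / sqrt (1 + k\<^sup>2)" for k :: real
definition "cos_angle k = - k / sqrt (1 + k\<^sup>2)" for k :: real

definition rot :: "real \<Rightarrow> real \<Rightarrow> real^3 \<Rightarrow> real^3 \<Rightarrow> real^3" where
  "rot \<delta> k x w = (w \<bullet> q x) *\<^sub>R (cos_angle k *\<^sub>R p x + sin_angle k *\<^sub>R n1 x)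
    + (w \<bullet> n2 x) *\<^sub>R (sin_angle k *\<^sub>R p x - cos_angle k *\<^sub>R n1 x) + (\<delta> * (w \<bullet> u2 x)) *\<^sub>R u1 x"

lemma angle_facts:
  fixes k :: real
  shows "sin_angle k > 0" "cos_angle k = - k * sin_angle k" "sqrt (1 + k\<^sup>2) = (1 + k\<^sup>2) * sin_angle k"
    "(1 + k\<^sup>2) * (sin_angle k * sin_angle k) = 1"
    "cos_angle k * cos_angle k + sin_angle k * sin_angle k = 1" "cos_angle k \<in> {-1<..<1}"
proof -
  have r: "1 + k\<^sup>2 > 0" by (simp add: add_pos_nonneg)
  then show s: "sin_angle k > 0" by (simp add: sin_angle_def)
  show c: "cos_angle k = - k * sin_angle k" by (simp add: sin_angle_def cos_angle_def)
  show "sqrt (1 + k\<^sup>2) = (1 + k\<^sup>2) * sin_angle k" using r by (simp add: sin_angle_def real_div_sqrt)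
  show ss: "(1 + k\<^sup>2) * (sin_angle k * sin_angle k) = 1" using r by (simp add: sin_angle_def)
  then show cs: "cos_angle k * cos_angle k + sin_angle k * sin_angle k = 1"
    unfolding c by (simp add: algebra_simps power2_eq_square)
  have "(cos_angle k)\<^sup>2 < 1\<^sup>2" using cs s by (simp add: power2_eq_square) (smt (verit) mult_pos_pos)
  then have "\<bar>cos_angle k\<bar> < 1" using power2_less_imp_less[of "\<bar>cos_angle k\<bar>" 1] by simp
  then show "cos_angle k \<in> {-1<..<1}" by auto
qed

text \<open>The map carries one orthonormal frame to another. The last part rests on the gradient of
  \<open>p \<bullet> R q\<close> along the two spheres: it is \<open>sin_angle k\<close> times
  \<open>(n1, n2)\<close>, hence a nonzero multiple of \<open>(m, n)\<close> when
  \<open>a = b\<close>.\<close>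

lemma rot_orthogonal:
  assumes x: "x \<in> U" and \<delta>: "\<delta> * \<delta> = 1"
  shows "orthogonal_transformation (rot \<delta> k x)" "p x \<bullet> rot \<delta> k x (q x) = cos_angle k"
    "w1 \<bullet> p x = 0 \<Longrightarrow> w2 \<bullet> q x = 0 \<Longrightarrow> w1 \<bullet> rot \<delta> k x (q x) + p x \<bullet> rot \<delta> k x w2 = 0 \<Longrightarrow>
      a = b \<Longrightarrow> w1 \<bullet> m x + w2 \<bullet> n x = 0"
proof -
  note o = orthonormal[OF x]
  let ?c = "cos_angle k" and ?s = "sin_angle k"
  have cs: "?c * ?c + ?s * ?s = 1" by (rule angle_facts)
  have "linear (rot \<delta> k x)"
    by (rule linearI) (simp_all add: rot_def inner_add_left algebra_simps)
  moreover have "rot \<delta> k x v \<bullet> rot \<delta> k x w = v \<bullet> w" for v w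
  proof -
    have "rot \<delta> k x v \<bullet> rot \<delta> k x w = (v \<bullet> q x) * (w \<bullet> q x) * (?c * ?c + ?s * ?s)
       + (v \<bullet> n2 x) * (w \<bullet> n2 x) * (?c * ?c + ?s * ?s) + \<delta> * \<delta> * ((v \<bullet> u2 x) * (w \<bullet> u2 x))"
      unfolding rot_def by (simp add: inner_add_left inner_add_right inner_diff_left inner_diff_right o algebra_simps)
    also have "\<dots> = v \<bullet> w"
      using arg_cong[OF frame2(4)[OF x, of v], of "\<lambda>z. z \<bullet> w"]
      unfolding cs \<delta> by (simp add: inner_add_left inner_add_right inner_commute)
    finally show ?thesis .
  qed
  ultimately show "orthogonal_transformation (rot \<delta> k x)" by (simp add: orthogonal_transformation_def)
  have rq: "rot \<delta> k x (q x) = ?c *\<^sub>R p x + ?s *\<^sub>R n1 x" by (simp add: rot_def o)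
  show "p x \<bullet> rot \<delta> k x (q x) = ?c" by (simp add: rq inner_add_right o)
  assume w: "w1 \<bullet> p x = 0" "w2 \<bullet> q x = 0" and "w1 \<bullet> rot \<delta> k x (q x) + p x \<bullet> rot \<delta> k x w2 = 0"
  then have "?s * (w1 \<bullet> n1 x + w2 \<bullet> n2 x) = 0"
    by (simp add: rq rot_def inner_add_right inner_diff_right o algebra_simps)
  then have z: "w1 \<bullet> n1 x + w2 \<bullet> n2 x = 0" using angle_facts(1)[of k] by simp
  assume "a = b"
  moreover have "w1 \<bullet> m x + w2 \<bullet> n x = a * (w1 \<bullet> n1 x) + b * (w2 \<bullet> n2 x)"
    using pos by (simp add: n1_def n2_def mult.assoc[symmetric])
  ultimately show "w1 \<bullet> m x + w2 \<bullet> n x = 0" using z by (metis distrib_left mult_zero_right)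
qed

lemma rot_has_derivative:
  assumes x: "x \<in> U"
  shows "((\<lambda>y. rot \<delta> k y w) has_derivative (\<lambda>v.
     ((w \<bullet> q x) *\<^sub>R (cos_angle k *\<^sub>R fderiv p x v + sin_angle k *\<^sub>R fderiv n1 x v)
        + (w \<bullet> fderiv q x v) *\<^sub>R (cos_angle k *\<^sub>R p x + sin_angle k *\<^sub>R n1 x))
    + ((w \<bullet> n2 x) *\<^sub>R (sin_angle k *\<^sub>R fderiv p x v - cos_angle k *\<^sub>R fderiv n1 x v)
        + (w \<bullet> fderiv n2 x v) *\<^sub>R (sin_angle k *\<^sub>R p x - cos_angle k *\<^sub>R n1 x))
    + ((\<delta> * (w \<bullet> u2 x)) *\<^sub>R (- ((X1 x \<bullet> v) *\<^sub>R p x) - S x v *\<^sub>R n1 x)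
        + (\<delta> * (w \<bullet> (- ((X2 x \<bullet> v) *\<^sub>R q x) - T x v *\<^sub>R n2 x))) *\<^sub>R u1 x))) (at x)"
  unfolding rot_def
  by (intro has_derivative_add has_derivative_diff has_derivative_scaleR has_derivative_scaleR_right
      has_derivative_mult_right has_derivative_inner_right derivs(1,2)[OF x] deriv_u[OF x]
      smooth_on_has_derivative[OF smooth_n(1) x] smooth_on_has_derivative[OF smooth_n(2) x])

text \<open>The map is constant once both frames turn alike. The matrix with rows
  \<open>(cos_angle k, sin_angle k)\<close> and \<open>(sin_angle k, - cos_angle k)\<close> takes
  the forms \<open>X1, S\<close> of the first factor to \<delta> times the forms
  \<open>X2, T\<close> of the second; this is where \<open>s1 = r2 = k\<close> and the value of
  \<open>s2\<close> enter.\<close>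

lemma rot_stationary:
  assumes x: "x \<in> U" and \<delta>: "\<delta> * \<delta> = 1" and ab: "a = b"
    and k: "s1 x = k" "r2 x = k" "r1 x = s2 x" "s2 x = \<delta> * sqrt (1 + k\<^sup>2)"
  shows "((\<lambda>y. rot \<delta> k y w) has_derivative (\<lambda>v. 0)) (at x)"
proof -
  let ?c = "cos_angle k" and ?s = "sin_angle k"
  note o = orthonormal[OF x]
  have d2: "\<delta> * (\<delta> * z) = z" for z using \<delta> by (simp add: mult.assoc[symmetric])
  have s2: "s2 x = \<delta> * ((1 + k\<^sup>2) * ?s)" using k(4) angle_facts(3)[of k] by simp
  have S: "S x v = k * (X1 x \<bullet> v) + \<delta> * ((1 + k\<^sup>2) * ?s) * (X2 x \<bullet> v)" for v
    by (simp add: ST_expansion[OF x] k(1) s2 frame_symmetry[OF x])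
  have T: "T x v = \<delta> * ((1 + k\<^sup>2) * ?s) * (X1 x \<bullet> v) + k * (X2 x \<bullet> v)" for v
    by (simp add: ST_expansion[OF x] k(2,3) s2 frame_symmetry[OF x])
  have ss: "?s * ((1 + k\<^sup>2) * ?s) = 1" using angle_facts(4)[of k] by (simp add: algebra_simps)
  \<comment> \<open>The \<open>u1\<close> component of the derivative of the image of
    \<open>q\<close>: the \<open>X1\<close> terms cancel because \<open>k\<close> is minus the
    cotangent of the angle, and the value of \<open>s2\<close> normalises the coefficient of
    \<open>X2\<close>.\<close>
  have hA: "?c * (X1 x \<bullet> v) + ?s * S x v = \<delta> * (X2 x \<bullet> v)" for v
  proof -
    have "?c * (X1 x \<bullet> v) + ?s * S x v = \<delta> * (?s * ((1 + k\<^sup>2) * ?s)) * (X2 x \<bullet> v)"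
      by (simp add: S angle_facts(2) distrib_left)
    then show ?thesis by (simp only: ss mult_1_right)
  qed
  have hB: "?s * (X1 x \<bullet> v) - ?c * S x v = \<delta> * T x v" for v
  proof -
    have "?s * (X1 x \<bullet> v) - ?c * S x v = (1 + k\<^sup>2) * ?s * (X1 x \<bullet> v) + \<delta> * k * (?s * ((1 + k\<^sup>2) * ?s)) * (X2 x \<bullet> v)"
      by (simp add: S angle_facts(2) algebra_simps power2_eq_square)
    also have "\<dots> = \<delta> * T x v" unfolding ss by (simp add: T distrib_left d2 mult.assoc)
    finally show ?thesis .
  qed
  have cs: "?c * ?c + ?s * ?s = 1" by (rule angle_facts)
  \<comment> \<open>The matrix of \<open>hA\<close> and \<open>hB\<close> is a reflection, hence its
    own inverse, so the two relations can be solved for \<open>X1\<close> and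
    \<open>S\<close>.\<close>
  have hX: "X1 x \<bullet> v = ?c * (\<delta> * (X2 x \<bullet> v)) + ?s * (\<delta> * T x v)" for v
  proof -
    have "?c * (\<delta> * (X2 x \<bullet> v)) + ?s * (\<delta> * T x v) = (?c * ?c + ?s * ?s) * (X1 x \<bullet> v)"
      unfolding hA[symmetric] hB[symmetric] by (simp add: algebra_simps)
    then show ?thesis using cs by simp
  qed
  have hS: "S x v = ?s * (\<delta> * (X2 x \<bullet> v)) - ?c * (\<delta> * T x v)" for v
  proof -
    have "?s * (\<delta> * (X2 x \<bullet> v)) - ?c * (\<delta> * T x v) = (?c * ?c + ?s * ?s) * S x v"
      unfolding hA[symmetric] hB[symmetric] by (simp add: algebra_simps)
    then show ?thesis using cs by simp
  qed
  define D where "D = (\<lambda>v.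
     ((w \<bullet> q x) *\<^sub>R (cos_angle k *\<^sub>R fderiv p x v + sin_angle k *\<^sub>R fderiv n1 x v)
        + (w \<bullet> fderiv q x v) *\<^sub>R (cos_angle k *\<^sub>R p x + sin_angle k *\<^sub>R n1 x))
    + ((w \<bullet> n2 x) *\<^sub>R (sin_angle k *\<^sub>R fderiv p x v - cos_angle k *\<^sub>R fderiv n1 x v)
        + (w \<bullet> fderiv n2 x v) *\<^sub>R (sin_angle k *\<^sub>R p x - cos_angle k *\<^sub>R n1 x))
    + ((\<delta> * (w \<bullet> u2 x)) *\<^sub>R (- ((X1 x \<bullet> v) *\<^sub>R p x) - S x v *\<^sub>R n1 x)
        + (\<delta> * (w \<bullet> (- ((X2 x \<bullet> v) *\<^sub>R q x) - T x v *\<^sub>R n2 x))) *\<^sub>R u1 x))"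
  have "D v = 0" for v
  proof -
    have e: "fderiv p x v = (b * (X3 x \<bullet> v)) *\<^sub>R n1 x + (X1 x \<bullet> v) *\<^sub>R u1 x"
      "fderiv q x v = (- b * (X3 x \<bullet> v)) *\<^sub>R n2 x + (X2 x \<bullet> v) *\<^sub>R u2 x"
      "fderiv n1 x v = (- b * (X3 x \<bullet> v)) *\<^sub>R p x + S x v *\<^sub>R u1 x"
      "fderiv n2 x v = (b * (X3 x \<bullet> v)) *\<^sub>R q x + T x v *\<^sub>R u2 x"
      using fderiv_pq[OF x, of v] fderiv_n[OF x, of v] ab by simp_all
    have "D v \<bullet> p x = 0"
      unfolding D_def e
      by (simp add: inner_add_left inner_diff_left inner_add_right inner_diff_right o)
        (simp add: hX algebra_simps d2)
    moreover have "D v \<bullet> n1 x = 0"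
      unfolding D_def e
      by (simp add: inner_add_left inner_diff_left inner_add_right inner_diff_right o)
        (simp add: hS algebra_simps d2)
    moreover have "D v \<bullet> u1 x = (w \<bullet> q x) * ((?c * (X1 x \<bullet> v) + ?s * S x v) - \<delta> * (X2 x \<bullet> v))
        + (w \<bullet> n2 x) * ((?s * (X1 x \<bullet> v) - ?c * S x v) - \<delta> * T x v)"
      unfolding D_def e
      by (simp add: inner_add_left inner_diff_left inner_add_right inner_diff_right o) (simp add: algebra_simps)
    then have "D v \<bullet> u1 x = 0" unfolding hA hB by simp
    ultimately show "D v = 0" using frame1(4)[OF x, of "D v"] by simp
  qed
  then have "D = (\<lambda>v. 0)" by (rule ext)
  then show ?thesis using rot_has_derivative[OF x, of \<delta> k w] unfolding D_def[symmetric] by simp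
qed

text \<open>The two maps differ by \<open>2 (w \<bullet> u2) u1\<close>. Constancy of both would
  make this constant near \<open>x\<close>, but for \<open>w = u2 x\<close> its derivative along
  \<open>V1\<close> has a nonzero component along \<open>p x\<close>.\<close>

lemma rot_sign_unique:
  assumes W: "open W" "x \<in> W" and x: "x \<in> U"
    and c: "\<And>y w. y \<in> W \<Longrightarrow> rot 1 k y w = rot 1 k x w" "\<And>y w. y \<in> W \<Longrightarrow> rot (-1) k y w = rot (-1) k x w"
  shows False
proof -
  have e: "rot 1 k y w - rot (-1) k y w = (2 * (w \<bullet> u2 y)) *\<^sub>R u1 y" for y w
    unfolding mult_2 scaleR_add_left by (simp add: rot_def)
  have "((\<lambda>y. (2 * (u2 x \<bullet> u2 y)) *\<^sub>R u1 y) has_derivative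
      (\<lambda>v. (2 * (u2 x \<bullet> u2 x)) *\<^sub>R (- ((X1 x \<bullet> v) *\<^sub>R p x) - S x v *\<^sub>R n1 x)
        + (2 * (u2 x \<bullet> (- ((X2 x \<bullet> v) *\<^sub>R q x) - T x v *\<^sub>R n2 x))) *\<^sub>R u1 x)) (at x)"
    by (intro has_derivative_scaleR has_derivative_mult_right has_derivative_inner_right deriv_u x)
  from has_derivative_locally_const[OF this W]
  have z: "(2 * (u2 x \<bullet> u2 x)) *\<^sub>R (- ((X1 x \<bullet> v) *\<^sub>R p x) - S x v *\<^sub>R n1 x)
        + (2 * (u2 x \<bullet> (- ((X2 x \<bullet> v) *\<^sub>R q x) - T x v *\<^sub>R n2 x))) *\<^sub>R u1 x = 0" for v
    using c e by (metis (no_types, lifting))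
  show False
    using arg_cong[OF z[of "V1 x"], of "\<lambda>z. z \<bullet> p x"]
    by (simp add: inner_add_left inner_diff_left orthonormal[OF x] dual[OF x])
qed

end

section \<open>Hypersurfaces as open pieces of level sets\<close>

context local_hypersurface begin

text \<open>One function serves both models: \<xi> = 0 with an orthogonal \<open>R\<close> gives
  \<open>M_hyp\<close> up to congruence, and \<open>R = 0\<close> gives a circle times the sphere.
  The unit lengths of \<open>p\<close> and \<open>q\<close> are added as two further equations, so
  that the level set in \<open>R6\<close> has codimension 3 and
  \<open>immersion_fills_level_set\<close> applies.\<close>

lemma level_set_open:
  assumes x: "x \<in> U" and R: "linear R"
    and c: "\<And>y. y \<in> U \<Longrightarrow> p y \<bullet> R (q y) + p y \<bullet> \<xi> = c"
    and ker: "\<And>w1 w2. w1 \<bullet> p x = 0 \<Longrightarrow> w2 \<bullet> q x = 0 \<Longrightarrow> w1 \<bullet> R (q x) + p x \<bullet> R w2 + w1 \<bullet> \<xi> = 0 \<Longrightarrow>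
      w1 \<bullet> m x + w2 \<bullet> n x = 0"
  shows "\<exists>V. open V \<and> (p x, q x) \<in> V \<and>
    (\<forall>z\<in>V. z \<in> S2S2 \<longrightarrow> fst z \<bullet> R (snd z) + fst z \<bullet> \<xi> = c \<longrightarrow> z \<in> (\<lambda>y. (p y, q y)) ` U)"
proof -
  let ?f = "\<lambda>y. (p y, q y)"
  define F :: "R6 \<Rightarrow> real \<times> real \<times> real" where
    "F z = (fst z \<bullet> fst z, snd z \<bullet> snd z, fst z \<bullet> R (snd z) + fst z \<bullet> \<xi>)" for z
  define F' :: "R6 \<Rightarrow> R6 \<Rightarrow> real \<times> real \<times> real" where
    "F' z v = (fst z \<bullet> fst v + fst v \<bullet> fst z, snd z \<bullet> snd v + snd v \<bullet> snd z,
      (fst z \<bullet> R (snd v) + fst v \<bullet> R (snd z)) + fst v \<bullet> \<xi>)" for z v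
  define B :: "R6 \<Rightarrow> R6 \<Rightarrow> real \<times> real \<times> real" where
    "B z v = (fst z \<bullet> fst v + fst v \<bullet> fst z, snd z \<bullet> snd v + snd v \<bullet> snd z,
      fst z \<bullet> R (snd v) + fst v \<bullet> R (snd z))" for z v
  have bR: "bounded_linear R" using R linear_conv_bounded_linear by blast
  have dF: "(F has_derivative F' z) (at z)" for z
    unfolding F_def F'_def
    by (intro has_derivative_Pair has_derivative_inner has_derivative_add has_derivative_inner_left
        bounded_linear.has_derivative[OF bR] has_derivative_fst has_derivative_snd has_derivative_ident)
  have "bilinear B"
    unfolding bilinear_def B_def
    by (auto intro!: linearI simp: linear_add[OF R] linear_scale[OF R] inner_add_left inner_add_right algebra_simps)
  then interpret B: bounded_bilinear B by (simp add: bilinear_conv_bounded_bilinear)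
  obtain K where K: "K > 0" "\<And>z v. norm (B z v) \<le> norm z * norm v * K" using B.pos_bounded by blast
  \<comment> \<open>\<open>F\<close> is a polynomial of degree at most 2, so its derivative varies
    with the base point through a bilinear map, whose bound gives the continuity
    \<open>F'c\<close>.\<close>
  have F'B: "F' z v - F' y v = B (z - y) v" for z y v
    by (simp add: F'_def B_def linear_diff[OF R] inner_diff_left inner_diff_right)
  have F'c: "\<exists>d>0. \<forall>z. dist (?f x) z < d \<longrightarrow> onorm (\<lambda>v. F' z v - F' (?f x) v) < e" if e: "e > 0" for e
  proof (intro exI[of _ "e / K"] conjI allI impI)
    show "e / K > 0" using e K by simp
    fix z assume z: "dist (?f x) z < e / K"
    have "onorm (\<lambda>v. B (z - ?f x) v) \<le> norm (z - ?f x) * K"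
      by (rule onorm_le) (use K(2)[of "z - ?f x"] in \<open>simp add: mult.commute mult.left_commute\<close>)
    also have "\<dots> < e" using z K(1) by (simp add: dist_norm norm_minus_commute field_simps)
    finally show "onorm (\<lambda>v. F' z v - F' (?f x) v) < e" unfolding F'B .
  qed
  have df: "(?f has_derivative (\<lambda>v. (fderiv p x v, fderiv q x v))) (at x)"
    by (rule has_derivative_Pair[OF derivs(1)[OF x] derivs(2)[OF x]])
  have lf: "linear (\<lambda>v. (fderiv p x v, fderiv q x v))" using df has_derivative_linear by blast
  have inj: "inj (\<lambda>v. (fderiv p x v, fderiv q x v))"
    using immersion[OF x] by (subst linear_injective_0[OF lf]) (simp add: zero_prod_def)
  have N: "norm (m x, n x) = 1" using unit_normal[OF x] by (simp add: norm_Pair)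
  have "\<exists>V. open V \<and> ?f x \<in> V \<and> (\<forall>z\<in>V. F z = (1, 1, c) \<longrightarrow> z \<in> ?f ` U)"
  proof (rule immersion_fills_level_set[OF U x _ df inj dF F'c])
    show "continuous_on U ?f"
      by (intro continuous_on_Pair smooth_on_continuous smooth)
    show "F (?f y) = (1, 1, c)" if "y \<in> U" for y
      using unit[OF that] c[OF that] by (simp add: F_def norm_eq_1)
    fix w assume "F' (?f x) w = 0"
    then have w: "fst w \<bullet> p x = 0" "snd w \<bullet> q x = 0" "fst w \<bullet> R (q x) + p x \<bullet> R (snd w) + fst w \<bullet> \<xi> = 0"
      by (auto simp: F'_def zero_prod_def inner_commute)
    \<comment> \<open>A vector in the kernel is orthogonal to \<open>(p, 0)\<close> and
      \<open>(0, q)\<close> and, by \<open>ker\<close>, to the normal; this leaves only the tangent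
      space of the hypersurface.\<close>
    show "w \<in> range (\<lambda>v. (fderiv p x v, fderiv q x v))"
      by (rule range_eq_orthogonal_complement[OF lf inj, of "(p x, 0)" "(0, q x)" "(m x, n x)"])
        (use w ker[OF w] N unit[OF x] tangent[OF x] first_order[OF x] normal[OF x] in
          \<open>simp_all add: inner_prod_def inner_commute norm_Pair\<close>)
  qed auto
  then show ?thesis by (auto simp: F_def S2S2_def mem_Times_iff norm_eq_1)
qed

end

section \<open>Locally constant functions on manifolds\<close>

abbreviation "coords c \<equiv> snd c ` fst c"

lemma chart_inv_in: "x \<in> coords c \<Longrightarrow> chart_inv c x \<in> fst c" "x \<in> coords c \<Longrightarrow> snd c (chart_inv c x) = x"
  unfolding chart_inv_def by (simp_all add: inv_into_into f_inv_into_f)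

context
  fixes M :: "'a topology" and c :: "'a chart"
  assumes chart: "is_chart M c"
begin

lemma chart_subset: "fst c \<subseteq> topspace M" and open_coords: "open (coords c)" and chart_open: "openin M (fst c)"
  using chart openin_subset by (auto simp: is_chart_def)

lemma topspace_chart: "topspace (subtopology M (fst c)) = fst c"
  using chart_subset by (auto simp: topspace_subtopology)

lemma chart_inv_chart: "z \<in> fst c \<Longrightarrow> chart_inv c (snd c z) = z"
proof -
  have "inj_on (snd c) (fst c)"
    using chart homeomorphic_imp_injective_map topspace_chart unfolding is_chart_def by metis
  then show "z \<in> fst c \<Longrightarrow> chart_inv c (snd c z) = z" by (simp add: chart_inv_def inv_into_f_f)
qed

lemma openin_chart_preimage:
  assumes "open V" shows "openin M {z \<in> fst c. snd c z \<in> V}"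
proof -
  have "continuous_map (subtopology M (fst c)) (top_of_set (coords c)) (snd c)"
    using chart homeomorphic_imp_continuous_map unfolding is_chart_def by blast
  moreover have "openin (top_of_set (coords c)) (coords c \<inter> V)" using assms by blast
  ultimately have "openin (subtopology M (fst c)) {z \<in> fst c. snd c z \<in> coords c \<inter> V}"
    using openin_continuous_map_preimage[of "subtopology M (fst c)" "top_of_set (coords c)" "snd c" "coords c \<inter> V"]
    unfolding topspace_chart by blast
  moreover have "{z \<in> fst c. snd c z \<in> coords c \<inter> V} = {z \<in> fst c. snd c z \<in> V}" by blast
  ultimately have "openin (subtopology M (fst c)) {z \<in> fst c. snd c z \<in> V}" by (simp only:)
  then show ?thesis using openin_open_subtopology[OF chart_open] by blast
qed

lemma open_chart_image:
  assumes "openin M G" shows "open (snd c ` (G \<inter> fst c))"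
proof -
  have "open_map (subtopology M (fst c)) (top_of_set (coords c)) (snd c)"
    using chart homeomorphic_imp_open_map unfolding is_chart_def by blast
  moreover have "openin (subtopology M (fst c)) (G \<inter> fst c)" using assms openin_subtopology by blast
  ultimately have "openin (top_of_set (coords c)) (snd c ` (G \<inter> fst c))" unfolding open_map_def by blast
  then show ?thesis using openin_open_eq[OF open_coords] by blast
qed

end

definition locally_const_at :: "'a topology \<Rightarrow> ('a \<Rightarrow> 'b) \<Rightarrow> 'a \<Rightarrow> bool" where
  "locally_const_at M f z \<longleftrightarrow> (\<exists>G. openin M G \<and> z \<in> G \<and> (\<forall>w\<in>G. f w = f z))"

lemma locally_const_chartI:
  assumes c: "is_chart M c" and z: "z \<in> fst c" and V: "open V" "snd c z \<in> V"
    and f: "\<And>y. y \<in> V \<Longrightarrow> y \<in> coords c \<Longrightarrow> f (chart_inv c y) = f z"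
  shows "locally_const_at M f z"
  unfolding locally_const_at_def
proof (intro exI conjI ballI)
  show "openin M {z \<in> fst c. snd c z \<in> V}" by (rule openin_chart_preimage[OF c V(1)])
  show "z \<in> {z \<in> fst c. snd c z \<in> V}" using z V by simp
  show "f w = f z" if "w \<in> {z \<in> fst c. snd c z \<in> V}" for w
    using f[of "snd c w"] that chart_inv_chart[OF c, of w] by auto
qed

lemma locally_const_chartD:
  assumes c: "is_chart M c" and z: "z \<in> fst c" and f: "locally_const_at M f z"
  obtains V where "open V" "V \<subseteq> coords c" "snd c z \<in> V" "\<And>y. y \<in> V \<Longrightarrow> f (chart_inv c y) = f z"
proof -
  obtain G where G: "openin M G" "z \<in> G" "\<And>w. w \<in> G \<Longrightarrow> f w = f z"
    using f by (auto simp: locally_const_at_def)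
  show ?thesis
  proof (rule that[OF open_chart_image[OF c G(1)]])
    show "snd c ` (G \<inter> fst c) \<subseteq> coords c" "snd c z \<in> snd c ` (G \<inter> fst c)" using G(2) z by blast+
    fix y assume "y \<in> snd c ` (G \<inter> fst c)"
    then obtain w where "w \<in> G" "w \<in> fst c" "y = snd c w" by blast
    then show "f (chart_inv c y) = f z" using G(3) chart_inv_chart[OF c] by simp
  qed
qed

text \<open>All preimages under \<open>f\<close> are open, hence also closed, and connectedness
  leaves only everything or nothing. The value type is arbitrary; with truth values as values, this
  is how alternatives at points are decided globally.\<close>

lemma connected_locally_const:
  assumes M: "connected_space M" and f: "\<And>z. z \<in> topspace M \<Longrightarrow> locally_const_at M f z"
    and zw: "z \<in> topspace M" "w \<in> topspace M"
  shows "f w = f z"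
proof -
  have o: "openin M (topspace M \<inter> f -` P)" for P
  proof (rule openin_subopen[THEN iffD2], intro ballI)
    fix x assume x: "x \<in> topspace M \<inter> f -` P"
    then have "locally_const_at M f x" using f by simp
    then obtain G where G: "openin M G" "x \<in> G" "\<And>w. w \<in> G \<Longrightarrow> f w = f x"
      by (auto simp: locally_const_at_def)
    have "G \<subseteq> topspace M \<inter> f -` P"
    proof
      fix y assume y: "y \<in> G"
      then have "f y = f x" by (rule G(3))
      then show "y \<in> topspace M \<inter> f -` P" using x subsetD[OF openin_subset[OF G(1)] y] by simp
    qed
    with G(1,2) show "\<exists>G. openin M G \<and> x \<in> G \<and> G \<subseteq> topspace M \<inter> f -` P" by blast
  qed
  have e: "topspace M - topspace M \<inter> f -` {f z} = topspace M \<inter> f -` (- {f z})" by blast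
  have "closedin M (topspace M \<inter> f -` {f z})"
    unfolding closedin_def e by (intro conjI o Int_lower1)
  then have "topspace M \<inter> f -` {f z} = {} \<or> topspace M \<inter> f -` {f z} = topspace M"
    using M o[of "{f z}"] unfolding connected_space_clopen_in by simp
  moreover have "z \<in> topspace M \<inter> f -` {f z}" using zw by simp
  ultimately have "w \<in> topspace M \<inter> f -` {f z}" using zw(2) by (metis empty_iff)
  then show ?thesis by simp
qed

section \<open>Congruence\<close>

text \<open>A linear map is its own smooth extension to \<open>R6\<close> and its own derivative
  everywhere.\<close>

lemma isometry_orthogonal:
  assumes L: "orthogonal_transformation L" and S: "L ` S2S2 = S2S2"
  shows "isometry_S2S2 L"
  unfolding isometry_S2S2_def
proof (intro conjI exI)
  have bl: "bounded_linear L" using L linear_conv_bounded_linear by (auto simp: orthogonal_transformation_def)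
  have fd: "frechet_derivative L (at x) = L" for x
    by (rule frechet_derivative_eqI[OF bounded_linear_imp_has_derivative[OF bl]])
  show "bij_betw L S2S2 S2S2"
    using orthogonal_transformation_inj[OF L] S by (auto simp: bij_betw_def inj_on_def)
  show "S2S2 \<subseteq> UNIV" by simp
  show "smooth_on UNIV L" by (rule smooth_on_bounded_linear[OF bl])
  show "\<forall>x\<in>S2S2. L x = L x" by simp
  show "\<forall>x\<in>S2S2. \<forall>v\<in>tangent_S2S2 x. \<forall>w\<in>tangent_S2S2 x. fderiv L x v \<bullet> fderiv L x w = v \<bullet> w"
    using L unfolding fd orthogonal_transformation_def by blast
qed

lemma orthogonal_product_map:
  fixes R R' :: "real^3 \<Rightarrow> real^3"
  assumes "orthogonal_transformation R" "orthogonal_transformation R'"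
  shows "orthogonal_transformation (\<lambda>z. (R (fst z), R' (snd z)))" "(\<lambda>z. (R (fst z), R' (snd z))) ` S2S2 = S2S2"
proof -
  show "orthogonal_transformation (\<lambda>z. (R (fst z), R' (snd z)))"
    using assms unfolding orthogonal_transformation_def
    by (auto intro!: linearI simp: linear_add linear_scale inner_prod_def)
  have s: "F ` sphere 0 1 = sphere 0 1" if F: "orthogonal_transformation F" for F :: "real^3 \<Rightarrow> real^3"
  proof
    show "F ` sphere 0 1 \<subseteq> sphere 0 1" using orthogonal_transformation_norm[OF F] by auto
    show "sphere 0 1 \<subseteq> F ` sphere 0 1"
    proof
      fix y :: "real^3" assume "y \<in> sphere 0 1"
      moreover obtain x where "y = F x" using orthogonal_transformation_surj[OF F] by blast
      ultimately show "y \<in> F ` sphere 0 1" using orthogonal_transformation_norm[OF F] by auto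
    qed
  qed
  have "(\<lambda>z. (R (fst z), R' (snd z))) ` S2S2 = (R ` sphere 0 1) \<times> (R' ` sphere 0 1)"
    unfolding S2S2_def by (simp add: case_prod_unfold image_paired_Times[symmetric])
  then show "(\<lambda>z. (R (fst z), R' (snd z))) ` S2S2 = S2S2" by (simp add: s assms S2S2_def)
qed

lemma orthogonal_image_open:
  fixes L :: "R6 \<Rightarrow> R6"
  assumes L: "orthogonal_transformation L" and X: "X \<subseteq> Z"
    and V: "\<And>z. z \<in> X \<Longrightarrow> \<exists>V. open V \<and> z \<in> V \<and> V \<inter> Z \<subseteq> X"
  shows "openin (top_of_set (L ` Z)) (L ` X)"
proof -
  have bl: "bounded_linear L" using L linear_conv_bounded_linear by (auto simp: orthogonal_transformation_def)
  have oL: "open (L ` V)" if "open V" for V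
    by (rule open_surjective_linear_image[OF that bounded_linear.linear[OF bl] orthogonal_transformation_surj[OF L]])
  define G where "G = \<Union>{V. open V \<and> V \<inter> Z \<subseteq> X}"
  have G: "open G" unfolding G_def by (rule open_Union) simp
  have "G \<inter> Z \<subseteq> X" unfolding G_def by blast
  moreover have "X \<subseteq> G" unfolding G_def using V by blast
  ultimately have "X = Z \<inter> G" using X by blast
  then have "L ` X = L ` Z \<inter> L ` G"
    using image_Int[OF orthogonal_transformation_inj[OF L]] by blast
  then show ?thesis unfolding openin_open using oL[OF G] by (intro exI[of _ "L ` G"] conjI)
qed

section \<open>The product case\<close>

text \<open>Exchanging the factors commutes with the tangential projection; this transfers the case
  \<open>n = 0\<close> to the case \<open>m = 0\<close>.\<close>

lemma shape_trace_swap: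
  assumes f: "(f has_derivative f') (at x)" and g: "(g has_derivative g') (at x)"
  shows "shape_trace (\<lambda>y. prod.swap (f y)) (\<lambda>y. prod.swap (g y)) x = shape_trace f g x"
proof -
  have sw: "bounded_linear (prod.swap :: R6 \<Rightarrow> R6)"
    unfolding prod.swap_def by (intro bounded_linear_Pair bounded_linear_fst bounded_linear_snd)
  have d: "fderiv (\<lambda>y. prod.swap (h y)) x v = prod.swap (fderiv h x v)"
    if "(h has_derivative h') (at x)" for h :: "real^3 \<Rightarrow> R6" and h' v
    using frechet_derivative_eqI[OF bounded_linear.has_derivative[OF sw that]] frechet_derivative_eqI[OF that] by simp
  have t: "tangent_proj (prod.swap z) (prod.swap w) = prod.swap (tangent_proj z w)" for z w
    by (simp add: tangent_proj_def)
  have "prod.swap u = - prod.swap v \<longleftrightarrow> u = - v" for u v :: R6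
    by (cases u; cases v) auto
  then show ?thesis by (simp add: shape_trace_def d[OF f] d[OF g] t)
qed

lemma local_hypersurface_swap:
  "local_hypersurface U p q m n \<Longrightarrow> local_hypersurface U q p n m"
  unfolding local_hypersurface_def by (auto simp: add.commute)

context local_hypersurface begin

lemma immersion_pair:
  assumes x: "x \<in> U"
  shows "fderiv (\<lambda>y. (p y, q y)) x = (\<lambda>v. (fderiv p x v, fderiv q x v))"
    "linear (fderiv (\<lambda>y. (p y, q y)) x)" "inj (fderiv (\<lambda>y. (p y, q y)) x)"
proof -
  have df: "((\<lambda>y. (p y, q y)) has_derivative (\<lambda>v. (fderiv p x v, fderiv q x v))) (at x)"
    by (rule has_derivative_Pair[OF derivs(1)[OF x] derivs(2)[OF x]])
  then show e: "fderiv (\<lambda>y. (p y, q y)) x = (\<lambda>v. (fderiv p x v, fderiv q x v))" by (rule frechet_derivative_eqI)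
  show l: "linear (fderiv (\<lambda>y. (p y, q y)) x)" unfolding e using df has_derivative_linear by blast
  show "inj (fderiv (\<lambda>y. (p y, q y)) x)"
    using immersion[OF x] by (subst linear_injective_0[OF l]) (simp add: e zero_prod_def)
qed

lemma normal_unique_local:
  assumes x: "x \<in> U" and N: "N' \<in> tangent_S2S2 (p x, q x)" "norm N' = 1"
    and o: "\<And>v. fderiv (\<lambda>y. (p y, q y)) x v \<bullet> N' = 0"
  shows "N' = (N' \<bullet> (m x, n x)) *\<^sub>R (m x, n x)" "(N' \<bullet> (m x, n x))\<^sup>2 = 1"
proof -
  have "(p x, q x) \<in> S2S2" using unit[OF x] by (simp add: S2S2_def)
  moreover have "fderiv (\<lambda>y. (p y, q y)) x v \<in> tangent_S2S2 (p x, q x)" for v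
    using first_order[OF x] by (simp add: immersion_pair[OF x] tangent_S2S2_def)
  moreover have "(m x, n x) \<in> tangent_S2S2 (p x, q x)" using tangent[OF x] by (simp add: tangent_S2S2_def)
  moreover have "norm (m x, n x) = 1" using unit_normal[OF x] by (simp add: norm_Pair)
  moreover have "fderiv (\<lambda>y. (p y, q y)) x v \<bullet> (m x, n x) = 0" for v
    using normal[OF x] by (simp add: immersion_pair[OF x])
  ultimately show "N' = (N' \<bullet> (m x, n x)) *\<^sub>R (m x, n x)" "(N' \<bullet> (m x, n x))\<^sup>2 = 1"
    using unit_normal_unique[OF immersion_pair(2,3)[OF x], of "(p x, q x)" "(m x, n x)" N'] N o by blast+
qed

text \<open>With \<open>n = 0\<close> both \<open>p\<close> and \<open>m\<close> move only in the
  direction \<open>u\<close>, so the shape operator has rank at most one and its trace is its only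
  possible nonzero eigenvalue. Symmetry of the second derivatives of \<open>p\<close> makes the
  derivative of \<open>m\<close> a multiple of that of \<open>p\<close>, and the trace identifies
  the factor.\<close>

lemma product_shape:
  assumes n0: "\<And>y. y \<in> U \<Longrightarrow> n y = 0" and x: "x \<in> U"
    and V: "open V" "x \<in> V" and g: "\<And>y. y \<in> V \<Longrightarrow> g y = \<sigma> *\<^sub>R (m y, n y)" and \<sigma>: "\<sigma> * \<sigma> = 1"
  shows "fderiv m x v = (- \<sigma> * shape_trace (\<lambda>y. (p y, q y)) g x) *\<^sub>R fderiv p x v"
proof -
  have nm: "norm (m y) = 1" if "y \<in> U" for y
    using unit_normal[OF that] n0[OF that] by (simp add: power2_eq_1_iff) (smt (verit) norm_ge_zero)
  define u where "u = cross3 (p x) (m x)"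
  note fr = cross3_frame[OF unit(1)[OF x] nm[OF x] tangent(1)[OF x, unfolded inner_commute[of "m x"]], folded u_def]
  have uu: "u \<bullet> u = 1" using fr(1) by (simp add: norm_eq_1)
  have dpm: "fderiv p y v \<bullet> m y = 0" if "y \<in> U" for y v using normal[OF that, of v] n0[OF that] by simp
  define X Y where "X = covector (\<lambda>v. fderiv p x v \<bullet> u)" and "Y = covector (\<lambda>v. fderiv m x v \<bullet> u)"
  have l: "linear (\<lambda>v. L v \<bullet> w)" if "linear L" for L :: "real^3 \<Rightarrow> real^3" and w
    using that by (intro linearI) (simp_all add: linear_add linear_scale inner_add_left)
  have X: "X \<bullet> v = fderiv p x v \<bullet> u" and Y: "Y \<bullet> v = fderiv m x v \<bullet> u" for v
    unfolding X_def Y_def by (rule covector_inner l lins x)+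
  have dp: "fderiv p x v = (X \<bullet> v) *\<^sub>R u" for v
    using fr(4)[of "fderiv p x v"] by (simp add: first_order(1)[OF x] dpm[OF x] X)
  have dmp: "fderiv m x v \<bullet> p x = 0" for v
    using first_order(3)[OF x, of v] dpm[OF x, of v] by (simp add: inner_commute)
  have dmm: "fderiv m x v \<bullet> m x = 0" for v
    using first_order(5)[OF x, of v] n0[OF x] by simp
  have dm: "fderiv m x v = (Y \<bullet> v) *\<^sub>R u" for v
    using fr(4)[of "fderiv m x v"] by (simp add: dmp dmm Y)
  \<comment> \<open>Derivative of the orthogonality of \<open>fderiv p y v\<close> and
    \<open>m y\<close>. The term with the second derivative is symmetric in \<open>v\<close> and
    \<open>w\<close>, hence so is the other one.\<close>
  have "fderiv p x v \<bullet> fderiv m x w + fderiv (\<lambda>y. fderiv p y v) x w \<bullet> m x = 0" for v w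
    by (rule has_derivative_inner_const[OF U x smooth_on_has_derivative[OF smooth_on_fderiv[OF smooth(1)] x] derivs(3)[OF x] dpm])
  then have s0: "fderiv p x v \<bullet> fderiv m x w = fderiv p x w \<bullet> fderiv m x v" for v w
    using second_derivative_symmetric[OF smooth(1) x, of v w] by (metis add_right_cancel)
  have sym: "(X \<bullet> v) * (Y \<bullet> w) = (X \<bullet> w) * (Y \<bullet> v)" for v w
    using s0[of v w] by (simp add: dp dm uu mult.commute)
  obtain n2 where n2: "norm n2 = 1" "q x \<bullet> n2 = 0" using unit_orthogonal_exists by blast
  define u2 where "u2 = cross3 (q x) n2"
  note fr2 = cross3_frame[OF unit(2)[OF x] n2, folded u2_def]
  define Z1 Z2 where "Z1 = covector (\<lambda>v. fderiv q x v \<bullet> n2)" and "Z2 = covector (\<lambda>v. fderiv q x v \<bullet> u2)"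
  have Z: "Z1 \<bullet> v = fderiv q x v \<bullet> n2" "Z2 \<bullet> v = fderiv q x v \<bullet> u2" for v
    unfolding Z1_def Z2_def by (rule covector_inner l lins x)+
  have dq: "fderiv q x v = (Z1 \<bullet> v) *\<^sub>R n2 + (Z2 \<bullet> v) *\<^sub>R u2" for v
    using fr2(4)[of "fderiv q x v"] by (simp add: first_order(2)[OF x] Z)
  have nz: "triple X Z1 Z2 \<noteq> 0"
  proof
    assume "triple X Z1 Z2 = 0"
    then obtain w where "w \<noteq> 0" "X \<bullet> w = 0" "Z1 \<bullet> w = 0" "Z2 \<bullet> w = 0"
      using triple_zero_common_normal by blast
    then show False using immersion[OF x, of w] by (simp add: dp dq)
  qed
  define w0 where "w0 = cross3 Z1 Z2 /\<^sub>R triple X Z1 Z2"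
  have w0: "X \<bullet> w0 = 1" unfolding w0_def by (rule triple_dual[OF nz])
  define \<mu> where "\<mu> = Y \<bullet> w0"
  have YX: "Y = \<mu> *\<^sub>R X"
  proof (rule vector_eq_rdot[THEN iffD1], intro allI)
    fix w show "Y \<bullet> w = (\<mu> *\<^sub>R X) \<bullet> w"
      using sym[of w0 w] w0 by (simp add: \<mu>_def mult.commute)
  qed
  have g0: "(g has_derivative (\<lambda>v. \<sigma> *\<^sub>R (fderiv m x v, 0))) (at x)"
  proof (rule has_derivative_transform_within_open)
    show "((\<lambda>y. \<sigma> *\<^sub>R (m y, 0 :: real^3)) has_derivative (\<lambda>v. \<sigma> *\<^sub>R (fderiv m x v, 0))) (at x)"
      by (intro has_derivative_scaleR_right has_derivative_Pair derivs x has_derivative_const)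
    show "open (V \<inter> U)" "x \<in> V \<inter> U" using V U x by auto
    show "\<sigma> *\<^sub>R (m y, 0) = g y" if "y \<in> V \<inter> U" for y using g[of y] n0[of y] that by simp
  qed
  have tp: "tangent_proj (p x, q x) (fderiv g x v) = ((\<sigma> * (Y \<bullet> v)) *\<^sub>R u, 0)" for v
    by (simp add: frechet_derivative_eqI[OF g0] tangent_proj_def dmp) (simp add: dm)
  have u0: "\<alpha> *\<^sub>R u = - (\<beta> *\<^sub>R u) \<longleftrightarrow> \<alpha> = - \<beta>" for \<alpha> \<beta> :: real
    using uu by (metis inner_zero_left scaleR_cancel_right scaleR_minus_left zero_neq_one)
  have c0: "\<alpha> *\<^sub>R n2 + \<beta> *\<^sub>R u2 = 0 \<longleftrightarrow> \<alpha> = 0 \<and> \<beta> = 0" for \<alpha> \<beta> :: real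
    using orthonormal_combination_eq[OF n2(1) fr2(1), of \<alpha> \<beta> 0 0] fr2(3) by (simp add: inner_commute)
  \<comment> \<open>The normal has no part in the second factor, so the rows of \<open>Z1\<close>
    and \<open>Z2\<close> contribute nothing and only the row of \<open>Y\<close> survives in
    Jacobi's formula.\<close>
  have "shape_trace (\<lambda>y. (p y, q y)) g x * triple X Z1 Z2 =
      - (triple (\<sigma> *\<^sub>R Y) Z1 Z2 + triple X 0 Z2 + triple X Z1 0)"
    unfolding shape_trace_def
    by (rule trace_implicit_operator[OF _ nz]) (simp add: immersion_pair[OF x] tp dp dq u0 c0)
  also have "\<dots> = - \<sigma> * \<mu> * triple X Z1 Z2" by (simp add: triple_def YX)
  finally have "shape_trace (\<lambda>y. (p y, q y)) g x = - \<sigma> * \<mu>" using mult_right_cancel[OF nz] by blast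
  then have "- \<sigma> * shape_trace (\<lambda>y. (p y, q y)) g x = \<mu>" using \<sigma> by (simp add: mult.assoc[symmetric])
  then show ?thesis by (simp add: dm dp YX)
qed

end

text \<open>Since \<open>E\<close> is a unit vector orthogonal to the unit vector \<open>P\<close>,
  the relation \<open>E = \<xi> + l P\<close> puts \<open>P\<close> in the plane
  \<open>P \<bullet> \<xi> = - l\<close> and gives \<xi> the squared length
  \<open>1 + l\<^sup>2\<close>. An orthogonal map of the first factor makes this plane
  horizontal.\<close>

lemma product_case:
  fixes M :: "'a topology" and A :: "'a chart set" and P Q E G :: "'a \<Rightarrow> real^3" and l :: real
  assumes M: "connected_space M" "topspace M \<noteq> {}" and A: "smooth_atlas M A"
    and loc: "\<And>c. c \<in> A \<Longrightarrow> local_hypersurface (coords c) (\<lambda>x. P (chart_inv c x)) (\<lambda>x. Q (chart_inv c x))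
      (\<lambda>x. E (chart_inv c x)) (\<lambda>x. G (chart_inv c x))"
    and G0: "\<And>z. z \<in> topspace M \<Longrightarrow> G z = 0"
    and l: "\<And>c x v. c \<in> A \<Longrightarrow> x \<in> coords c \<Longrightarrow>
      fderiv (\<lambda>x. E (chart_inv c x)) x v = l *\<^sub>R fderiv (\<lambda>x. P (chart_inv c x)) x v"
  shows "\<exists>r\<in>{0<..1}. \<exists>L. orthogonal_transformation L \<and> L ` S2S2 = S2S2 \<and>
    openin (top_of_set (circle_S1 r \<times> sphere 0 1)) (L ` (\<lambda>z. (P z, Q z)) ` topspace M)"
proof -
  have ch: "is_chart M c" if "c \<in> A" for c using A that by (simp add: smooth_atlas_def)
  have cov: "\<exists>c\<in>A. z \<in> fst c" if "z \<in> topspace M" for z using A that by (auto simp: smooth_atlas_def)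
  have lc: "locally_const_at M (\<lambda>z. E z - l *\<^sub>R P z) z" if z: "z \<in> topspace M" for z
  proof -
    obtain c where c: "c \<in> A" "z \<in> fst c" using cov[OF z] by blast
    interpret local_hypersurface "coords c" "\<lambda>x. P (chart_inv c x)" "\<lambda>x. Q (chart_inv c x)" "\<lambda>x. E (chart_inv c x)" "\<lambda>x. G (chart_inv c x)"
      by (rule loc[OF c(1)])
    have "snd c z \<in> coords c" using c by auto
    then obtain e where e: "e > 0" "ball (snd c z) e \<subseteq> coords c" using U open_contains_ball by blast
    have "((\<lambda>x. E (chart_inv c x) - l *\<^sub>R P (chart_inv c x)) has_derivative (\<lambda>v. 0)) (at x within ball (snd c z) e)"
      if "x \<in> ball (snd c z) e" for x
    proof -
      have x: "x \<in> coords c" using e that by blast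
      have "((\<lambda>x. E (chart_inv c x) - l *\<^sub>R P (chart_inv c x)) has_derivative
        (\<lambda>v. fderiv (\<lambda>x. E (chart_inv c x)) x v - l *\<^sub>R fderiv (\<lambda>x. P (chart_inv c x)) x v)) (at x)"
        by (intro has_derivative_diff has_derivative_scaleR_right derivs x)
      then show ?thesis by (simp add: l[OF c(1) x] has_derivative_at_withinI)
    qed
    from has_derivative_zero_constant[OF convex_ball this]
    obtain k where k: "\<And>x. x \<in> ball (snd c z) e \<Longrightarrow> E (chart_inv c x) - l *\<^sub>R P (chart_inv c x) = k" by blast
    show ?thesis
      by (rule locally_const_chartI[OF ch[OF c(1)] c(2) open_ball centre_in_ball[THEN iffD2, OF e(1)]])
        (use k[of "snd c z"] k e(1) chart_inv_chart[OF ch[OF c(1)] c(2)] in auto)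
  qed
  obtain z0 where z0: "z0 \<in> topspace M" using M(2) by blast
  define \<xi> where "\<xi> = E z0 - l *\<^sub>R P z0"
  have xi: "E z = \<xi> + l *\<^sub>R P z" if "z \<in> topspace M" for z
    using connected_locally_const[OF M(1) lc z0 that] by (simp add: \<xi>_def algebra_simps)
  have pt: "norm (P z) = 1 \<and> norm (Q z) = 1 \<and> E z \<bullet> P z = 0 \<and> norm (E z) = 1 \<and> P z \<bullet> \<xi> = - l \<and>
      (\<exists>V. open V \<and> (P z, Q z) \<in> V \<and> (\<forall>y\<in>V. y \<in> S2S2 \<longrightarrow> fst y \<bullet> \<xi> = - l \<longrightarrow> y \<in> (\<lambda>z. (P z, Q z)) ` topspace M))"
    if z: "z \<in> topspace M" for z
  proof -
    obtain c where c: "c \<in> A" "z \<in> fst c" using cov[OF z] by blast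
    interpret local_hypersurface "coords c" "\<lambda>x. P (chart_inv c x)" "\<lambda>x. Q (chart_inv c x)" "\<lambda>x. E (chart_inv c x)" "\<lambda>x. G (chart_inv c x)"
      by (rule loc[OF c(1)])
    have x: "snd c z \<in> coords c" using c by auto
    have iz: "chart_inv c (snd c z) = z" by (rule chart_inv_chart[OF ch[OF c(1)] c(2)])
    have sub: "chart_inv c y \<in> topspace M" if "y \<in> coords c" for y
      using chart_inv_in(1)[OF that] chart_subset[OF ch[OF c(1)]] by blast
    have e: "P (chart_inv c y) \<bullet> \<xi> = - l" if "y \<in> coords c" for y
      using tangent(1)[OF that] unit(1)[OF that] xi[OF sub[OF that]]
      by (simp add: inner_add_right inner_commute norm_eq_1)
    have "\<exists>V. open V \<and> (P (chart_inv c (snd c z)), Q (chart_inv c (snd c z))) \<in> V \<and>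
      (\<forall>y\<in>V. y \<in> S2S2 \<longrightarrow> fst y \<bullet> (\<lambda>_. 0) (snd y) + fst y \<bullet> \<xi> = - l \<longrightarrow>
        y \<in> (\<lambda>y. (P (chart_inv c y), Q (chart_inv c y))) ` coords c)"
    \<comment> \<open>Here \<open>R = 0\<close>. As \<open>G = 0\<close>, the kernel condition
      concerns only \<open>E = \<xi> + l P\<close>, and both summands are orthogonal to
      \<open>w1\<close>.\<close>
    proof (rule level_set_open[OF x])
      show "linear (\<lambda>_::real^3. 0::real^3)" by (simp add: linear_iff)
      fix w1 w2 assume "w1 \<bullet> P (chart_inv c (snd c z)) = 0"
        "w1 \<bullet> 0 + P (chart_inv c (snd c z)) \<bullet> 0 + w1 \<bullet> \<xi> = 0"
      then show "w1 \<bullet> E (chart_inv c (snd c z)) + w2 \<bullet> G (chart_inv c (snd c z)) = 0"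
        using xi[OF z] G0[OF z] by (simp add: iz inner_add_right)
    qed (simp add: e)
    then obtain V where V: "open V" "(P z, Q z) \<in> V"
      "\<And>y. y \<in> V \<Longrightarrow> y \<in> S2S2 \<Longrightarrow> fst y \<bullet> \<xi> = - l \<Longrightarrow> y \<in> (\<lambda>y. (P (chart_inv c y), Q (chart_inv c y))) ` coords c"
      unfolding iz by auto
    have "y \<in> (\<lambda>z. (P z, Q z)) ` topspace M" if "y \<in> V" "y \<in> S2S2" "fst y \<bullet> \<xi> = - l" for y
      using V(3)[OF that] sub by blast
    with V(1,2) have "\<exists>V. open V \<and> (P z, Q z) \<in> V \<and>
        (\<forall>y\<in>V. y \<in> S2S2 \<longrightarrow> fst y \<bullet> \<xi> = - l \<longrightarrow> y \<in> (\<lambda>z. (P z, Q z)) ` topspace M)"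
      by (intro exI[of _ V] conjI ballI impI)
    moreover have "(norm (E z))\<^sup>2 = 1" using unit_normal[OF x] G0[OF z] by (simp add: iz)
    then have "norm (E z) = 1" using norm_ge_zero[of "E z"] by (simp add: power2_eq_1_iff)
    ultimately show ?thesis using unit[OF x] tangent[OF x] e[OF x] by (simp add: iz)
  qed
  have "\<xi> \<bullet> \<xi> = 1 + l\<^sup>2"
    using pt[OF z0] by (simp add: \<xi>_def inner_diff_left inner_diff_right norm_eq_1 inner_commute power2_eq_square)
  then have nxi: "norm \<xi> = sqrt (1 + l\<^sup>2)" by (simp add: norm_eq_sqrt_inner)
  define s where "s = sqrt (1 + l\<^sup>2)"
  have s: "s \<ge> 1" "s * s = 1 + l\<^sup>2" by (simp_all add: s_def)
  \<comment> \<open>The plane has distance \<open>\<bar>l\<bar> / s\<close> from the origin, and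
    \<open>1 - (l / s)^2 = 1 / s^2\<close>, so the circle cut out of the unit sphere has radius
    \<open>1 / s\<close>.\<close>
  define r where "r = 1 / s"
  have r: "r \<in> {0<..1}" using s(1) by (simp add: r_def)
  have r2: "sqrt (1 - r\<^sup>2) = \<bar>l\<bar> / s"
  proof -
    have "s * s \<noteq> 0" using s(1) by simp
    then have "1 - r\<^sup>2 = (s * s - 1) / (s * s)" by (simp add: r_def power2_eq_square diff_divide_distrib)
    also have "\<dots> = (\<bar>l\<bar> / s)\<^sup>2" unfolding s(2) by (simp add: power2_eq_square s(2))
    finally have "1 - r\<^sup>2 = (\<bar>l\<bar> / s)\<^sup>2" .
    moreover have "\<bar>l\<bar> / s \<ge> 0" using s(1) by simp
    ultimately show ?thesis by (simp only: real_sqrt_abs abs_of_nonneg)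
  qed
  \<comment> \<open>\<open>circle_S1\<close> lies at nonnegative height, so \<xi> is sent to the
    upper or the lower half of the axis according to the sign of \<open>l\<close>.\<close>
  define \<tau> :: real where "\<tau> = (if l \<le> 0 then 1 else - 1)"
  have nn: "norm \<xi> = norm ((\<tau> * s) *\<^sub>R axis 3 1 :: real^3)" using s(1) nxi by (simp add: \<tau>_def s_def)
  obtain R :: "real^3 \<Rightarrow> real^3" where R: "orthogonal_transformation R" "R \<xi> = (\<tau> * s) *\<^sub>R axis 3 1"
    by (rule orthogonal_transformation_exists[OF nn], rule that)
  have R3: "y \<bullet> \<xi> = \<tau> * s * R y $ 3" for y
  proof -
    have "y \<bullet> \<xi> = R y \<bullet> R \<xi>" using R(1) by (simp add: orthogonal_transformation_def)
    then show ?thesis unfolding R(2) by (simp add: inner_axis)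
  qed
  have lvl: "y \<bullet> \<xi> = - l \<longleftrightarrow> R y $ 3 = sqrt (1 - r\<^sup>2)" for y
  proof -
    have s0: "s \<noteq> 0" using s(1) by simp
    have "\<tau> * s * R y $ 3 = - l \<longleftrightarrow> R y $ 3 * s = \<bar>l\<bar>" unfolding \<tau>_def by (auto simp: mult.commute)
    also have "\<dots> \<longleftrightarrow> R y $ 3 = \<bar>l\<bar> / s" using s0 by (simp add: eq_divide_eq)
    finally show ?thesis unfolding R3 r2 .
  qed
  define L :: "R6 \<Rightarrow> R6" where "L = (\<lambda>z. (R (fst z), id (snd z)))"
  have oid: "orthogonal_transformation (id :: real^3 \<Rightarrow> real^3)" by (simp add: orthogonal_transformation_id id_def)
  note L = orthogonal_product_map[OF R(1) oid, folded L_def]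
  let ?Z = "{z \<in> S2S2. fst z \<bullet> \<xi> = - l}"
  have Z: "L ` ?Z = circle_S1 r \<times> sphere 0 1"
  proof
    show "L ` ?Z \<subseteq> circle_S1 r \<times> sphere 0 1"
      using L(2) by (auto simp: L_def circle_S1_def lvl S2S2_def orthogonal_transformation_norm[OF R(1)])
    show "circle_S1 r \<times> sphere 0 1 \<subseteq> L ` ?Z"
    proof
      fix y :: R6 assume y: "y \<in> circle_S1 r \<times> sphere 0 1"
      then have "y \<in> L ` S2S2" unfolding L(2) by (auto simp: circle_S1_def S2S2_def)
      then obtain z where "z \<in> S2S2" "y = L z" by blast
      then show "y \<in> L ` ?Z" using y by (auto simp: L_def circle_S1_def lvl)
    qed
  qed
  have "openin (top_of_set (L ` ?Z)) (L ` (\<lambda>z. (P z, Q z)) ` topspace M)"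
  proof (rule orthogonal_image_open[OF L(1)])
    show "(\<lambda>z. (P z, Q z)) ` topspace M \<subseteq> ?Z" using pt by (auto simp: S2S2_def)
    fix y assume "y \<in> (\<lambda>z. (P z, Q z)) ` topspace M"
    then obtain z where z: "z \<in> topspace M" "y = (P z, Q z)" by blast
    obtain V where V: "open V" "(P z, Q z) \<in> V"
      "\<forall>y\<in>V. y \<in> S2S2 \<longrightarrow> fst y \<bullet> \<xi> = - l \<longrightarrow> y \<in> (\<lambda>z. (P z, Q z)) ` topspace M"
      using pt[OF z(1)] by blast
    from V(3) have "V \<inter> ?Z \<subseteq> (\<lambda>z. (P z, Q z)) ` topspace M" by (intro subsetI) simp
    with V(1,2) z(2) show "\<exists>V. open V \<and> y \<in> V \<and> V \<inter> ?Z \<subseteq> (\<lambda>z. (P z, Q z)) ` topspace M"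
      by (intro exI[of _ V] conjI) simp_all
  qed
  then have "orthogonal_transformation L \<and> L ` S2S2 = S2S2 \<and>
      openin (top_of_set (circle_S1 r \<times> sphere 0 1)) (L ` (\<lambda>z. (P z, Q z)) ` topspace M)"
    using L unfolding Z by simp
  with r show ?thesis by (intro bexI[of _ r] exI[of _ L])
qed

section \<open>Parallel hypersurfaces of constant mean curvature\<close>

text \<open>\<open>exp_S2S2\<close> is evaluated at time 1 on a multiple of the normal. For negative
  \<open>t\<close> the norm drops the sign, and \<open>sgn\<close> brings it back.\<close>

lemma great_circle_scale: "great_circle p (t *\<^sub>R u) 1 = great_circle p u t"
proof (cases t "0 :: real" rule: linorder_cases)
  case less
  then have "norm (t *\<^sub>R u) = - (norm u * t)" "sgn (t *\<^sub>R u) = - sgn u"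
    by (simp_all add: sgn_scaleR)
  then show ?thesis by (simp add: great_circle_def)
qed (simp_all add: great_circle_def sgn_scaleR mult.commute)

lemma exp_great_circle:
  assumes "z \<in> S2S2" "v \<in> tangent_S2S2 z"
  shows "exp_S2S2 z (t *\<^sub>R v) = (great_circle (fst z) (fst v) t, great_circle (snd z) (snd v) t)"
proof -
  have "t *\<^sub>R v \<in> tangent_S2S2 z" using assms(2) by (simp add: tangent_S2S2_def)
  from exp_S2S2_eq[OF assms(1) this] show ?thesis
    using great_circle_scale[of "fst z" t "fst v"] great_circle_scale[of "snd z" t "snd v"]
    by (simp add: great_circle_def)
qed

lemma mean_curvature_coords:
  assumes c: "is_chart M c" and x: "x \<in> coords c"
    and F: "\<And>y. y \<in> coords c \<Longrightarrow> \<Phi> (chart_inv c y) = f y"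
  shows "mean_curvature c \<Phi> N (chart_inv c x) = shape_trace f (\<lambda>y. N (chart_inv c y)) x / 3"
proof -
  have 1: "frechet_derivative (\<lambda>y. \<Phi> (chart_inv c y)) (at x) = frechet_derivative f (at x)"
    by (rule frechet_derivative_cong_open[OF open_coords[OF c] x]) (simp add: F)
  show ?thesis
    unfolding mean_curvature_def shape_operator_def shape_trace_def chart_deriv_def
      chart_inv_in(2)[OF x] 1 F[OF x] comp_def ..
qed

lemma connected_square_one_const:
  fixes f :: "'a::topological_space \<Rightarrow> real"
  assumes "connected V" "continuous_on V f" "\<And>x. x \<in> V \<Longrightarrow> (f x)\<^sup>2 = 1" "x \<in> V" "y \<in> V"
  shows "f x = f y"
proof -
  have "f ` V \<subseteq> {1, -1}" using assms(3) by (auto simp: power2_eq_1_iff)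
  then have "finite (f ` V)" by (rule finite_subset) simp
  then have "f constant_on V" using continuous_finite_range_constant assms(1,2) by blast
  then show ?thesis using assms(4,5) by (metis constant_on_def)
qed

lemma trig_mix_scale: "trig_mix a b (\<lambda>i. k i / s) t = trig_mix a b k t / s"
  by (simp add: trig_mix_def divide_inverse algebra_simps)

text \<open>Constant mean curvature is an existence statement for each time, so \<open>N'\<close>
  and \<open>H\<close> are choices made separately for each \<open>t\<close>, with no continuity in
  \<open>t\<close> and no prescribed relation of \<open>N' t\<close> to \<open>N\<close>.\<close>

locale parallel_cmc =
  fixes M :: "'a topology" and A :: "'a chart set" and \<Phi> N :: "'a \<Rightarrow> R6" and \<epsilon> :: real
    and N' :: "real \<Rightarrow> 'a \<Rightarrow> R6" and H :: "real \<Rightarrow> real"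
  assumes hyp: "hypersurface M A \<Phi>" and con: "connected_space M" and ne: "topspace M \<noteq> {}"
    and nor: "unit_normal_field M A \<Phi> N" and eps: "\<epsilon> > 0"
    and parH: "\<And>t. t \<in> {-\<epsilon><..<\<epsilon>} \<Longrightarrow> hypersurface M A (parallel_hypersurface \<Phi> N t)"
    and nor': "\<And>t. t \<in> {-\<epsilon><..<\<epsilon>} \<Longrightarrow> unit_normal_field M A (parallel_hypersurface \<Phi> N t) (N' t)"
    and cmc: "\<And>t c z. t \<in> {-\<epsilon><..<\<epsilon>} \<Longrightarrow> c \<in> A \<Longrightarrow> z \<in> fst c \<Longrightarrow>
      mean_curvature c (parallel_hypersurface \<Phi> N t) (N' t) z = H t"
begin

definition "P z = fst (\<Phi> z)"
definition "Q z = snd (\<Phi> z)"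
definition "E z = fst (N z)"
definition "G z = snd (N z)"

definition "pc c x = P (chart_inv c x)"
definition "qc c x = Q (chart_inv c x)"
definition "mc c x = E (chart_inv c x)"
definition "nc c x = G (chart_inv c x)"

lemmas comp_defs = pc_def qc_def mc_def nc_def P_def Q_def E_def G_def

lemma atlas: "smooth_atlas M A" using hyp by (simp add: hypersurface_def smooth_3_manifold_def)

lemma chart: "c \<in> A \<Longrightarrow> is_chart M c" using atlas by (simp add: smooth_atlas_def)

lemma covered: assumes "z \<in> topspace M" obtains c where "c \<in> A" "z \<in> fst c"
proof -
  have "z \<in> (\<Union>c\<in>A. fst c)" using atlas assms unfolding smooth_atlas_def by (simp only:)
  then show thesis using that by blast
qed

lemma in_space: "c \<in> A \<Longrightarrow> x \<in> coords c \<Longrightarrow> chart_inv c x \<in> topspace M"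
  by (rule subsetD[OF chart_subset[OF chart] chart_inv_in(1)])

lemma local_coords:
  assumes c: "c \<in> A"
  shows "local_hypersurface (coords c) (pc c) (qc c) (mc c) (nc c)"
proof
  have s: "smooth_on (coords c) (\<lambda>x. \<Phi> (chart_inv c x))" "smooth_on (coords c) (\<lambda>x. N (chart_inv c x))"
    using hyp nor c by (simp_all add: hypersurface_def unit_normal_field_def smooth_map_def comp_def)
  show sm: "smooth_on (coords c) (pc c)" "smooth_on (coords c) (qc c)" "smooth_on (coords c) (mc c)" "smooth_on (coords c) (nc c)"
    unfolding comp_defs
    by (intro smooth_on_linear_image[OF bounded_linear_fst] smooth_on_linear_image[OF bounded_linear_snd] s)+
  show "open (coords c)" by (rule open_coords[OF chart[OF c]])
  fix x assume x: "x \<in> coords c"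
  have "\<Phi> (chart_inv c x) \<in> S2S2" using hyp in_space[OF c x] by (auto simp: hypersurface_def)
  then show "norm (pc c x) = 1" "norm (qc c x) = 1" by (auto simp: comp_defs S2S2_def mem_Times_iff)
  have N: "N (chart_inv c x) \<in> tangent_S2S2 (\<Phi> (chart_inv c x))" "norm (N (chart_inv c x)) = 1"
    using nor in_space[OF c x] by (auto simp: unit_normal_field_def)
  then show "mc c x \<bullet> pc c x = 0" "nc c x \<bullet> qc c x = 0" by (auto simp: comp_defs tangent_S2S2_def)
  show "(norm (mc c x))\<^sup>2 + (norm (nc c x))\<^sup>2 = 1"
    using N(2) by (cases "N (chart_inv c x)") (simp add: comp_defs norm_Pair)
  have "((\<lambda>x. (pc c x, qc c x)) has_derivative (\<lambda>v. (fderiv (pc c) x v, fderiv (qc c) x v))) (at x)"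
    by (rule has_derivative_Pair[OF smooth_on_has_derivative[OF sm(1) x] smooth_on_has_derivative[OF sm(2) x]])
  moreover have "(\<lambda>x. (pc c x, qc c x)) = \<Phi> \<circ> chart_inv c" by (simp add: fun_eq_iff comp_defs)
  ultimately have cd: "chart_deriv c \<Phi> (chart_inv c x) v = (fderiv (pc c) x v, fderiv (qc c) x v)" for v
    by (simp add: chart_deriv_def chart_inv_in(2)[OF x] frechet_derivative_eqI)
  fix v
  have "chart_deriv c \<Phi> (chart_inv c x) v \<bullet> N (chart_inv c x) = 0"
    using nor c chart_inv_in(1)[OF x] by (auto simp: unit_normal_field_def)
  then show "fderiv (pc c) x v \<bullet> mc c x + fderiv (qc c) x v \<bullet> nc c x = 0"
    unfolding cd by (simp add: inner_prod_def comp_defs)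
  assume "fderiv (pc c) x v = 0" "fderiv (qc c) x v = 0"
  moreover have "fderiv (pc c) x 0 = 0" "fderiv (qc c) x 0 = 0"
    using smooth_on_linear[OF sm(1) x] smooth_on_linear[OF sm(2) x] by (simp_all add: linear_0)
  moreover have "inj (chart_deriv c \<Phi> (chart_inv c x))"
    using hyp c chart_inv_in(1)[OF x] by (auto simp: hypersurface_def)
  ultimately show "v = 0" using cd by (metis injD)
qed

lemma parallel_eq:
  assumes "z \<in> topspace M"
  shows "parallel_hypersurface \<Phi> N t z = (great_circle (P z) (E z) t, great_circle (Q z) (G z) t)"
proof -
  have "\<Phi> z \<in> S2S2" "N z \<in> tangent_S2S2 (\<Phi> z)"
    using hyp nor assms by (auto simp: hypersurface_def unit_normal_field_def)
  then show ?thesis by (simp add: parallel_hypersurface_def exp_great_circle P_def Q_def E_def G_def)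
qed

text \<open>Where both components of the normal are nonzero this is 1 or - 1: the sign of the chosen
  normal against the velocity of the normal geodesics.\<close>

definition "side t z = N' t z \<bullet> (great_circle' (P z) (E z) t, great_circle' (Q z) (G z) t)"

abbreviation "par c t \<equiv> \<lambda>y. (great_circle (pc c y) (mc c y) t, great_circle (qc c y) (nc c y) t)"
abbreviation "par' c t \<equiv> \<lambda>y. (great_circle' (pc c y) (mc c y) t, great_circle' (qc c y) (nc c y) t)"

lemma parallel_coords:
  assumes "c \<in> A" "y \<in> coords c"
  shows "parallel_hypersurface \<Phi> N t (chart_inv c y) = par c t y"
  using parallel_eq[OF in_space[OF assms]] by (simp add: pc_def qc_def mc_def nc_def)

lemma fderiv_parallel:
  assumes c: "c \<in> A" and x: "x \<in> coords c"
  shows "chart_deriv c (parallel_hypersurface \<Phi> N t) (chart_inv c x) =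
    frechet_derivative (par c t) (at x)"
  unfolding chart_deriv_def chart_inv_in(2)[OF x]
  by (rule frechet_derivative_cong_open[OF open_coords[OF chart[OF c]] x]) (simp add: parallel_coords c)

lemma N'_props:
  assumes t: "t \<in> {-\<epsilon><..<\<epsilon>}" and c: "c \<in> A" and x: "x \<in> coords c"
  shows "N' t (chart_inv c x) \<in> tangent_S2S2 (par c t x)"
    "norm (N' t (chart_inv c x)) = 1"
    "fderiv (par c t) x v \<bullet> N' t (chart_inv c x) = 0"
    "inj (fderiv (par c t) x)"
    "smooth_on (coords c) (\<lambda>y. N' t (chart_inv c y))"
proof -
  note u = nor'[OF t, unfolded unit_normal_field_def, THEN conjunct2, THEN conjunct1, rule_format]
    and u' = nor'[OF t, unfolded unit_normal_field_def, THEN conjunct2, THEN conjunct2, rule_format]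
    and h = parH[OF t, unfolded hypersurface_def, THEN conjunct2, THEN conjunct2, THEN conjunct2, rule_format]
  have z: "chart_inv c x \<in> topspace M" "chart_inv c x \<in> fst c" using in_space[OF c x] chart_inv_in(1)[OF x] .
  show "N' t (chart_inv c x) \<in> tangent_S2S2 (par c t x)"
    unfolding parallel_coords[OF c x, symmetric] using u[OF z(1)] by simp
  show "norm (N' t (chart_inv c x)) = 1" using u[OF z(1)] by simp
  show "fderiv (par c t) x v \<bullet> N' t (chart_inv c x) = 0"
    unfolding fderiv_parallel[OF c x, symmetric] by (rule u'[OF c z(2)])
  show "inj (fderiv (par c t) x)"
    unfolding fderiv_parallel[OF c x, symmetric] by (rule h[OF c z(2)])
  show "smooth_on (coords c) (\<lambda>y. N' t (chart_inv c y))"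
    using nor'[OF t] c by (simp add: unit_normal_field_def smooth_map_def comp_def)
qed

text \<open>By the Gauss lemma contained in \<open>parallel_variation\<close>, the geodesic velocity
  is a unit normal of the parallel hypersurface, and unit normals are unique up to sign.\<close>

lemma N'_eq:
  assumes t: "t \<in> {-\<epsilon><..<\<epsilon>}" and c: "c \<in> A" and x: "x \<in> coords c" and nz: "mc c x \<noteq> 0" "nc c x \<noteq> 0"
  shows "N' t (chart_inv c x) = side t (chart_inv c x) *\<^sub>R par' c t x"
    "(side t (chart_inv c x))\<^sup>2 = 1"
proof -
  interpret local_hypersurface "coords c" "pc c" "qc c" "mc c" "nc c" by (rule local_coords[OF c])
  obtain D where pv: "parallel t x \<in> S2S2" "parallel_normal t x \<in> tangent_S2S2 (parallel t x)"
    "norm (parallel_normal t x) = 1" "\<And>v. fderiv (parallel t) x v \<in> tangent_S2S2 (parallel t x)"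
    "\<And>v. fderiv (parallel t) x v \<bullet> parallel_normal t x = 0"
    "(parallel t has_derivative fderiv (parallel t) x) (at x)" "(parallel_normal t has_derivative D) (at x)"
    by (rule parallel_variation[OF x nz, of t], rule that)
  have lin: "linear (fderiv (parallel t) x)" by (rule has_derivative_linear[OF pv(6)])
  have "side t (chart_inv c x) = N' t (chart_inv c x) \<bullet> parallel_normal t x"
    by (simp add: side_def pc_def qc_def mc_def nc_def)
  with unit_normal_unique[OF lin N'_props(4)[OF t c x] pv(1,4,2) N'_props(1)[OF t c x] pv(3) N'_props(2)[OF t c x] pv(5) N'_props(3)[OF t c x]]
  show "N' t (chart_inv c x) = side t (chart_inv c x) *\<^sub>R par' c t x"
    "(side t (chart_inv c x))\<^sup>2 = 1" by simp_all
qed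

lemma continuous_coords:
  assumes "c \<in> A"
  shows "continuous_on (coords c) (pc c)" "continuous_on (coords c) (qc c)"
    "continuous_on (coords c) (mc c)" "continuous_on (coords c) (nc c)"
proof -
  interpret local_hypersurface "coords c" "pc c" "qc c" "mc c" "nc c" by (rule local_coords[OF assms])
  show "continuous_on (coords c) (pc c)" "continuous_on (coords c) (qc c)"
    "continuous_on (coords c) (mc c)" "continuous_on (coords c) (nc c)"
    by (intro smooth_on_continuous smooth)+
qed

text \<open>The neighbourhood on which the signs are constant does not depend on \<open>t\<close>.\<close>

lemma side_locally_const:
  assumes c: "c \<in> A" and x: "x \<in> coords c" and nz: "mc c x \<noteq> 0" "nc c x \<noteq> 0"
  obtains V where "open V" "x \<in> V" "V \<subseteq> coords c" "\<And>y. y \<in> V \<Longrightarrow> mc c y \<noteq> 0 \<and> nc c y \<noteq> 0"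
    "\<And>t y. t \<in> {-\<epsilon><..<\<epsilon>} \<Longrightarrow> y \<in> V \<Longrightarrow> side t (chart_inv c y) = side t (chart_inv c x)"
proof -
  note cc = continuous_coords[OF c]
  have oc: "open (coords c)" by (rule open_coords[OF chart[OF c]])
  let ?S = "coords c \<inter> (\<lambda>y. (mc c y, nc c y)) -` ((- {0}) \<times> (- {0}))"
  have "open ?S"
    by (intro continuous_open_preimage oc continuous_on_Pair cc open_Times open_Compl closed_singleton)
  moreover have "x \<in> ?S" using x nz by simp
  ultimately obtain e where e: "e > 0" "ball x e \<subseteq> ?S" by (rule openE)
  have sub: "ball x e \<subseteq> coords c" using e(2) by blast
  have nzb: "mc c y \<noteq> 0" "nc c y \<noteq> 0" if "y \<in> ball x e" for y using e(2) that by auto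
  show ?thesis
  proof (rule that[of "ball x e"])
    show "open (ball x e)" "x \<in> ball x e" "ball x e \<subseteq> coords c" using e sub by auto
    show "mc c y \<noteq> 0 \<and> nc c y \<noteq> 0" if "y \<in> ball x e" for y using nzb[OF that] by simp
    fix t y assume t: "t \<in> {-\<epsilon><..<\<epsilon>}" and y: "y \<in> ball x e"
    have "continuous_on (coords c) (\<lambda>y. N' t (chart_inv c y) \<bullet> par' c t y)"
      unfolding great_circle'_def
      by (intro continuous_intros cc smooth_on_continuous N'_props(5)[OF t c x])
    then have "continuous_on (ball x e) (\<lambda>y. side t (chart_inv c y))"
      unfolding side_def pc_def qc_def mc_def nc_def by (rule continuous_on_subset) (rule sub)
    then show "side t (chart_inv c y) = side t (chart_inv c x)"
      by (rule connected_square_one_const[OF connected_ball]) (use y e N'_eq(2)[OF t c] sub nzb in auto)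
  qed
qed

abbreviation "volc c \<equiv> local_hypersurface.vol (pc c) (qc c) (mc c) (nc c)"

text \<open>The logarithmic derivative depends on the point only through the sign
  \<open>side\<close>; this makes the Jacobians at different points comparable.\<close>

lemma vol_ode:
  assumes c: "c \<in> A" and x: "x \<in> coords c" and nz: "mc c x \<noteq> 0" "nc c x \<noteq> 0" and t: "t \<in> {-\<epsilon><..<\<epsilon>}"
  shows "(volc c x has_real_derivative - (3 * side t (chart_inv c x) * H t) * volc c x t) (at t)" "volc c x t \<noteq> 0"
proof -
  interpret local_hypersurface "coords c" "pc c" "qc c" "mc c" "nc c" by (rule local_coords[OF c])
  obtain V where V: "open V" "x \<in> V" "V \<subseteq> coords c" "\<And>y. y \<in> V \<Longrightarrow> mc c y \<noteq> 0 \<and> nc c y \<noteq> 0"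
    "\<And>t y. t \<in> {-\<epsilon><..<\<epsilon>} \<Longrightarrow> y \<in> V \<Longrightarrow> side t (chart_inv c y) = side t (chart_inv c x)"
    by (rule side_locally_const[OF c x nz], rule that)
  have g: "N' t (chart_inv c y) = side t (chart_inv c x) *\<^sub>R parallel_normal t y" if "y \<in> V" for y
    using N'_eq(1)[OF t c] V(3,4,5) t that by auto
  note st = shape_trace_parallel[OF x nz N'_props(4)[OF t c x] V(1,2) g N'_eq(2)[OF t c x nz]]
  have "shape_trace (parallel t) (\<lambda>y. N' t (chart_inv c y)) x = 3 * H t"
    using mean_curvature_coords[where f="parallel t" and \<Phi>="parallel_hypersurface \<Phi> N t" and N="N' t",
        OF chart[OF c] x parallel_coords[OF c]]
      cmc[OF t c chart_inv_in(1)[OF x]] by simp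
  then show "(volc c x has_real_derivative - (3 * side t (chart_inv c x) * H t) * volc c x t) (at t)"
    using st(1) by (simp add: mult.assoc mult.left_commute)
  show "volc c x t \<noteq> 0" by (rule st(2))
qed

lemma vol_ratio_eq:
  assumes c: "c \<in> A" "x \<in> coords c" "mc c x \<noteq> 0" "nc c x \<noteq> 0"
    and d: "d \<in> A" "y \<in> coords d" "mc d y \<noteq> 0" "nc d y \<noteq> 0"
    and s: "\<And>t. t \<in> {-\<epsilon><..<\<epsilon>} \<Longrightarrow> side t (chart_inv c x) = side t (chart_inv d y)"
    and t: "t \<in> {-\<epsilon><..<\<epsilon>}"
  shows "volc c x t / volc c x 0 = volc d y t / volc d y 0"
proof -
  have 0: "0 \<in> {-\<epsilon><..<\<epsilon>}" using eps by simp
  let ?h = "\<lambda>t. - (3 * side t (chart_inv c x) * H t)"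
  show ?thesis
  proof (rule logarithmic_derivative_unique[OF eps, where h="?h" and f="\<lambda>t. volc c x t / volc c x 0"
      and g="\<lambda>t. volc d y t / volc d y 0"])
    fix t assume t: "t \<in> {-\<epsilon><..<\<epsilon>}"
    show "((\<lambda>t. volc c x t / volc c x 0) has_real_derivative ?h t * (volc c x t / volc c x 0)) (at t)"
      using DERIV_cdivide[OF vol_ode(1)[OF c t], of "volc c x 0"] by simp
    show "((\<lambda>t. volc d y t / volc d y 0) has_real_derivative ?h t * (volc d y t / volc d y 0)) (at t)"
      using DERIV_cdivide[OF vol_ode(1)[OF d t], of "volc d y 0"] s[OF t] by simp
    show "volc d y t / volc d y 0 \<noteq> 0" using vol_ode(2)[OF d t] vol_ode(2)[OF d 0] by simp
  qed (use vol_ode(2)[OF c 0] vol_ode(2)[OF d 0] t in auto)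
qed

definition "angle_product z = (norm (E z))\<^sup>2 * (norm (G z))\<^sup>2"

lemma angle_product_eq:
  assumes c: "c \<in> A" "x \<in> coords c" "mc c x \<noteq> 0" "nc c x \<noteq> 0"
    and d: "d \<in> A" "x' \<in> coords d" "mc d x' \<noteq> 0" "nc d x' \<noteq> 0"
    and s: "\<And>t. t \<in> {-\<epsilon><..<\<epsilon>} \<Longrightarrow> side t (chart_inv c x) = side t (chart_inv d x')"
  shows "angle_product (chart_inv c x) = angle_product (chart_inv d x')"
proof -
  interpret C: local_hypersurface "coords c" "pc c" "qc c" "mc c" "nc c" by (rule local_coords[OF c(1)])
  interpret D: local_hypersurface "coords d" "pc d" "qc d" "mc d" "nc d" by (rule local_coords[OF d(1)])
  obtain k where k: "volc c x = trig_mix (norm (mc c x)) (norm (nc c x)) k" using C.vol_trig_mix[of x] by blast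
  obtain l where l: "volc d x' = trig_mix (norm (mc d x')) (norm (nc d x')) l" using D.vol_trig_mix[of x'] by blast
  have 0: "0 \<in> {-\<epsilon><..<\<epsilon>}" using eps by simp
  \<comment> \<open>At time 0 only the first coefficient of the mix survives, and it is the nonzero
    Jacobian there.\<close>
  have "k 0 \<noteq> 0" using vol_ode(2)[OF c 0] unfolding k by (simp add: trig_mix_def)
  then have "k 0 / volc c x 0 \<noteq> 0" using vol_ode(2)[OF c 0] by simp
  moreover have "trig_mix (norm (mc c x)) (norm (nc c x)) (\<lambda>i. k i / volc c x 0) t
      = trig_mix (norm (mc d x')) (norm (nc d x')) (\<lambda>i. l i / volc d x' 0) t" if "t \<in> {-\<epsilon><..<\<epsilon>}" for t
    using vol_ratio_eq[OF c d s that] unfolding trig_mix_scale k[symmetric] l[symmetric] .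
  ultimately have "(norm (mc c x))\<^sup>2 * (norm (nc c x))\<^sup>2 = (norm (mc d x'))\<^sup>2 * (norm (nc d x'))\<^sup>2"
    by (intro trig_mix_frequencies[OF C.unit_normal[OF c(2)] D.unit_normal[OF d(2)] eps])
  then show ?thesis by (simp add: angle_product_def mc_def nc_def)
qed

lemma angle_product_zero_iff:
  "angle_product (chart_inv c x) = 0 \<longleftrightarrow> mc c x = 0 \<or> nc c x = 0"
  by (simp add: angle_product_def mc_def nc_def)

text \<open>The frame is missing where the product vanishes, so Jacobians cannot be compared there.
  Instead one nonzero value is fixed, and the condition of taking this value is locally constant: at
  points with nonzero product by comparing Jacobians, at zeros by continuity, since nearby values
  stay away from it.\<close>

lemma angle_product_const: assumes z: "z \<in> topspace M" "w \<in> topspace M" shows "angle_product z = angle_product w"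
proof (rule ccontr)
  assume "angle_product z \<noteq> angle_product w"
  then obtain z0 where z0: "z0 \<in> topspace M" "angle_product z0 \<noteq> 0" and z1: "\<exists>z1\<in>topspace M. angle_product z1 \<noteq> angle_product z0" using z by metis
  have "locally_const_at M (\<lambda>z. angle_product z = angle_product z0) z" if z: "z \<in> topspace M" for z
  proof -
    obtain c where c: "c \<in> A" "z \<in> fst c" using covered[OF z] .
    let ?x = "snd c z"
    have x: "?x \<in> coords c" using c by auto
    have iz: "chart_inv c ?x = z" by (rule chart_inv_chart[OF chart[OF c(1)] c(2)])
    show ?thesis
    proof (cases "angle_product z = 0")
      case False
      then have nz: "mc c ?x \<noteq> 0" "nc c ?x \<noteq> 0" using angle_product_zero_iff[of c ?x] by (simp_all add: iz)
      obtain V where V: "open V" "?x \<in> V" "V \<subseteq> coords c" "\<And>y. y \<in> V \<Longrightarrow> mc c y \<noteq> 0 \<and> nc c y \<noteq> 0"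
        "\<And>t y. t \<in> {-\<epsilon><..<\<epsilon>} \<Longrightarrow> y \<in> V \<Longrightarrow> side t (chart_inv c y) = side t (chart_inv c ?x)"
        by (rule side_locally_const[OF c(1) x nz], rule that)
      have "angle_product (chart_inv c v) = angle_product (chart_inv c ?x)" if "v \<in> V" for v
        by (rule angle_product_eq[OF c(1) subsetD[OF V(3) that] conjunct1[OF V(4)[OF that]] conjunct2[OF V(4)[OF that]] c(1) x nz V(5)[OF _ that]])
      then show ?thesis
        by (intro locally_const_chartI[OF chart[OF c(1)] c(2) V(1,2)]) (simp only: iz)
    next
      case True
      have cy: "continuous_on (coords c) (\<lambda>v. angle_product (chart_inv c v))"
        using continuous_coords[OF c(1)] unfolding angle_product_def mc_def nc_def by (intro continuous_intros)
      have o: "open (coords c \<inter> (\<lambda>v. angle_product (chart_inv c v)) -` (- {angle_product z0}))"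
        by (intro continuous_open_preimage cy open_coords[OF chart[OF c(1)]] open_Compl closed_singleton)
      show ?thesis
      proof (rule locally_const_chartI[OF chart[OF c(1)] c(2) o])
        show "?x \<in> coords c \<inter> (\<lambda>v. angle_product (chart_inv c v)) -` (- {angle_product z0})" using x True z0(2) by (simp add: iz)
        fix v assume "v \<in> coords c \<inter> (\<lambda>v. angle_product (chart_inv c v)) -` (- {angle_product z0})"
        then show "(angle_product (chart_inv c v) = angle_product z0) = (angle_product z = angle_product z0)" using True z0(2) by simp
      qed
    qed
  qed
  from connected_locally_const[OF con this z0(1)] z1 show False by auto
qed

lemma unit_EG:
  assumes "z \<in> topspace M" shows "(norm (E z))\<^sup>2 + (norm (G z))\<^sup>2 = 1"
proof -
  have "norm (N z) = 1" using nor assms unfolding unit_normal_field_def by blast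
  moreover have "norm (N z) = sqrt ((norm (E z))\<^sup>2 + (norm (G z))\<^sup>2)" unfolding E_def G_def by (rule norm_prod_def)
  ultimately show ?thesis by simp
qed

text \<open>Since \<open>norm (E z)\<^sup>2 + norm (G z)\<^sup>2 = 1\<close>, each summand takes at most two values once the product is constant.\<close>

lemma norm_E_const: assumes "z \<in> topspace M" "w \<in> topspace M" shows "norm (E w) = norm (E z)"
proof -
  let ?a = "norm (E z)" and ?b = "norm (G z)"
  have sq: "(norm (E w))\<^sup>2 \<in> {?a\<^sup>2, ?b\<^sup>2}" if "w \<in> topspace M" for w
  proof -
    \<comment> \<open>A quadratic polynomial with roots \<open>?a\<^sup>2\<close> and
      \<open>?b\<^sup>2\<close>; its coefficients are the sum 1 and the product, which is the same
      at all points.\<close>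
    have "((norm (E w))\<^sup>2 - ?a\<^sup>2) * ((norm (E w))\<^sup>2 - ?b\<^sup>2)
      = (norm (E w))\<^sup>2 * ((norm (E w))\<^sup>2 - (?a\<^sup>2 + ?b\<^sup>2)) + ?a\<^sup>2 * ?b\<^sup>2" by (simp add: algebra_simps)
    also have "\<dots> = (norm (E w))\<^sup>2 * ((norm (E w))\<^sup>2 - ((norm (E w))\<^sup>2 + (norm (G w))\<^sup>2)) + angle_product z"
      unfolding unit_EG[OF assms(1)] unit_EG[OF that] by (simp add: angle_product_def)
    also have "\<dots> = angle_product z - angle_product w" by (simp add: angle_product_def algebra_simps)
    finally show ?thesis using angle_product_const[OF assms(1) that] by auto
  qed
  have "locally_const_at M (\<lambda>w. norm (E w)) w" if w: "w \<in> topspace M" for w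
  proof -
    obtain c where c: "c \<in> A" "w \<in> fst c" using covered[OF w] .
    have x: "snd c w \<in> coords c" using c by auto
    have iw: "chart_inv c (snd c w) = w" by (rule chart_inv_chart[OF chart[OF c(1)] c(2)])
    obtain e where e: "e > 0" "ball (snd c w) e \<subseteq> coords c"
      using open_coords[OF chart[OF c(1)]] x open_contains_ball by blast
    have ce: "continuous_on (ball (snd c w) e) (\<lambda>v. norm (E (chart_inv c v)))"
      using continuous_on_subset[OF continuous_coords(3)[OF c(1)] e(2)] unfolding mc_def by (intro continuous_intros)
    have "norm (E (chart_inv c v)) \<in> {?a, ?b}" if "v \<in> ball (snd c w) e" for v
    proof -
      have "chart_inv c v \<in> topspace M" using in_space[OF c(1)] e(2) that by blast
      then have "(norm (E (chart_inv c v)))\<^sup>2 \<in> {?a\<^sup>2, ?b\<^sup>2}" by (rule sq)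
      then show ?thesis by (auto simp: power2_eq_iff_nonneg)
    qed
    then have "(\<lambda>v. norm (E (chart_inv c v))) ` ball (snd c w) e \<subseteq> {?a, ?b}" by blast
    then have "finite ((\<lambda>v. norm (E (chart_inv c v))) ` ball (snd c w) e)" by (rule finite_subset) simp
    then have "(\<lambda>v. norm (E (chart_inv c v))) constant_on ball (snd c w) e"
      using continuous_finite_range_constant[OF connected_ball ce] by blast
    then obtain k where k: "\<And>v. v \<in> ball (snd c w) e \<Longrightarrow> norm (E (chart_inv c v)) = k" by (auto simp: constant_on_def)
    then show ?thesis
      by (intro locally_const_chartI[OF chart[OF c(1)] c(2) open_ball centre_in_ball[THEN iffD2, OF e(1)]])
        (use k[of "snd c w"] e(1) iw in auto)
  qed
  from connected_locally_const[OF con this assms] show ?thesis .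
qed

lemma norm_G_const: assumes "z \<in> topspace M" "w \<in> topspace M" shows "norm (G w) = norm (G z)"
proof -
  have "(norm (G w))\<^sup>2 = (norm (G z))\<^sup>2"
    using unit_EG[OF assms(1)] unit_EG[OF assms(2)] unfolding norm_E_const[OF assms] by linarith
  then show ?thesis by simp
qed

end

section \<open>One component of the normal vanishes\<close>

lemma image_swap_S2S2: "prod.swap ` S2S2 = S2S2"
  by (auto simp: S2S2_def image_iff)

lemma orthogonal_swap: "orthogonal_transformation (prod.swap :: R6 \<Rightarrow> R6)"
  unfolding orthogonal_transformation_def by (auto intro!: linearI simp: inner_prod_def)

context parallel_cmc begin

lemma image_Phi: "(\<lambda>z. (P z, Q z)) ` topspace M = \<Phi> ` topspace M"
  by (simp add: P_def Q_def)

text \<open>The same sign as \<open>side 0\<close>, treated anew because \<open>N'_eq\<close> rests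
  on the frame and asks for both components of the normal to be nonzero.\<close>

definition "side0 z = N' 0 z \<bullet> N z"

lemma N'_0:
  assumes c: "c \<in> A" and x: "x \<in> coords c"
  shows "N' 0 (chart_inv c x) = side0 (chart_inv c x) *\<^sub>R (mc c x, nc c x)" "(side0 (chart_inv c x))\<^sup>2 = 1"
proof -
  interpret local_hypersurface "coords c" "pc c" "qc c" "mc c" "nc c" by (rule local_coords[OF c])
  have 0: "0 \<in> {-\<epsilon><..<\<epsilon>}" using eps by simp
  have g: "great_circle p u 0 = p" for p u :: "real^3" by (simp add: great_circle_def)
  have "side0 (chart_inv c x) = N' 0 (chart_inv c x) \<bullet> (mc c x, nc c x)"
    by (simp add: side0_def mc_def nc_def E_def G_def)
  then show "N' 0 (chart_inv c x) = side0 (chart_inv c x) *\<^sub>R (mc c x, nc c x)" "(side0 (chart_inv c x))\<^sup>2 = 1"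
    using normal_unique_local[OF x N'_props(1,2,3)[OF 0 c x, unfolded g]] by simp_all
qed

lemma side0_const: assumes "z \<in> topspace M" "w \<in> topspace M" shows "side0 w = side0 z"
proof (rule connected_locally_const[OF con _ assms])
  fix z assume z: "z \<in> topspace M"
  obtain c where c: "c \<in> A" "z \<in> fst c" by (rule covered[OF z])
  have x: "snd c z \<in> coords c" using c by auto
  have iz: "chart_inv c (snd c z) = z" by (rule chart_inv_chart[OF chart[OF c(1)] c(2)])
  obtain e where e: "e > 0" "ball (snd c z) e \<subseteq> coords c"
    using open_coords[OF chart[OF c(1)]] x by (rule openE)
  have 0: "0 \<in> {-\<epsilon><..<\<epsilon>}" using eps by simp
  have "continuous_on (coords c) (\<lambda>y. N' 0 (chart_inv c y) \<bullet> (mc c y, nc c y))"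
    by (intro continuous_intros continuous_coords[OF c(1)] smooth_on_continuous N'_props(5)[OF 0 c(1) x])
  then have "continuous_on (coords c) (\<lambda>y. side0 (chart_inv c y))"
    by (simp add: side0_def mc_def nc_def E_def G_def)
  then have cb: "continuous_on (ball (snd c z) e) (\<lambda>y. side0 (chart_inv c y))"
    using e(2) continuous_on_subset by blast
  have "side0 (chart_inv c y) = side0 (chart_inv c (snd c z))" if "y \<in> ball (snd c z) e" for y
    by (rule connected_square_one_const[OF connected_ball cb N'_0(2)[OF c(1)] that centre_in_ball[THEN iffD2, OF e(1)]])
      (rule subsetD[OF e(2)])
  then show "locally_const_at M side0 z"
    by (intro locally_const_chartI[OF chart[OF c(1)] c(2) open_ball centre_in_ball[THEN iffD2, OF e(1)]]) (simp only: iz)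
qed

lemma shape_trace_0:
  assumes c: "c \<in> A" and x: "x \<in> coords c"
  shows "shape_trace (\<lambda>y. (pc c y, qc c y)) (\<lambda>y. N' 0 (chart_inv c y)) x = 3 * H 0"
proof -
  have 0: "0 \<in> {-\<epsilon><..<\<epsilon>}" using eps by simp
  have f: "parallel_hypersurface \<Phi> N 0 (chart_inv c y) = (pc c y, qc c y)" if "y \<in> coords c" for y
    using parallel_coords[OF c that, of 0] by (simp add: great_circle_def)
  show ?thesis
    using mean_curvature_coords[where f="\<lambda>y. (pc c y, qc c y)" and \<Phi>="parallel_hypersurface \<Phi> N 0" and N="N' 0",
        OF chart[OF c] x f] cmc[OF 0 c chart_inv_in(1)[OF x]] by simp
qed

lemma product_result1:
  assumes G0: "\<And>z. z \<in> topspace M \<Longrightarrow> G z = 0"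
  shows "\<exists>r\<in>{0<..1}. \<exists>W. openin (top_of_set (circle_S1 r \<times> sphere 0 1)) W \<and> congruent_S2S2 (\<Phi> ` topspace M) W"
proof -
  obtain z0 where z0: "z0 \<in> topspace M" using ne by blast
  \<comment> \<open>The factor is the same in all charts because the sign \<open>side0\<close> is
    constant on the connected manifold.\<close>
  have l: "fderiv (\<lambda>x. E (chart_inv c x)) x v = (- side0 z0 * (3 * H 0)) *\<^sub>R fderiv (\<lambda>x. P (chart_inv c x)) x v"
    if c: "c \<in> A" and x: "x \<in> coords c" for c x v
  proof -
    interpret local_hypersurface "coords c" "pc c" "qc c" "mc c" "nc c" by (rule local_coords[OF c])
    have n0: "nc c y = 0" if "y \<in> coords c" for y using G0[OF in_space[OF c that]] by (simp add: nc_def)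
    have g: "N' 0 (chart_inv c y) = side0 z0 *\<^sub>R (mc c y, nc c y)" if "y \<in> coords c" for y
      using N'_0(1)[OF c that] side0_const[OF z0 in_space[OF c that]] by simp
    have s: "side0 z0 * side0 z0 = 1"
      using N'_0(2)[OF c x] side0_const[OF z0 in_space[OF c x]] by (simp add: power2_eq_square)
    show ?thesis
      using product_shape[where g="\<lambda>y. N' 0 (chart_inv c y)", OF n0 x U x g s, of v]
      unfolding shape_trace_0[OF c x] by (simp add: mc_def[abs_def] pc_def[abs_def])
  qed
  have "\<exists>r\<in>{0<..1}. \<exists>L. orthogonal_transformation L \<and> L ` S2S2 = S2S2 \<and>
    openin (top_of_set (circle_S1 r \<times> sphere 0 1)) (L ` (\<lambda>z. (P z, Q z)) ` topspace M)"
    by (rule product_case[OF con ne atlas _ G0 l])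
      (use local_coords in \<open>simp_all add: pc_def[abs_def] qc_def[abs_def] mc_def[abs_def] nc_def[abs_def]\<close>)
  then obtain r L where r: "r \<in> {0<..1}" and L: "orthogonal_transformation L" "L ` S2S2 = S2S2"
    "openin (top_of_set (circle_S1 r \<times> sphere 0 1)) (L ` \<Phi> ` topspace M)" unfolding image_Phi by blast
  have "congruent_S2S2 (\<Phi> ` topspace M) (L ` \<Phi> ` topspace M)"
    unfolding congruent_S2S2_def using isometry_orthogonal[OF L(1,2)] by blast
  with r L(3) show ?thesis by blast
qed

text \<open>The factors are exchanged before \<open>product_case\<close> is applied, and the
  exchange, an isometry of \<open>S2S2\<close>, is composed with the resulting map.\<close>

lemma product_result2:
  assumes E0: "\<And>z. z \<in> topspace M \<Longrightarrow> E z = 0"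
  shows "\<exists>r\<in>{0<..1}. \<exists>W. openin (top_of_set (circle_S1 r \<times> sphere 0 1)) W \<and> congruent_S2S2 (\<Phi> ` topspace M) W"
proof -
  obtain z0 where z0: "z0 \<in> topspace M" using ne by blast
  have l: "fderiv (\<lambda>x. G (chart_inv c x)) x v = (- side0 z0 * (3 * H 0)) *\<^sub>R fderiv (\<lambda>x. Q (chart_inv c x)) x v"
    if c: "c \<in> A" and x: "x \<in> coords c" for c x v
  proof -
    interpret local_hypersurface "coords c" "qc c" "pc c" "nc c" "mc c"
      by (rule local_hypersurface_swap[OF local_coords[OF c]])
    have n0: "mc c y = 0" if "y \<in> coords c" for y using E0[OF in_space[OF c that]] by (simp add: mc_def)
    have g: "prod.swap (N' 0 (chart_inv c y)) = side0 z0 *\<^sub>R (nc c y, mc c y)" if "y \<in> coords c" for y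
      using N'_0(1)[OF c that] side0_const[OF z0 in_space[OF c that]] by simp
    have s: "side0 z0 * side0 z0 = 1"
      using N'_0(2)[OF c x] side0_const[OF z0 in_space[OF c x]] by (simp add: power2_eq_square)
    have 0: "0 \<in> {-\<epsilon><..<\<epsilon>}" using eps by simp
    have "shape_trace (\<lambda>y. (qc c y, pc c y)) (\<lambda>y. prod.swap (N' 0 (chart_inv c y))) x = 3 * H 0"
      using shape_trace_swap[OF has_derivative_Pair[OF derivs(2)[OF x] derivs(1)[OF x]]
          smooth_on_has_derivative[OF N'_props(5)[OF 0 c x] x]] shape_trace_0[OF c x] by simp
    then show ?thesis
      using product_shape[where g="\<lambda>y. prod.swap (N' 0 (chart_inv c y))", OF n0 x U x g s, of v]
      by (simp add: nc_def[abs_def] qc_def[abs_def])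
  qed
  have "\<exists>r\<in>{0<..1}. \<exists>L. orthogonal_transformation L \<and> L ` S2S2 = S2S2 \<and>
    openin (top_of_set (circle_S1 r \<times> sphere 0 1)) (L ` (\<lambda>z. (Q z, P z)) ` topspace M)"
    by (rule product_case[OF con ne atlas _ E0 l])
      (use local_hypersurface_swap[OF local_coords] in \<open>simp_all add: pc_def[abs_def] qc_def[abs_def] mc_def[abs_def] nc_def[abs_def]\<close>)
  then obtain r L where r: "r \<in> {0<..1}" and L: "orthogonal_transformation L" "L ` S2S2 = S2S2"
    "openin (top_of_set (circle_S1 r \<times> sphere 0 1)) (L ` (\<lambda>z. (Q z, P z)) ` topspace M)" by blast
  have sw: "(\<lambda>z. (Q z, P z)) ` topspace M = prod.swap ` \<Phi> ` topspace M"
    unfolding image_Phi[symmetric] by (simp add: image_image)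
  have e: "L ` (\<lambda>z. (Q z, P z)) ` topspace M = (L \<circ> prod.swap) ` \<Phi> ` topspace M"
    unfolding sw by (simp add: image_image)
  have "orthogonal_transformation (L \<circ> prod.swap)"
    by (rule orthogonal_transformation_compose[OF L(1) orthogonal_swap])
  moreover have "(L \<circ> prod.swap) ` S2S2 = S2S2"
    unfolding image_comp[symmetric] image_swap_S2S2 by (rule L(2))
  ultimately have "congruent_S2S2 (\<Phi> ` topspace M) ((L \<circ> prod.swap) ` \<Phi> ` topspace M)"
    unfolding congruent_S2S2_def using isometry_orthogonal by blast
  with r L(3) show ?thesis unfolding e by blast
qed

end

section \<open>Both components of the normal are nonzero\<close>

locale parallel_cmc_angle = parallel_cmc +
  fixes a b :: real
  assumes pos: "a > 0" "b > 0"
    and norm_E: "\<And>z. z \<in> topspace M \<Longrightarrow> norm (E z) = a" and norm_G: "\<And>z. z \<in> topspace M \<Longrightarrow> norm (G z) = b"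
begin

lemma angle: assumes c: "c \<in> A" shows "constant_angle (coords c) (pc c) (qc c) (mc c) (nc c) a b"
proof -
  interpret local_hypersurface "coords c" "pc c" "qc c" "mc c" "nc c" by (rule local_coords[OF c])
  show ?thesis
    by unfold_locales (use pos norm_E norm_G in_space[OF c] in \<open>auto simp: mc_def nc_def\<close>)
qed

lemma nonzero: "c \<in> A \<Longrightarrow> x \<in> coords c \<Longrightarrow> mc c x \<noteq> 0" "c \<in> A \<Longrightarrow> x \<in> coords c \<Longrightarrow> nc c x \<noteq> 0"
  using constant_angle.nonzero_mn[OF angle] by blast+

lemma side_const:
  assumes t: "t \<in> {-\<epsilon><..<\<epsilon>}" and "z \<in> topspace M" "w \<in> topspace M"
  shows "side t w = side t z"
proof (rule connected_locally_const[OF con _ assms(2,3)])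
  fix z assume z: "z \<in> topspace M"
  obtain c where c: "c \<in> A" "z \<in> fst c" by (rule covered[OF z])
  have x: "snd c z \<in> coords c" using c by auto
  have iz: "chart_inv c (snd c z) = z" by (rule chart_inv_chart[OF chart[OF c(1)] c(2)])
  obtain V where V: "open V" "snd c z \<in> V"
    "\<And>t y. t \<in> {-\<epsilon><..<\<epsilon>} \<Longrightarrow> y \<in> V \<Longrightarrow> side t (chart_inv c y) = side t (chart_inv c (snd c z))"
    by (rule side_locally_const[OF c(1) x nonzero[OF c(1) x]], rule that)
  then show "locally_const_at M (side t) z"
    using t by (intro locally_const_chartI[OF chart[OF c(1)] c(2) V(1,2)]) (simp add: iz)
qed

abbreviation "s1c c \<equiv> constant_angle.s1 (pc c) (qc c) (mc c) (nc c) a"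
abbreviation "s2c c \<equiv> constant_angle.s2 (pc c) (qc c) (mc c) (nc c) a"
abbreviation "r1c c \<equiv> constant_angle.r1 (pc c) (qc c) (mc c) (nc c) b"
abbreviation "r2c c \<equiv> constant_angle.r2 (pc c) (qc c) (mc c) (nc c) b"

text \<open>Normalised Jacobians agree at any two points, so the differences of their coefficients
  satisfy the hypothesis of \<open>trig_mix_zero\<close>. The weaker outcome for
  \<open>a = b\<close> is inherited from there.\<close>

lemma curvatures_eq:
  assumes c: "c \<in> A" and x: "x \<in> coords c" and d: "d \<in> A" and x': "x' \<in> coords d"
  shows "s1c c x + r2c c x = s1c d x' + r2c d x'"
    "s1c c x * r2c c x - s2c c x * r1c c x = s1c d x' * r2c d x' - s2c d x' * r1c d x'"
    "a \<noteq> b \<Longrightarrow> s1c c x = s1c d x'" "a \<noteq> b \<Longrightarrow> r2c c x = r2c d x'"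
proof -
  interpret C: constant_angle "coords c" "pc c" "qc c" "mc c" "nc c" a b by (rule angle[OF c])
  interpret D: constant_angle "coords d" "pc d" "qc d" "mc d" "nc d" a b by (rule angle[OF d])
  let ?\<alpha> = "C.s1 x - D.s1 x'" and ?\<beta> = "C.r2 x - D.r2 x'"
  let ?\<gamma> = "(C.s1 x * C.r2 x - C.s2 x * C.r1 x) - (D.s1 x' * D.r2 x' - D.s2 x' * D.r1 x')"
  have z: "?\<alpha> * (sin (a * t) * cos (b * t)) + ?\<beta> * (cos (a * t) * sin (b * t)) + ?\<gamma> * (sin (a * t) * sin (b * t)) = 0"
    if t: "t \<in> {-\<epsilon><..<\<epsilon>}" for t
  proof -
    have "C.vol x t / C.vol x 0 = D.vol x' t / D.vol x' 0"
      by (rule vol_ratio_eq[OF c x nonzero[OF c x] d x' nonzero[OF d x'] side_const t])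
        (use in_space c x d x' in auto)
    then show ?thesis
      unfolding C.Delta_vol[OF x, symmetric] D.Delta_vol[OF x', symmetric]
        C.vol_constant_angle[OF x, of t] D.vol_constant_angle[OF x', of t]
        nonzero_mult_div_cancel_left[OF C.Delta_nonzero[OF x]] nonzero_mult_div_cancel_left[OF D.Delta_nonzero[OF x']]
      by (simp add: algebra_simps)
  qed
  have tz: "?\<alpha> + ?\<beta> = 0" "?\<gamma> = 0" "a \<noteq> b \<Longrightarrow> ?\<alpha> = 0"
    using trig_mix_zero[OF pos eps, of ?\<alpha> ?\<beta> ?\<gamma>] z by simp_all
  show "s1c c x + r2c c x = s1c d x' + r2c d x'" using tz(1) by simp
  show "s1c c x * r2c c x - s2c c x * r1c c x = s1c d x' * r2c d x' - s2c d x' * r1c d x'" using tz(2) by simp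
  show "s1c c x = s1c d x'" "r2c c x = r2c d x'" if "a \<noteq> b" using tz(1) tz(3)[OF that] by simp_all
qed

lemma some_chart: obtains c x where "c \<in> A" "x \<in> coords c"
proof -
  obtain z where z: "z \<in> topspace M" using ne by blast
  obtain c where c: "c \<in> A" "z \<in> fst c" by (rule covered[OF z])
  show ?thesis by (rule that[of c "snd c z"]) (use c in auto)
qed

lemma equal_radii: "a = b"
proof (rule ccontr)
  assume ab: "a \<noteq> b"
  obtain c x where c: "c \<in> A" and x: "x \<in> coords c" by (rule some_chart)
  interpret constant_angle "coords c" "pc c" "qc c" "mc c" "nc c" a b by (rule angle[OF c])
  show False
    by (rule different_radii_impossible[OF U subset_refl x ab])
      (use curvatures_eq[OF c _ c x] ab in blast)+
qed

lemma curvatures: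
  obtains k where "\<And>c x. c \<in> A \<Longrightarrow> x \<in> coords c \<Longrightarrow>
    s1c c x = k \<and> r2c c x = k \<and> r1c c x = s2c c x \<and> (s2c c x)\<^sup>2 = 1 + k\<^sup>2"
proof -
  obtain d x' where d: "d \<in> A" and x': "x' \<in> coords d" by (rule some_chart)
  let ?h = "s1c d x' + r2c d x'"
  show ?thesis
  proof (rule that[of "?h / 2"])
    fix c x assume c: "c \<in> A" and x: "x \<in> coords c"
    interpret constant_angle "coords c" "pc c" "qc c" "mc c" "nc c" a b by (rule angle[OF c])
    note e = equal_radii_curvatures[OF U subset_refl x equal_radii, of ?h,
        OF curvatures_eq(1)[OF c _ d x'] curvatures_eq(2)[OF c _ d x']]
    show "s1c c x = ?h / 2 \<and> r2c c x = ?h / 2 \<and> r1c c x = s2c c x \<and> (s2c c x)\<^sup>2 = 1 + (?h / 2)\<^sup>2"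
      by (intro conjI e)
  qed
qed

text \<open>The map \<open>rot\<close> expressed through \<Phi> and \<open>N\<close> alone, so that
  it is a function on \<open>M\<close> and different charts can be compared.\<close>

definition rotG :: "real \<Rightarrow> real \<Rightarrow> 'a \<Rightarrow> real^3 \<Rightarrow> real^3" where
  "rotG k \<delta> z = (\<lambda>w. (w \<bullet> Q z) *\<^sub>R (constant_angle.cos_angle k *\<^sub>R P z + constant_angle.sin_angle k *\<^sub>R (E z /\<^sub>R a))
    + (w \<bullet> (G z /\<^sub>R b)) *\<^sub>R (constant_angle.sin_angle k *\<^sub>R P z - constant_angle.cos_angle k *\<^sub>R (E z /\<^sub>R a))
    + (\<delta> * (w \<bullet> cross3 (Q z) (sgn (G z)))) *\<^sub>R cross3 (P z) (sgn (E z)))"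

end

lemma locally_const_at_open:
  assumes "locally_const_at M f z"
  obtains G where "openin M G" "z \<in> G" "\<And>w. w \<in> G \<Longrightarrow> locally_const_at M f w"
proof -
  obtain G where G: "openin M G" "z \<in> G" "\<forall>w\<in>G. f w = f z"
    using assms unfolding locally_const_at_def by blast
  have "locally_const_at M f w" if "w \<in> G" for w
  proof -
    have "\<forall>v\<in>G. f v = f w" using G(3) that by metis
    with G(1) that show ?thesis unfolding locally_const_at_def by blast
  qed
  then show ?thesis by (rule that[OF G(1,2)])
qed

context parallel_cmc_angle begin

lemma rotG_coords:
  assumes c: "c \<in> A"
  shows "constant_angle.rot (pc c) (qc c) (mc c) (nc c) a b \<delta> k x w = rotG k \<delta> (chart_inv c x) w"
proof -
  interpret constant_angle "coords c" "pc c" "qc c" "mc c" "nc c" a b by (rule angle[OF c])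
  show ?thesis
    by (simp add: rot_def rotG_def n1_def n2_def u1_def u2_def pc_def qc_def mc_def nc_def)
qed

text \<open>In a ball \<open>s2\<close> is continuous with constant nonzero square, so its sign
  \<delta> is constant there and \<open>rot\<close> with this sign is stationary. At this stage the
  sign is known only near \<open>z\<close>.\<close>

lemma rotG_locally_const:
  assumes k: "\<And>c x. c \<in> A \<Longrightarrow> x \<in> coords c \<Longrightarrow>
    s1c c x = k \<and> r2c c x = k \<and> r1c c x = s2c c x \<and> (s2c c x)\<^sup>2 = 1 + k\<^sup>2"
    and z: "z \<in> topspace M"
  shows "\<exists>\<delta>\<in>{1, -1}. locally_const_at M (rotG k \<delta>) z"
proof -
  obtain c where c: "c \<in> A" "z \<in> fst c" by (rule covered[OF z])
  have x: "snd c z \<in> coords c" using c by auto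
  have iz: "chart_inv c (snd c z) = z" by (rule chart_inv_chart[OF chart[OF c(1)] c(2)])
  interpret constant_angle "coords c" "pc c" "qc c" "mc c" "nc c" a b by (rule angle[OF c(1)])
  obtain e where e: "e > 0" "ball (snd c z) e \<subseteq> coords c" using U x by (rule openE)
  have kk: "s1 y = k" "r2 y = k" "r1 y = s2 y" "(s2 y)\<^sup>2 = 1 + k\<^sup>2" if "y \<in> ball (snd c z) e" for y
    using k[OF c(1) subsetD[OF e(2) that]] by simp_all
  let ?\<rho> = "sqrt (1 + k\<^sup>2)"
  have \<rho>: "?\<rho> > 0" "?\<rho>\<^sup>2 = 1 + k\<^sup>2" by (simp_all add: add_pos_nonneg)
  have "continuous_on (ball (snd c z) e) s2"
  proof (rule continuous_at_imp_continuous_on, intro ballI)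
    fix y assume y: "y \<in> ball (snd c z) e"
    obtain s1' s2' r2' where "(s2 has_derivative s2') (at y)" by (rule Codazzi[OF subsetD[OF e(2) y]])
    then show "isCont s2 y" by (rule has_derivative_continuous)
  qed
  then have cs: "continuous_on (ball (snd c z) e) (\<lambda>y. s2 y / ?\<rho>)"
    by (rule continuous_on_divide) (use \<rho> in auto)
  have sq: "(s2 y / ?\<rho>)\<^sup>2 = 1" if "y \<in> ball (snd c z) e" for y
    using kk(4)[OF that] \<rho> by (simp add: power_divide)
  define \<delta> where "\<delta> = s2 (snd c z) / ?\<rho>"
  have z0: "snd c z \<in> ball (snd c z) e" using e by simp
  have d: "\<delta> * \<delta> = 1" using sq[OF z0] unfolding \<delta>_def power2_eq_square .
  have s2: "s2 y = \<delta> * ?\<rho>" if "y \<in> ball (snd c z) e" for y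
    using connected_square_one_const[OF connected_ball cs sq that z0] \<rho> by (simp add: \<delta>_def field_simps)
  have rc: "rot \<delta> k y w = rot \<delta> k (snd c z) w" if y: "y \<in> ball (snd c z) e" for y w
  proof -
    have "\<exists>v. \<forall>y\<in>ball (snd c z) e. rot \<delta> k y w = v"
    proof (rule has_derivative_zero_constant[OF convex_ball])
      fix y assume y: "y \<in> ball (snd c z) e"
      show "((\<lambda>y. rot \<delta> k y w) has_derivative (\<lambda>h. 0)) (at y within ball (snd c z) e)"
        by (rule has_derivative_at_withinI[OF rot_stationary[OF subsetD[OF e(2) y] d equal_radii kk(1,2,3)[OF y] s2[OF y]]])
    qed
    then show ?thesis using y z0 by metis
  qed
  have "locally_const_at M (rotG k \<delta>) z"
  proof (rule locally_const_chartI[OF chart[OF c(1)] c(2) open_ball z0])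
    fix y assume "y \<in> ball (snd c z) e"
    from rc[OF this] show "rotG k \<delta> (chart_inv c y) = rotG k \<delta> z"
      unfolding rotG_coords[OF c(1)] iz by (rule ext)
  qed
  moreover have "\<delta> = 1 \<or> \<delta> = -1" using d by (simp add: square_eq_1_iff)
  ultimately show ?thesis by auto
qed

text \<open>This spares comparing the signs of \<open>s2\<close> between charts: it is enough for
  gluing that one sign excludes the other.\<close>

lemma rotG_not_both:
  assumes z: "z \<in> topspace M" and l: "locally_const_at M (rotG k 1) z" "locally_const_at M (rotG k (-1)) z"
  shows False
proof -
  obtain c where c: "c \<in> A" "z \<in> fst c" by (rule covered[OF z])
  have x: "snd c z \<in> coords c" using c by auto
  have iz: "chart_inv c (snd c z) = z" by (rule chart_inv_chart[OF chart[OF c(1)] c(2)])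
  interpret constant_angle "coords c" "pc c" "qc c" "mc c" "nc c" a b by (rule angle[OF c(1)])
  obtain V where V: "open V" "V \<subseteq> coords c" "snd c z \<in> V" "\<And>y. y \<in> V \<Longrightarrow> rotG k 1 (chart_inv c y) = rotG k 1 z"
    by (rule locally_const_chartD[OF chart[OF c(1)] c(2) l(1)], rule that)
  obtain V' where V': "open V'" "V' \<subseteq> coords c" "snd c z \<in> V'" "\<And>y. y \<in> V' \<Longrightarrow> rotG k (-1) (chart_inv c y) = rotG k (-1) z"
    by (rule locally_const_chartD[OF chart[OF c(1)] c(2) l(2)], rule that)
  show False
    by (rule rot_sign_unique[of "V \<inter> V'" "snd c z" k])
      (use V V' x in \<open>simp_all add: rotG_coords[OF c(1)] iz open_Int\<close>)
qed

text \<open>The truth value of local constancy for the sign 1 is itself locally constant: where it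
  holds it holds nearby, and where it fails the sign - 1 works nearby and excludes it. Connectedness
  selects one sign, and then makes the map constant.\<close>

lemma rotG_const:
  assumes k: "\<And>c x. c \<in> A \<Longrightarrow> x \<in> coords c \<Longrightarrow>
    s1c c x = k \<and> r2c c x = k \<and> r1c c x = s2c c x \<and> (s2c c x)\<^sup>2 = 1 + k\<^sup>2"
  obtains \<delta> R where "\<delta> * \<delta> = 1" "\<And>z. z \<in> topspace M \<Longrightarrow> rotG k \<delta> z = R"
proof -
  let ?L = "\<lambda>\<delta> z. locally_const_at M (rotG k \<delta>) z"
  have L: "?L 1 z \<or> ?L (-1) z" if "z \<in> topspace M" for z using rotG_locally_const[OF k that] by blast
  have lc: "locally_const_at M (?L 1) z" if z: "z \<in> topspace M" for z
  proof (cases "?L 1 z")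
    case True
    obtain G where G: "openin M G" "z \<in> G" "\<And>w. w \<in> G \<Longrightarrow> ?L 1 w" by (rule locally_const_at_open[OF True], rule that)
    show ?thesis unfolding locally_const_at_def[of M "?L 1"] by (rule exI[of _ G]) (simp add: G True)
  next
    case False
    then have m: "?L (-1) z" using L[OF z] by blast
    obtain G where G: "openin M G" "z \<in> G" "\<And>w. w \<in> G \<Longrightarrow> ?L (-1) w" by (rule locally_const_at_open[OF m], rule that)
    have "\<not> ?L 1 w" if "w \<in> G" for w
      using rotG_not_both[OF subsetD[OF openin_subset[OF G(1)] that] _ G(3)[OF that]] by blast
    then show ?thesis unfolding locally_const_at_def[of M "?L 1"] by (intro exI[of _ G]) (simp add: G False)
  qed
  obtain z0 where z0: "z0 \<in> topspace M" using ne by blast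
  have same: "?L 1 z = ?L 1 z0" if "z \<in> topspace M" for z
    by (rule connected_locally_const[OF con lc z0 that])
  show ?thesis
  proof (cases "?L 1 z0")
    case True
    then have "?L 1 z" if "z \<in> topspace M" for z using same[OF that] by simp
    then show ?thesis
      by (intro that[of 1 "rotG k 1 z0"] connected_locally_const[OF con _ z0]) simp_all
  next
    case False
    then have "?L (-1) z" if "z \<in> topspace M" for z using same[OF that] L[OF that] by simp
    then show ?thesis
      by (intro that[of "-1" "rotG k (-1) z0"] connected_locally_const[OF con _ z0]) simp_all
  qed
qed

lemma angle_result:
  "\<exists>t\<in>{-1<..<1}. \<exists>W. openin (top_of_set (M_hyp t)) W \<and> congruent_S2S2 (\<Phi> ` topspace M) W"
proof -
  obtain k where k: "\<And>c x. c \<in> A \<Longrightarrow> x \<in> coords c \<Longrightarrow>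
    s1c c x = k \<and> r2c c x = k \<and> r1c c x = s2c c x \<and> (s2c c x)\<^sup>2 = 1 + k\<^sup>2" using curvatures by blast
  obtain \<delta> R where d: "\<delta> * \<delta> = 1" and RR: "\<And>z. z \<in> topspace M \<Longrightarrow> rotG k \<delta> z = R"
    by (rule rotG_const[of k], rule k, assumption, assumption, rule that)
  obtain c0 x0 where c0: "c0 \<in> A" "x0 \<in> coords c0" by (rule some_chart)
  interpret C0: constant_angle "coords c0" "pc c0" "qc c0" "mc c0" "nc c0" a b by (rule angle[OF c0(1)])
  \<comment> \<open>The level is the cosine of the angle between \<open>p\<close> and
    \<open>R q\<close>, which is fixed by \<open>k\<close>.\<close>
  define t where "t = C0.cos_angle k"
  have t: "t \<in> {-1<..<1}" unfolding t_def by (rule C0.angle_facts)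
  have rot: "constant_angle.rot (pc c) (qc c) (mc c) (nc c) a b \<delta> k x = R" if c: "c \<in> A" and x: "x \<in> coords c" for c x
    using rotG_coords[OF c, of \<delta> k x] RR[OF in_space[OF c x]] by (simp add: fun_eq_iff)
  have oR: "orthogonal_transformation R"
    using C0.rot_orthogonal(1)[OF c0(2) d, of k] unfolding rot[OF c0] .
  have lR: "linear R" using oR by (simp add: orthogonal_transformation_def)
  let ?Z = "{z \<in> S2S2. fst z \<bullet> R (snd z) = t}"
  have loc: "\<Phi> z \<in> ?Z \<and> (\<exists>V. open V \<and> \<Phi> z \<in> V \<and> V \<inter> ?Z \<subseteq> \<Phi> ` topspace M)" if z: "z \<in> topspace M" for z
  proof -
    obtain c where c: "c \<in> A" "z \<in> fst c" by (rule covered[OF z])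
    have x: "snd c z \<in> coords c" using c by auto
    have iz: "chart_inv c (snd c z) = z" by (rule chart_inv_chart[OF chart[OF c(1)] c(2)])
    interpret constant_angle "coords c" "pc c" "qc c" "mc c" "nc c" a b by (rule angle[OF c(1)])
    have pq: "(pc c y, qc c y) = \<Phi> (chart_inv c y)" for y by (simp add: comp_defs)
    have e: "pc c y \<bullet> R (qc c y) = t" if "y \<in> coords c" for y
      using rot_orthogonal(2)[OF that d, of k] unfolding rot[OF c(1) that] t_def .
    have "\<exists>V. open V \<and> (pc c (snd c z), qc c (snd c z)) \<in> V \<and>
      (\<forall>y\<in>V. y \<in> S2S2 \<longrightarrow> fst y \<bullet> R (snd y) + fst y \<bullet> 0 = t \<longrightarrow> y \<in> (\<lambda>y. (pc c y, qc c y)) ` coords c)"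
    proof (rule level_set_open[OF x lR])
      fix w1 w2 assume w: "w1 \<bullet> pc c (snd c z) = 0" "w2 \<bullet> qc c (snd c z) = 0"
        "w1 \<bullet> R (qc c (snd c z)) + pc c (snd c z) \<bullet> R w2 + w1 \<bullet> 0 = 0"
      show "w1 \<bullet> mc c (snd c z) + w2 \<bullet> nc c (snd c z) = 0"
        by (rule rot_orthogonal(3)[where k=k, OF x d w(1,2) _ equal_radii]) (use w(3) in \<open>simp add: rot[OF c(1) x]\<close>)
    qed (simp add: e)
    then obtain V where V: "open V" "\<Phi> z \<in> V"
      "\<forall>y\<in>V. y \<in> S2S2 \<longrightarrow> fst y \<bullet> R (snd y) + fst y \<bullet> 0 = t \<longrightarrow> y \<in> (\<lambda>y. \<Phi> (chart_inv c y)) ` coords c"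
      unfolding pq iz by blast
    have "V \<inter> ?Z \<subseteq> \<Phi> ` topspace M"
    proof
      fix y assume "y \<in> V \<inter> ?Z"
      then have "y \<in> (\<lambda>y. \<Phi> (chart_inv c y)) ` coords c" using V(3) by simp
      then obtain v where "v \<in> coords c" "y = \<Phi> (chart_inv c v)" by blast
      then show "y \<in> \<Phi> ` topspace M" using in_space[OF c(1)] by blast
    qed
    moreover have "\<Phi> z \<in> S2S2" using hyp z unfolding hypersurface_def by blast
    moreover have "fst (\<Phi> z) \<bullet> R (snd (\<Phi> z)) = t" using e[OF x] by (simp add: comp_defs iz)
    ultimately show ?thesis using V(1,2) by (intro conjI exI[of _ V]) simp_all
  qed
  \<comment> \<open>Applying \<open>R\<close> to the second factor alone turns the level set of
    \<open>p \<bullet> R q\<close> into \<open>M_hyp t\<close>.\<close>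
  define L :: "R6 \<Rightarrow> R6" where "L = (\<lambda>z. (id (fst z), R (snd z)))"
  have oid: "orthogonal_transformation (id :: real^3 \<Rightarrow> real^3)" by (simp add: orthogonal_transformation_id id_def)
  note L = orthogonal_product_map[OF oid oR, folded L_def]
  have Z: "L ` ?Z = M_hyp t"
  proof
    show "L ` ?Z \<subseteq> M_hyp t"
    proof
      fix y assume "y \<in> L ` ?Z"
      then obtain z where z: "z \<in> S2S2" "fst z \<bullet> R (snd z) = t" "y = L z" by blast
      then have "y \<in> S2S2" using L(2) by blast
      with z show "y \<in> M_hyp t" by (simp add: M_hyp_def L_def)
    qed
    show "M_hyp t \<subseteq> L ` ?Z"
    proof
      fix y assume y: "y \<in> M_hyp t"
      then have "y \<in> L ` S2S2" unfolding L(2) by (auto simp: M_hyp_def)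
      then obtain z where z: "z \<in> S2S2" "y = L z" by blast
      with y have "fst z \<bullet> R (snd z) = t" by (simp add: M_hyp_def L_def)
      with z show "y \<in> L ` ?Z" by blast
    qed
  qed
  have "openin (top_of_set (L ` ?Z)) (L ` \<Phi> ` topspace M)"
  proof (rule orthogonal_image_open[OF L(1)])
    show "\<Phi> ` topspace M \<subseteq> ?Z" using loc by blast
    show "\<exists>V. open V \<and> y \<in> V \<and> V \<inter> ?Z \<subseteq> \<Phi> ` topspace M" if "y \<in> \<Phi> ` topspace M" for y
      using that loc by (elim imageE) simp
  qed
  moreover have "congruent_S2S2 (\<Phi> ` topspace M) (L ` \<Phi> ` topspace M)"
    unfolding congruent_S2S2_def using isometry_orthogonal[OF L] by blast
  ultimately show ?thesis using t unfolding Z by blast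
qed

end

section \<open>Distinction by the components of the normal at one point\<close>

theorem theorem2:
  fixes M :: "'a topology" and A :: "'a chart set"
    and \<Phi> N :: "'a \<Rightarrow> (real^3) \<times> (real^3)" and \<epsilon> :: real
  assumes "hypersurface M A \<Phi>"
    and "connected_space M"
    and "orientable_manifold M A"
    and "unit_normal_field M A \<Phi> N"
    and "\<epsilon> > 0"
    and "\<And>t. t \<in> {-\<epsilon><..<\<epsilon>} \<Longrightarrow> hypersurface M A (parallel_hypersurface \<Phi> N t)"
    and "\<And>t. t \<in> {-\<epsilon><..<\<epsilon>} \<Longrightarrow> constant_mean_curvature M A (parallel_hypersurface \<Phi> N t)"
  shows "(\<exists>r\<in>{0<..1}. \<exists>W. openin (top_of_set (circle_S1 r \<times> sphere 0 1)) W \<and>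
            congruent_S2S2 (\<Phi> ` topspace M) W) \<or>
         (\<exists>t\<in>{-1<..<1}. \<exists>W. openin (top_of_set (M_hyp t)) W \<and>
            congruent_S2S2 (\<Phi> ` topspace M) W)"
proof (cases "topspace M = {}")
  case True
  \<comment> \<open>The empty space counts as connected; its image is the empty open subset of
    \<open>M_hyp 0\<close>.\<close>
  have "isometry_S2S2 (\<lambda>z. z)" by (rule isometry_orthogonal[OF orthogonal_transformation_id]) simp
  then have "congruent_S2S2 (\<Phi> ` topspace M) {}" unfolding congruent_S2S2_def True by auto
  then show ?thesis by (intro disjI2 bexI[of _ 0] exI[of _ "{}"]) auto
next
  case False
  \<comment> \<open>The bound on \<open>t\<close> stands inside the existential, so that choice
    yields functions of all real \<open>t\<close>.\<close>
  have "\<forall>t. \<exists>N' H. t \<in> {-\<epsilon><..<\<epsilon>} \<longrightarrow> unit_normal_field M A (parallel_hypersurface \<Phi> N t) N' \<and>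
      (\<forall>c\<in>A. \<forall>p\<in>fst c. mean_curvature c (parallel_hypersurface \<Phi> N t) N' p = H)"
    using assms(7) unfolding constant_mean_curvature_def by blast
  then obtain N' H where NH: "\<And>t. t \<in> {-\<epsilon><..<\<epsilon>} \<Longrightarrow> unit_normal_field M A (parallel_hypersurface \<Phi> N t) (N' t) \<and>
      (\<forall>c\<in>A. \<forall>p\<in>fst c. mean_curvature c (parallel_hypersurface \<Phi> N t) (N' t) p = H t)"
    by metis
  interpret parallel_cmc M A \<Phi> N \<epsilon> N' H
    by unfold_locales (use assms False NH in auto)
  obtain z0 where z0: "z0 \<in> topspace M" using False by blast
  \<comment> \<open>One point suffices for the distinction, since both norms are constant on
    \<open>M\<close>.\<close>
  consider "E z0 = 0" | "G z0 = 0" | "norm (E z0) > 0" "norm (G z0) > 0" by auto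
  then show ?thesis
  proof cases
    case 1
    then have "E z = 0" if "z \<in> topspace M" for z using norm_E_const[OF z0 that] by simp
    then show ?thesis using product_result2 by blast
  next
    case 2
    then have "G z = 0" if "z \<in> topspace M" for z using norm_G_const[OF z0 that] by simp
    then show ?thesis using product_result1 by blast
  next
    case 3
    interpret parallel_cmc_angle M A \<Phi> N \<epsilon> N' H "norm (E z0)" "norm (G z0)"
      by unfold_locales (use 3 norm_E_const[OF z0] norm_G_const[OF z0] in auto)
    show ?thesis using angle_result by blast
  qed
qed

end
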